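(* Let $(E,\rho)$ be a weighted space and $(P(t))_{t\ge0}$ a generalized Feller semigroup on $\mathscr{B}^\rho(E)$ with $P(t)1=1$ for all $t$, with generator $A$, and let $M\ge1$, $\omega\in\mathbb{R}$ satisfy $\|P(t)\|\le Me^{\omega t}$ for all $t\ge0$. Let $\nu\in\mathcal{M}^\rho(E)$ be a probability measure and let $(\lambda_t)$, $\mathbb{P}_\nu$, $(\mathcal{F}_t)$ be the canonical process, probability measure and complete right-continuous filtration on $(E^{\mathbb{R}_+},\mathcal{B}(E)^{\mathbb{R}_+})$ for which $\lambda$ is adapted, $\mathbb{P}_\nu\circ\lambda_0^{-1}=\nu$ and $\mathbb{E}_\nu[f(\lambda_t)\mid\mathcal{F}_s]=P(t-s)f(\lambda_s)$ a.s. for all $t\ge s\ge0$, $f\in\mathscr{B}^\rho(E)$. Then: (i) For every countable family $(f_n)_{n\in\mathbb{N}}\subset\mathscr{B}^\rho(E)$ there are processes $(\bar Z^{\beta,n}_t)_{t\ge0}$ with càdlàg paths, indexed by $n\in\mathbb{N}$ and integers $\beta>\omega$, such that for each $t\ge0$ there is a $\mathbb{P}_\nu$-null set $\mathcal{N}_t\in\mathcal{F}_0$ with $\beta R(\beta,A)f_n(\lambda_t)=\bar Z^{\beta,n}_t$ outside $\mathcal{N}_t$ for all such $n,\beta$. (ii) Suppose in addition $\rho$ is $\mathcal{B}_0(E)$-measurable and $M$ can be chosen equal to $1$. Then $(e^{-\omega t}\rho(\lambda_t))_{t\ge0}$ is an $(\mathcal{F}_t)$-supermartingale. If moreover $t\mapsto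 P(t)\rho(x)$ is continuous for $\nu$-a.e. $x\in E$, this supermartingale has a càdlàg version, and for every countable family $(f_n)\subset\mathscr{B}^\rho(E)$ there are càdlàg processes $(\overline{f_n(\lambda_t)})_{t\ge0}$ such that for each $t\ge0$ there is a null set $\mathcal{N}'_t\in\mathcal{F}_0$ with $f_n(\lambda_t)=\overline{f_n(\lambda_t)}$ outside $\mathcal{N}'_t$ for all $n$. (iii) If in addition to the assumptions of (ii) there exists a countable family $(f_n)\subset\mathscr{B}^\rho(E)$ of sequentially continuous functions that separates the points of $E$, then $(\lambda_t)$ has a version with càdlàg paths.
   Context: A weighted space is a pair $(E,\rho)$ where $E$ is a completely regular Hausdorff topological space and $\rho:E\to(0,\infty)$ is an admissible weight function, meaning that for every $R\ge 0$ the sublevel set $K_R:=\{x\in E:\rho(x)\le R\}$ is compact. For $f:E\to\mathbb{R}$ put $\|f\|_\rho:=\sup_{x\in E}|f(x)|/\rho(x)$; $\mathscr{B}^\rho(E)$ denotes the closure of $C_b(E)$ with respect to $\|\cdot\|_\rho$ inside $\{f:E\to\mathbb{R}:\|f\|_\rho<\infty\}$. A generalized Feller semigroup on $\mathscr{B}^\rho(E)$ is a family $(P(t))_{t\ge0}$ of bounded linear operators on $\mathscr{B}^\rho(E)$ such that (P1) $P(0)=\mathrm{Id}$; (P2) $P(t+s)=P(s)P(t)$ for all $s,t\ge0$; (P3) $\lim_{t\downarrow0}P(t)f(x)=f(x)$ for all $f\in\mathscr{B}^\rho(E)$, $x\in E$; (P4) there exist $\varepsilon>0$, $C<\infty$ with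 $\|P(t)\|_{L(\mathscr{B}^\rho(E))}\le C$ for all $t\in[0,\varepsilon]$; (P5) each $P(t)$ is a positive operator. Such a semigroup is strongly continuous on $\mathscr{B}^\rho(E)$; $A$ denotes its infinitesimal generator and $R(\beta,A)=(\beta-A)^{-1}=\int_0^\infty e^{-\beta s}P(s)\,ds$ its resolvent for $\beta>\omega$. For each $t,x$ there is a unique positive finite Radon measure $p(t)(x,\cdot)$ on $\mathcal{B}(E)$ with $P(t)f(x)=\int f\,dp(t)(x,\cdot)$ for $f\in\mathscr{B}^\rho(E)$, and $P(t)\rho(x):=\int_E\rho(y)\,p(t)(x,dy)=\sup\{|P(t)f(x)|: f\in C_b(E),|f|\le\rho\}$. $\mathcal{M}^\rho(E)$ is the set of signed Radon measures $\mu$ on $\mathcal{B}(E)$ with $\int\rho\,d|\mu|<\infty$; $\mathcal{B}_0(E)$ is the Baire σ-algebra (smallest σ-algebra making all bounded continuous functions measurable). A function $f$ is sequentially continuous if $x_m\to x$ implies $f(x_m)\to f(x)$. *)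

theory Defs
  imports "HOL-Analysis.Analysis" "HOL-Probability.Probability"
begin

definition admissible_weight :: "('a::topological_space \<Rightarrow> real) \<Rightarrow> bool" where
  "admissible_weight \<rho> \<longleftrightarrow> (\<forall>x. 0 < \<rho> x) \<and> (\<forall>R\<ge>0. compact {x. \<rho> x \<le> R})"

definition rho_bounded :: "('a \<Rightarrow> real) \<Rightarrow> ('a \<Rightarrow> real) \<Rightarrow> bool" where
  "rho_bounded \<rho> f \<longleftrightarrow> (\<exists>C. \<forall>x. \<bar>f x\<bar> \<le> C * \<rho> x)"

text \<open>The weighted sup-norm (only meaningful for rho-bounded f).\<close>
definition rho_norm :: "('a \<Rightarrow> real) \<Rightarrow> ('a \<Rightarrow> real) \<Rightarrow> real" where
  "rho_norm \<rho> f = (SUP x. \<bar>f x\<bar> / \<rho> x)"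

definition Cb :: "('a::topological_space \<Rightarrow> real) set" where
  "Cb = {f. continuous_on UNIV f \<and> bounded (range f)}"

definition Brho :: "('a::topological_space \<Rightarrow> real) \<Rightarrow> ('a \<Rightarrow> real) set" where
  "Brho \<rho> = {f. rho_bounded \<rho> f \<and> (\<forall>\<epsilon>>0. \<exists>g\<in>Cb. rho_norm \<rho> (\<lambda>x. f x - g x) < \<epsilon>)}"

definition gen_feller_semigroup ::
  "('a::topological_space \<Rightarrow> real) \<Rightarrow> (real \<Rightarrow> ('a \<Rightarrow> real) \<Rightarrow> ('a \<Rightarrow> real)) \<Rightarrow> bool" where
  "gen_feller_semigroup \<rho> P \<longleftrightarrow>
     (\<forall>t\<ge>0. \<forall>f\<in>Brho \<rho>. P t f \<in> Brho \<rho>) \<and>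
     (\<forall>t\<ge>0. \<forall>f\<in>Brho \<rho>. \<forall>g\<in>Brho \<rho>. \<forall>a b.
         P t (\<lambda>x. a * f x + b * g x) = (\<lambda>x. a * P t f x + b * P t g x)) \<and>
     (\<forall>t\<ge>0. \<exists>C. \<forall>f\<in>Brho \<rho>. rho_norm \<rho> (P t f) \<le> C * rho_norm \<rho> f) \<and>
     (\<forall>f\<in>Brho \<rho>. P 0 f = f) \<and>
     (\<forall>s\<ge>0. \<forall>t\<ge>0. \<forall>f\<in>Brho \<rho>. P (t + s) f = P s (P t f)) \<and>
     (\<forall>f\<in>Brho \<rho>. \<forall>x. ((\<lambda>t. P t f x) \<longlongrightarrow> f x) (at_right 0)) \<and>
     (\<exists>\<epsilon>>0. \<exists>C. \<forall>t\<in>{0..\<epsilon>}. \<forall>f\<in>Brho \<rho>. rho_norm \<rho> (P t f) \<le> C * rho_norm \<rho> f) \<and>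
     (\<forall>t\<ge>0. \<forall>f\<in>Brho \<rho>. (\<forall>x. 0 \<le> f x) \<longrightarrow> (\<forall>x. 0 \<le> P t f x))"

text \<open>Resolvent R(beta,A) f = int_0^infty e^(-beta s) P(s) f ds, evaluated pointwise
  (point evaluation is a continuous linear functional on B^rho, so this agrees with
  the Bochner integral in B^rho).\<close>
definition resolvent ::
  "(real \<Rightarrow> ('a \<Rightarrow> real) \<Rightarrow> ('a \<Rightarrow> real)) \<Rightarrow> real \<Rightarrow> ('a \<Rightarrow> real) \<Rightarrow> 'a \<Rightarrow> real" where
  "resolvent P \<beta> f x = (LBINT s:{0..}. exp (- \<beta> * s) * P s f x)"

definition P_rho ::
  "('a::topological_space \<Rightarrow> real) \<Rightarrow> (real \<Rightarrow> ('a \<Rightarrow> real) \<Rightarrow> ('a \<Rightarrow> real)) \<Rightarrow> real \<Rightarrow> 'a \<Rightarrow> real" where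
  "P_rho \<rho> P t x = (SUP f\<in>{f\<in>Cb. \<forall>y. \<bar>f y\<bar> \<le> \<rho> y}. \<bar>P t f x\<bar>)"

definition baire_sets :: "'a::topological_space set set" where
  "baire_sets = sigma_sets UNIV {f -` B | f B. f \<in> Cb \<and> B \<in> sets (borel :: real measure)}"

definition radon_measure :: "'a::topological_space measure \<Rightarrow> bool" where
  "radon_measure \<mu> \<longleftrightarrow> sets \<mu> = sets borel \<and>
     (\<forall>B\<in>sets borel. emeasure \<mu> B = (SUP K\<in>{K. compact K \<and> K \<subseteq> B}. emeasure \<mu> K)) \<and>
     (\<forall>x. \<exists>U. open U \<and> x \<in> U \<and> emeasure \<mu> U < \<infinity>)"

definition sequentially_continuous :: "('a::topological_space \<Rightarrow> 'b::topological_space) \<Rightarrow> bool" where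
  "sequentially_continuous f \<longleftrightarrow> (\<forall>xs x. xs \<longlonglongrightarrow> x \<longrightarrow> (\<lambda>m. f (xs m)) \<longlonglongrightarrow> f x)"

definition cadlag :: "(real \<Rightarrow> 'b::topological_space) \<Rightarrow> bool" where
  "cadlag g \<longleftrightarrow> (\<forall>t\<ge>0. (g \<longlongrightarrow> g t) (at_right t)) \<and> (\<forall>t>0. \<exists>l. (g \<longlongrightarrow> l) (at_left t))"

definition complete_rc_filtration :: "'w measure \<Rightarrow> (real \<Rightarrow> 'w measure) \<Rightarrow> bool" where
  "complete_rc_filtration M F \<longleftrightarrow>
     (\<forall>t\<ge>0. subalgebra M (F t)) \<and>
     (\<forall>s t. 0 \<le> s \<and> s \<le> t \<longrightarrow> sets (F s) \<subseteq> sets (F t)) \<and>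
     null_sets M \<subseteq> sets (F 0) \<and>
     (\<forall>t\<ge>0. sets (F t) = (\<Inter>s\<in>{t<..}. sets (F s)))"

definition supermartingale :: "'w measure \<Rightarrow> (real \<Rightarrow> 'w measure) \<Rightarrow> (real \<Rightarrow> 'w \<Rightarrow> real) \<Rightarrow> bool" where
  "supermartingale M F X \<longleftrightarrow>
     (\<forall>t\<ge>0. X t \<in> borel_measurable (F t) \<and> integrable M (X t)) \<and>
     (\<forall>s t. 0 \<le> s \<and> s \<le> t \<longrightarrow> (AE \<omega> in M. real_cond_exp M (F s) (X t) \<omega> \<le> X s \<omega>))"

end

(* For f >= 0 and beta > w the process exp(-beta t) R(beta,A)f(lambda_t) is a nonnegative
   supermartingale: by Tonelli and the Markov property its integral over a set A of F_s is the
   integral over v >= t of exp(-beta v) times the integral over A of P(v-s)f(lambda_s). Doob's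
   upcrossing inequality on dyadic grids yields left and right limits along dyadic times, and lower
   semicontinuity of the expectations identifies the right limit at t with the value at t; this
   gives (i).

   For (ii), a compact Baire set depends on countably many functions in C_b and hence is the zero
   set of a continuous function, so rho is an increasing limit of functions g_k in C_b. Monotone
   convergence extends P(t)g_k <= exp(w t) rho to the supermartingale property of
   exp(-w t) rho(lambda_t), and the right continuity of t -> P(t)g_k(x) makes the expectations lower
   semicontinuous. Convergence of rho along a path confines the path to a compact sublevel set of
   rho, on which every R(beta,A)f is continuous; since beta R(beta,A)f -> f pointwise, the limits
   of R(beta,A)f(lambda) for all beta determine that of f(lambda). The same compactness argument
   with a separating family in place of the resolvents gives (iii). *)

theory Submission
  imports Defs "HOL-Real_Asymp.Real_Asymp"
begin

section \<open>Paths along dyadic times\<close>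

text \<open>Events about all times of a path at once need not be measurable on a product over
  uncountably many times. Regularity is therefore asked along dyadic times only, and a modification
  is read off from right limits along these. The delicate point is that such a right limit
  \<open>Z\<close> at \<open>t\<close> does not fall short of the value there. Fatou's lemma bounds
  \<open>Z\<close> by the value; the reverse comparison of expectations would usually rest on
  uniform integrability. Here it comes from truncation at an earlier value being at most
  \<open>K\<close>, an event known to the filtration. Neither a metric nor sequences describe
  convergence in \<open>E\<close>. Limits of points are found as cluster points of filters in
  compact sublevel sets, and they are identified through the values that real functions take at
  them. For the weight the constant in the growth bound has to be exactly 1: a factor
  \<open>M > 1\<close> would remain in front of the earlier value and spoil the supermartingale
  inequality. In the resolvent case the integral over the future absorbs the constant, and only
  nonnegativity of \<open>f\<close> has to be arranged, by splitting into positive and negative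
  part.\<close>

definition dyadic :: "real set" where
  "dyadic = {real k / 2 ^ n | k n. True}"

abbreviation dright :: "real \<Rightarrow> real filter" where
  "dright t \<equiv> at t within (dyadic \<inter> {t<..})"

abbreviation dleft :: "real \<Rightarrow> real filter" where
  "dleft t \<equiv> at t within (dyadic \<inter> {..<t})"

lemma countable_dyadic: "countable dyadic"
proof -
  have "dyadic = (\<lambda>(k, n). real k / 2 ^ n) ` (UNIV :: (nat \<times> nat) set)"
    by (auto simp: dyadic_def)
  then show ?thesis by (metis countable_image countableI_type)
qed

lemma dyadic_nonneg: "q \<in> dyadic \<Longrightarrow> 0 \<le> q"
  by (auto simp: dyadic_def)

lemma zero_in_dyadic: "0 \<in> dyadic"
  unfolding dyadic_def by (intro CollectI exI[of _ "0::nat"]) simp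

text \<open>Refinement keeps the points of coarser grids, so finitely many dyadic times share a grid
  at every high level. Crossings found at arbitrary dyadic times can therefore be counted on
  grids.\<close>

lemma dyadic_level:
  assumes "p \<in> dyadic"
  shows "\<exists>m. \<forall>n\<ge>m. \<exists>i::nat. p = real i / 2 ^ n"
proof -
  obtain k m where p: "p = real k / 2 ^ m" using assms by (auto simp: dyadic_def)
  have "p = real (k * 2 ^ (n - m)) / 2 ^ n" if "n \<ge> m" for n
    using that by (simp add: p field_simps flip: power_add)
  then show ?thesis by blast
qed

lemma dyadic_dense:
  fixes s t :: real
  assumes "0 \<le> s" "s < t"
  shows "\<exists>q\<in>dyadic. s < q \<and> q < t"
proof -
  obtain n where n: "(1/2) ^ n < t - s"
    using real_arch_pow_inv[of "t - s" "1/2"] assms by auto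
  define k where "k = nat \<lfloor>s * 2 ^ n\<rfloor> + 1"
  have k: "real k = of_int \<lfloor>s * 2 ^ n\<rfloor> + 1" using assms by (simp add: k_def)
  have "s * 2 ^ n < real k" unfolding k by linarith
  moreover have "real k \<le> s * 2 ^ n + 1" unfolding k by linarith
  moreover have "s * 2 ^ n + 1 < t * 2 ^ n" using n by (simp add: field_simps power_divide)
  ultimately have "s < real k / 2 ^ n" "real k / 2 ^ n < t" by (auto simp: field_simps)
  then show ?thesis by (auto simp: dyadic_def)
qed

lemma eventually_dright:
  "eventually Q (dright t) \<longleftrightarrow> (\<exists>d>t. \<forall>q\<in>dyadic. t < q \<and> q < d \<longrightarrow> Q q)"
proof
  assume "eventually Q (dright t)"
  then obtain d where "d > 0" "\<forall>x\<in>dyadic \<inter> {t<..}. x \<noteq> t \<and> dist x t < d \<longrightarrow> Q x"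
    unfolding eventually_at by blast
  then show "\<exists>d>t. \<forall>q\<in>dyadic. t < q \<and> q < d \<longrightarrow> Q q"
    by (intro exI[of _ "t + d"]) (auto simp: dist_real_def)
next
  assume "\<exists>d>t. \<forall>q\<in>dyadic. t < q \<and> q < d \<longrightarrow> Q q"
  then obtain d where "d > t" "\<forall>q\<in>dyadic. t < q \<and> q < d \<longrightarrow> Q q" by blast
  then show "eventually Q (dright t)" unfolding eventually_at
    by (intro exI[of _ "d - t"]) (auto simp: dist_real_def)
qed

lemma eventually_dleft:
  "eventually Q (dleft t) \<longleftrightarrow> (\<exists>d<t. \<forall>q\<in>dyadic. d < q \<and> q < t \<longrightarrow> Q q)"
proof
  assume "eventually Q (dleft t)"
  then obtain d where "d > 0" "\<forall>x\<in>dyadic \<inter> {..<t}. x \<noteq> t \<and> dist x t < d \<longrightarrow> Q x"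
    unfolding eventually_at by blast
  then show "\<exists>d<t. \<forall>q\<in>dyadic. d < q \<and> q < t \<longrightarrow> Q q"
    by (intro exI[of _ "t - d"]) (auto simp: dist_real_def)
next
  assume "\<exists>d<t. \<forall>q\<in>dyadic. d < q \<and> q < t \<longrightarrow> Q q"
  then obtain d where "d < t" "\<forall>q\<in>dyadic. d < q \<and> q < t \<longrightarrow> Q q" by blast
  then show "eventually Q (dleft t)" unfolding eventually_at
    by (intro exI[of _ "t - d"]) (auto simp: dist_real_def)
qed

lemma dright_neq_bot:
  assumes "0 \<le> t" shows "dright t \<noteq> bot"
proof -
  have "\<exists>q\<in>dyadic. t < q \<and> q < d" if "t < d" for d
    using dyadic_dense[of t d] that assms by blast
  then show ?thesis unfolding trivial_limit_def eventually_dright by blast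
qed

lemma dleft_neq_bot:
  assumes "0 < t" shows "dleft t \<noteq> bot"
proof -
  have "\<exists>q\<in>dyadic. d < q \<and> q < t" if "d < t" for d
    using dyadic_dense[of "max 0 d" t] that assms by auto
  then show ?thesis unfolding trivial_limit_def eventually_dleft by blast
qed

text \<open>Fatou's lemma and dominated convergence need sequences. This one runs inside the filter,
  so for a regular path its limit is the limit along the filter.\<close>

lemma dright_sequence:
  assumes "0 \<le> t"
  obtains q :: "nat \<Rightarrow> real" where "\<And>n. q n \<in> dyadic" "\<And>n. t < q n"
    "q \<longlonglongrightarrow> t" "filterlim q (dright t) sequentially"
proof -
  have "\<exists>r\<in>dyadic. t < r \<and> r < t + 1 / real (Suc n)" for n
    using dyadic_dense[of t] assms by simp
  then obtain q where q: "\<And>n. q n \<in> dyadic" "\<And>n. t < q n" "\<And>n. q n < t + 1 / real (Suc n)"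
    by metis
  have "(\<lambda>n. t + 1 / real (Suc n)) \<longlonglongrightarrow> t + 0"
    by (intro tendsto_intros LIMSEQ_Suc lim_1_over_n)
  then have lim: "q \<longlonglongrightarrow> t"
    by (intro tendsto_sandwich[of "\<lambda>_. t" q sequentially "\<lambda>n. t + 1 / real (Suc n)"])
       (use q in \<open>auto intro!: always_eventually less_imp_le simp del: of_nat_Suc\<close>)
  have "filterlim q (dright t) sequentially"
    unfolding filterlim_at using lim q by (simp add: q less_imp_neq[OF q(2), symmetric])
  with q lim that show thesis by blast
qed

text \<open>Only the countably many values at dyadic times enter, and limits are merely asked to
  exist. That the right limit is the value at \<open>t\<close> is a separate statement, proved
  outside a null set that depends on \<open>t\<close>.\<close>

definition regular_path :: "(real \<Rightarrow> real) \<Rightarrow> bool" where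
  "regular_path g \<longleftrightarrow>
     (\<forall>t\<ge>0. \<exists>l. (g \<longlongrightarrow> l) (dright t)) \<and> (\<forall>t>0. \<exists>l. (g \<longlongrightarrow> l) (dleft t))"

definition right_lim :: "(real \<Rightarrow> real) \<Rightarrow> real \<Rightarrow> real" where
  "right_lim g t = Lim (dright t) g"

lemma right_limI: "0 \<le> t \<Longrightarrow> (g \<longlongrightarrow> l) (dright t) \<Longrightarrow> right_lim g t = l"
  unfolding right_lim_def by (intro tendsto_Lim dright_neq_bot)

lemma right_lim_tendsto:
  "regular_path g \<Longrightarrow> 0 \<le> t \<Longrightarrow> (g \<longlongrightarrow> right_lim g t) (dright t)"
  unfolding regular_path_def by (metis right_limI)

lemma right_lim_near:
  assumes g: "regular_path g" and s: "0 \<le> s" "s < d"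
    and near: "\<And>q. q \<in> dyadic \<Longrightarrow> s < q \<Longrightarrow> q < d \<Longrightarrow> \<bar>g q - l\<bar> < e"
  shows "\<bar>right_lim g s - l\<bar> \<le> e"
proof (rule tendsto_upperbound)
  show "((\<lambda>q. \<bar>g q - l\<bar>) \<longlongrightarrow> \<bar>right_lim g s - l\<bar>) (dright s)"
    by (intro tendsto_intros right_lim_tendsto g s)
  show "\<forall>\<^sub>F q in dright s. \<bar>g q - l\<bar> \<le> e"
    unfolding eventually_dright using s near by (intro exI[of _ d]) (auto intro: less_imp_le)
qed (use dright_neq_bot s in auto)

lemma cadlag_right_lim:
  assumes g: "regular_path g"
  shows "cadlag (right_lim g)"
  unfolding cadlag_def
proof (intro conjI allI impI)
  fix t :: real assume t: "0 \<le> t"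
  show "(right_lim g \<longlongrightarrow> right_lim g t) (at_right t)"
  proof (rule tendstoI)
    fix e :: real assume "0 < e"
    \<comment> \<open>Half of \<open>e\<close>, because \<open>right_lim_near\<close> turns the
      strict bound along dyadic times into a weak one for the limit.\<close>
    then have "\<forall>\<^sub>F q in dright t. \<bar>g q - right_lim g t\<bar> < e / 2"
      using tendstoD[OF right_lim_tendsto[OF g t], of "e / 2"] by (simp add: dist_real_def)
    then obtain d where d: "d > t" "\<And>q. q \<in> dyadic \<Longrightarrow> t < q \<Longrightarrow> q < d \<Longrightarrow> \<bar>g q - right_lim g t\<bar> < e / 2"
      unfolding eventually_dright by blast
    have "dist (right_lim g s) (right_lim g t) < e" if "t < s" "s < d" for s
    proof -
      have "\<bar>right_lim g s - right_lim g t\<bar> \<le> e / 2"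
        using t that d by (intro right_lim_near[OF g, of s d]) auto
      with \<open>0 < e\<close> show ?thesis by (simp add: dist_real_def)
    qed
    then show "\<forall>\<^sub>F s in at_right t. dist (right_lim g s) (right_lim g t) < e"
      unfolding eventually_at_right_field using d(1) by blast
  qed
next
  fix t :: real assume t: "0 < t"
  then obtain l where l: "(g \<longlongrightarrow> l) (dleft t)" using g by (auto simp: regular_path_def)
  have "(right_lim g \<longlongrightarrow> l) (at_left t)"
  proof (rule tendstoI)
    fix e :: real assume "0 < e"
    then have "\<forall>\<^sub>F q in dleft t. \<bar>g q - l\<bar> < e / 2"
      using tendstoD[OF l, of "e / 2"] by (simp add: dist_real_def)
    then obtain d where d: "d < t" "\<And>q. q \<in> dyadic \<Longrightarrow> d < q \<Longrightarrow> q < t \<Longrightarrow> \<bar>g q - l\<bar> < e / 2"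
      unfolding eventually_dleft by blast
    \<comment> \<open>\<open>max 0 d\<close> keeps \<open>s\<close> nonnegative, where the right
      limits along dyadic times are known to exist.\<close>
    have "dist (right_lim g s) l < e" if "max 0 d < s" "s < t" for s
    proof -
      have "\<bar>right_lim g s - l\<bar> \<le> e / 2"
        using that d by (intro right_lim_near[OF g, of s t]) auto
      with \<open>0 < e\<close> show ?thesis by (simp add: dist_real_def)
    qed
    then show "\<forall>\<^sub>F s in at_left t. dist (right_lim g s) l < e"
      unfolding eventually_at_left_field using d(1) t by (intro exI[of _ "max 0 d"]) auto
  qed
  then show "\<exists>l. (right_lim g \<longlongrightarrow> l) (at_left t)" by blast
qed

lemma cadlag_mult_continuous:
  fixes c g :: "real \<Rightarrow> real"
  assumes c: "continuous_on UNIV c" and g: "cadlag g"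
  shows "cadlag (\<lambda>t. c t * g t)"
  unfolding cadlag_def
proof (intro conjI allI impI)
  have lim: "(c \<longlongrightarrow> c t) (at t within S)" for t S
    using c by (metis UNIV_I continuous_on_def tendsto_within_subset subset_UNIV)
  show "((\<lambda>t. c t * g t) \<longlongrightarrow> c t * g t) (at_right t)" if "0 \<le> t" for t
    using g that by (intro tendsto_mult lim) (simp add: cadlag_def)
  fix t :: real assume "0 < t"
  then obtain l where "(g \<longlongrightarrow> l) (at_left t)" using g by (auto simp: cadlag_def)
  from tendsto_mult[OF lim this]
  show "\<exists>l. ((\<lambda>t. c t * g t) \<longlongrightarrow> l) (at_left t)" by blast
qed

lemma regular_path_diff:
  assumes "regular_path g" "regular_path h"
  shows "regular_path (\<lambda>t. g t - h t)"
proof -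
  have "\<exists>l. ((\<lambda>t. g t - h t) \<longlongrightarrow> l) Fi" if "\<exists>l. (g \<longlongrightarrow> l) Fi" "\<exists>l. (h \<longlongrightarrow> l) Fi" for Fi
    using that tendsto_diff by blast
  then show ?thesis using assms unfolding regular_path_def by simp
qed

lemma regular_path_mult_continuous:
  assumes "continuous_on UNIV c" "regular_path g"
  shows "regular_path (\<lambda>t. c t * g t)"
proof -
  have "(c \<longlongrightarrow> c t) (at t within S)" for t S
    using assms(1) by (metis UNIV_I continuous_on_def tendsto_within_subset subset_UNIV)
  then have "\<exists>l. ((\<lambda>t. c t * g t) \<longlongrightarrow> l) (at t within S)" if "\<exists>l. (g \<longlongrightarrow> l) (at t within S)" for t S
    using that tendsto_mult by blast
  then show ?thesis using assms(2) unfolding regular_path_def by simp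
qed

section \<open>Upcrossings of an interval and the gain of a trading strategy\<close>

text \<open>The strategy of buying when the price \<open>y\<close> is below \<open>a\<close> and selling when it exceeds \<open>b\<close>:
  \<open>hold\<close> tells whether the asset is held after time \<open>j\<close>.\<close>

fun hold :: "real \<Rightarrow> real \<Rightarrow> (nat \<Rightarrow> real) \<Rightarrow> nat \<Rightarrow> bool" where
  "hold a b y 0 \<longleftrightarrow> y 0 < a"
| "hold a b y (Suc j) \<longleftrightarrow> (if hold a b y j then y (Suc j) \<le> b else y (Suc j) < a)"

text \<open>Counts the sales of the strategy, that is, the completed upcrossings; a position still
  open is not counted.\<close>

fun upcr :: "real \<Rightarrow> real \<Rightarrow> (nat \<Rightarrow> real) \<Rightarrow> nat \<Rightarrow> nat" where
  "upcr a b y 0 = 0"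
| "upcr a b y (Suc j) = upcr a b y j + of_bool (hold a b y j \<and> b < y (Suc j))"

text \<open>The discrete stochastic integral of the strategy against the price.\<close>

definition gain :: "real \<Rightarrow> real \<Rightarrow> (nat \<Rightarrow> real) \<Rightarrow> nat \<Rightarrow> real" where
  "gain a b y n = (\<Sum>j<n. of_bool (hold a b y j) * (y (Suc j) - y j))"

text \<open>Every completed round trip earns more than \<open>b - a\<close>, and an asset held at
  time \<open>n\<close> was bought below \<open>a\<close>, so the open position has changed by at
  least \<open>y n - a\<close>. Carrying the second term along makes the induction close.\<close>

lemma gain_ge: "a < b \<Longrightarrow> (b - a) * upcr a b y n + of_bool (hold a b y n) * (y n - a) \<le> gain a b y n"
  by (induction n) (auto simp: gain_def algebra_simps)

text \<open>Nonnegativity of \<open>y n\<close> limits the loss of an open position to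
  \<open>a\<close>; this is the source of the bound \<open>a / (b - a)\<close> below.\<close>

lemma upcr_le_gain:
  assumes "0 \<le> a" "a < b" "0 \<le> y n"
  shows "(b - a) * upcr a b y n \<le> gain a b y n + a"
  using gain_ge[of a b y n] assms by (cases "hold a b y n") auto

lemma upcr_mono: "i \<le> j \<Longrightarrow> upcr a b y i \<le> upcr a b y j"
  by (rule lift_Suc_mono_le[of "upcr a b y"]) auto

lemma holdI: "a \<le> b \<Longrightarrow> y i < a \<Longrightarrow> hold a b y i"
  by (cases i) auto

lemma upcr_Suc_le:
  assumes "a \<le> b" "y i < a" "b < y j" "i < j"
  shows "Suc (upcr a b y i) \<le> upcr a b y j"
proof -
  \<comment> \<open>From time \<open>i\<close> on, either the asset has been held ever since or a
    sale has been counted meanwhile.\<close>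
  have *: "hold a b y k \<or> Suc (upcr a b y i) \<le> upcr a b y k" if "i \<le> k" for k
    using that
  proof (induction k rule: dec_induct)
    case base show ?case using holdI assms by blast
  next
    case (step k) then show ?case using upcr_mono[of i k a b y] by auto
  qed
  obtain k where k: "j = Suc k" "i \<le> k" using assms(4) by (cases j) auto
  show ?thesis using *[of k] k assms(3) upcr_mono[of i k a b y] by auto
qed

definition grid_upcr :: "(real \<Rightarrow> real) \<Rightarrow> real \<Rightarrow> real \<Rightarrow> nat \<Rightarrow> nat \<Rightarrow> nat" where
  "grid_upcr g a b T n = upcr a b (\<lambda>j. g (real j / 2 ^ n)) (T * 2 ^ n)"

text \<open>Successive crossings whose dyadic times may have any level. One-sided oscillation near a
  point produces such crossings without reference to a grid.\<close>

inductive crossings :: "(real \<Rightarrow> real) \<Rightarrow> real \<Rightarrow> real \<Rightarrow> nat \<Rightarrow> real \<Rightarrow> real \<Rightarrow> bool"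
  for g a b where
  zero: "s \<le> u \<Longrightarrow> crossings g a b 0 s u"
| step: "crossings g a b k s u \<Longrightarrow> u \<le> p \<Longrightarrow> p < q \<Longrightarrow> q \<le> v \<Longrightarrow> p \<in> dyadic \<Longrightarrow> q \<in> dyadic \<Longrightarrow>
    g p < a \<Longrightarrow> b < g q \<Longrightarrow> crossings g a b (Suc k) s v"

lemma crossings_mono_end: "crossings g a b k s u \<Longrightarrow> u \<le> v \<Longrightarrow> crossings g a b k s v"
proof (induction rule: crossings.induct)
  case (step k s u p q w)
  show ?case by (rule crossings.step[OF step.hyps(1-3)]) (use step in auto)
qed (auto intro: crossings.zero)

text \<open>The rules attach crossings at the late end only. When a time is approached from the
  right, each new crossing lies before those found so far and has to be put in front.\<close>

lemma crossings_append:
  assumes "crossings g a b m u' v" "crossings g a b k s u" "u \<le> u'"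
  shows "crossings g a b (m + k) s v"
  using assms
proof (induction rule: crossings.induct)
  case (zero u' v)
  then show ?case using crossings_mono_end[of g a b k s u v] by simp
next
  case (step m u' u'' p q v)
  show ?case unfolding add_Suc
    by (rule crossings.step[OF step.IH[OF step.prems]]) (use step in auto)
qed

text \<open>All times of finitely many crossings lie on the grids of high level, and there each
  crossing forces a sale by \<open>upcr_Suc_le\<close>. The level \<open>N\<close> depends on the
  crossings alone, not on the grid index \<open>j\<close>.\<close>

lemma crossings_upcr:
  assumes "crossings g a b k s u" "a \<le> b"
  shows "\<exists>N. \<forall>n\<ge>N. \<forall>j. u \<le> real j / 2 ^ n \<longrightarrow> k \<le> upcr a b (\<lambda>j. g (real j / 2 ^ n)) j"
  using assms(1)
proof (induction rule: crossings.induct)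
  case (step k s u p q v)
  obtain N where N: "\<And>n j. N \<le> n \<Longrightarrow> u \<le> real j / 2 ^ n \<Longrightarrow> k \<le> upcr a b (\<lambda>j. g (real j / 2 ^ n)) j"
    using step.IH by blast
  obtain N1 where N1: "\<And>n. N1 \<le> n \<Longrightarrow> \<exists>i::nat. p = real i / 2 ^ n" using dyadic_level step.hyps by metis
  obtain N2 where N2: "\<And>n. N2 \<le> n \<Longrightarrow> \<exists>i::nat. q = real i / 2 ^ n" using dyadic_level step.hyps by metis
  show ?case
  proof (intro exI[of _ "max N (max N1 N2)"] allI impI)
    fix n j assume n: "max N (max N1 N2) \<le> n" and j: "v \<le> real j / 2 ^ n"
    obtain i i' where i: "p = real i / 2 ^ n" "q = real i' / 2 ^ n" using N1[of n] N2[of n] n by auto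
    let ?y = "\<lambda>j. g (real j / 2 ^ n)"
    have lt: "i < i'" using step.hyps i by (simp add: divide_strict_right_mono divide_less_cancel)
    have "real i' / 2 ^ n \<le> real j / 2 ^ n" using step.hyps i j by simp
    then have le: "i' \<le> j" by (simp add: divide_le_cancel)
    have "k \<le> upcr a b ?y i" using N[of n i] n i step.hyps by auto
    also have "Suc \<dots> \<le> upcr a b ?y i'"
      using upcr_Suc_le[of a b ?y i i'] assms(2) step.hyps i lt by auto
    also have "\<dots> \<le> upcr a b ?y j" using le by (rule upcr_mono)
    finally show "Suc k \<le> upcr a b ?y j" by simp
  qed
qed auto

lemma crossings_grid_upcr:
  assumes "crossings g a b k s u" "a \<le> b" "u \<le> real T"
  shows "\<forall>\<^sub>F n in sequentially. k \<le> grid_upcr g a b T n"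
proof -
  obtain N where N: "\<And>n j. N \<le> n \<Longrightarrow> u \<le> real j / 2 ^ n \<Longrightarrow> k \<le> upcr a b (\<lambda>j. g (real j / 2 ^ n)) j"
    using crossings_upcr[OF assms(1,2)] by blast
  show ?thesis unfolding eventually_sequentially grid_upcr_def
    using N assms(3) by (intro exI[of _ N]) auto
qed

text \<open>The next crossing is sought strictly between \<open>t\<close> and those already found;
  its high value is chosen first and the low value then between \<open>t\<close> and that
  time.\<close>

lemma crossings_right:
  assumes "\<exists>\<^sub>F q in dright t. g q < a" "\<exists>\<^sub>F q in dright t. b < g q" "t < d"
  shows "\<exists>s u. t < s \<and> u < d \<and> crossings g a b k s u"
proof (induction k)
  case 0
  show ?case using assms(3) dense[of t d] by (auto intro: crossings.zero)
next
  case (Suc k)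
  then obtain s u where su: "t < s" "u < d" "crossings g a b k s u" by blast
  have f: "\<exists>q\<in>dyadic. t < q \<and> q < c \<and> Q q" if "\<exists>\<^sub>F q in dright t. Q q" "t < c" for c Q
    using that unfolding frequently_def eventually_dright by (metis)
  obtain q where q: "q \<in> dyadic" "t < q" "q < s" "b < g q" using f[OF assms(2) su(1)] by blast
  obtain p where p: "p \<in> dyadic" "t < p" "p < q" "g p < a" using f[OF assms(1) q(2)] by blast
  have "crossings g a b (Suc 0) p q"
    by (rule crossings.step[OF crossings.zero[OF order_refl]]) (use p q in auto)
  from crossings_append[OF su(3) this] q have "crossings g a b (Suc k) p u" by auto
  then show ?case using p su by blast
qed

lemma crossings_left:
  assumes "\<exists>\<^sub>F q in dleft t. g q < a" "\<exists>\<^sub>F q in dleft t. b < g q"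
  shows "\<exists>s u. u < t \<and> crossings g a b k s u"
proof (induction k)
  case 0
  show ?case by (auto intro!: exI[of _ "t - 1"] crossings.zero)
next
  case (Suc k)
  then obtain s u where su: "u < t" "crossings g a b k s u" by blast
  have f: "\<exists>q\<in>dyadic. c < q \<and> q < t \<and> Q q" if "\<exists>\<^sub>F q in dleft t. Q q" "c < t" for c Q
    using that unfolding frequently_def eventually_dleft by (metis)
  obtain p where p: "p \<in> dyadic" "u < p" "p < t" "g p < a" using f[OF assms(1) su(1)] by blast
  obtain q where q: "q \<in> dyadic" "p < q" "q < t" "b < g q" using f[OF assms(2) p(3)] by blast
  have "crossings g a b (Suc k) s q"
    by (rule crossings.step[OF su(2)]) (use p q in auto)
  then show ?case using q by blast
qed

text \<open>Boundedness excludes an infinite limit, so without a limit the liminf lies strictly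
  below the limsup and rational levels fit between them. Rational levels leave countably many pairs,
  and \<open>0 \<le> a\<close> is what the upcrossing estimate asks for.\<close>

lemma oscillation:
  fixes g :: "'b \<Rightarrow> real"
  assumes ne: "F \<noteq> bot" and bd: "\<forall>\<^sub>F x in F. 0 \<le> g x \<and> g x \<le> B" and no: "\<nexists>l. (g \<longlongrightarrow> l) F"
  shows "\<exists>a\<in>\<rat>. \<exists>b\<in>\<rat>. 0 \<le> a \<and> a < b \<and> (\<exists>\<^sub>F x in F. g x < a) \<and> (\<exists>\<^sub>F x in F. b < g x)"
proof -
  let ?h = "\<lambda>x. ereal (g x)"
  have lo: "0 \<le> Liminf F ?h" by (rule Liminf_bounded) (use bd in \<open>auto elim: eventually_mono\<close>)
  have hi: "Limsup F ?h \<le> ereal B" by (rule Limsup_bounded) (use bd in \<open>auto elim: eventually_mono\<close>)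
  have le: "Liminf F ?h \<le> Limsup F ?h" by (rule Liminf_le_Limsup[OF ne])
  have "Liminf F ?h \<noteq> Limsup F ?h"
  proof
    assume eq: "Liminf F ?h = Limsup F ?h"
    then have "\<bar>Liminf F ?h\<bar> \<noteq> \<infinity>" using lo hi by auto
    then obtain l where l: "Liminf F ?h = ereal l" by auto
    have "(?h \<longlongrightarrow> ereal l) F" using eq l by (intro Liminf_eq_Limsup ne) auto
    then show False using no by auto
  qed
  with le have lt: "Liminf F ?h < Limsup F ?h" by simp
  obtain b' where b': "b' \<in> \<rat>" "Liminf F ?h < ereal b'" "ereal b' < Limsup F ?h"
    using ereal_dense3[OF lt] by (auto simp: Rats_def)
  obtain a where a: "a \<in> \<rat>" "Liminf F ?h < ereal a" "ereal a < ereal b'"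
    using ereal_dense3[OF b'(2)] by (auto simp: Rats_def)
  have "0 < ereal a" using lo a(2) by (rule le_less_trans)
  moreover have "\<exists>\<^sub>F x in F. g x < a"
  proof (rule ccontr)
    assume "\<not> ?thesis"
    then have "ereal a \<le> Liminf F ?h" by (intro Liminf_bounded) (auto simp: not_frequently not_less)
    with a(2) show False by simp
  qed
  moreover have "\<exists>\<^sub>F x in F. b' < g x"
  proof (rule ccontr)
    assume "\<not> ?thesis"
    then have "Limsup F ?h \<le> ereal b'" by (intro Limsup_bounded) (auto simp: not_frequently not_less)
    with b'(3) show False by simp
  qed
  ultimately show ?thesis using a b' by (intro bexI[of _ a] bexI[of _ b']) auto
qed

text \<open>A missing one-sided limit yields rational levels crossed arbitrarily often before
  \<open>T\<close>, hence arbitrarily large counts on all fine grids. Assumption \<open>fin\<close>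
  denies this in the form that a finite liminf of the grid counts provides.\<close>

lemma regular_path_if_finite_crossings:
  assumes nonneg: "\<And>q. q \<in> dyadic \<Longrightarrow> 0 \<le> g q"
    and bd: "\<And>T::nat. \<exists>B. \<forall>q\<in>dyadic. q \<le> real T \<longrightarrow> g q \<le> B"
    and fin: "\<And>T a b. a \<in> \<rat> \<Longrightarrow> b \<in> \<rat> \<Longrightarrow> 0 \<le> a \<Longrightarrow> a < b \<Longrightarrow> \<exists>k. \<not> (\<forall>\<^sub>F n in sequentially. k \<le> grid_upcr g a b T n)"
  shows "regular_path g"
proof -
  have main: False if F: "F = dright t \<and> 0 \<le> t \<or> F = dleft t \<and> 0 < t" and no: "\<nexists>l. (g \<longlongrightarrow> l) F" for F t
  proof -
    \<comment> \<open>The margin of 1 leaves room for a right neighbourhood of \<open>t\<close>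
      below \<open>T\<close>.\<close>
    obtain T :: nat where T: "t + 1 < real T" using reals_Archimedean2[of "t + 1"] by blast
    obtain B where B: "\<And>q. q \<in> dyadic \<Longrightarrow> q \<le> real T \<Longrightarrow> g q \<le> B" using bd by blast
    have ne: "F \<noteq> bot" using F dright_neq_bot[of t] dleft_neq_bot[of t] by metis
    have ev: "\<forall>\<^sub>F x in F. 0 \<le> g x \<and> g x \<le> B"
      using F
    proof (elim disjE conjE)
      assume Fd: "F = dright t" show ?thesis unfolding Fd eventually_dright
        using nonneg B T by (auto intro!: exI[of _ "t + 1"])
    next
      assume Fd: "F = dleft t" show ?thesis unfolding Fd eventually_dleft
        using nonneg B T by (auto intro!: exI[of _ "t - 1"])
    qed
    obtain a b where ab: "a \<in> \<rat>" "b \<in> \<rat>" "0 \<le> a" "a < b" "\<exists>\<^sub>F x in F. g x < a" "\<exists>\<^sub>F x in F. b < g x"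
      using oscillation[OF ne ev no] by blast
    have "\<exists>s u. u \<le> real T \<and> crossings g a b k s u" for k
      using F
    proof (elim disjE conjE)
      assume "F = dright t"
      with crossings_right[of g a t b "t + 1" k] ab obtain s u
        where "u < t + 1" "crossings g a b k s u" by auto
      with T show ?thesis by (intro exI[of _ s] exI[of _ u]) simp
    next
      assume "F = dleft t"
      with crossings_left[of g a t b k] ab obtain s u
        where "u < t" "crossings g a b k s u" by auto
      with T show ?thesis by (intro exI[of _ s] exI[of _ u]) simp
    qed
    then have "\<forall>\<^sub>F n in sequentially. k \<le> grid_upcr g a b T n" for k
      using crossings_grid_upcr ab by (meson less_imp_le)
    then show False using fin[OF ab(1-4)] by blast
  qed
  show ?thesis unfolding regular_path_def using main by blast
qed

section \<open>Regularisation of nonnegative supermartingales\<close>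

lemma set_nn_integral_space: "(\<integral>\<^sup>+\<omega>\<in>space N. f \<omega> \<partial>N) = (\<integral>\<^sup>+\<omega>. f \<omega> \<partial>N)"
  by (intro nn_integral_cong) simp

text \<open>One test set suffices, the set where the inequality fails: there \<open>f - g\<close> is
  positive but has a nonpositive integral.\<close>

lemma AE_le_if_set_integral_le:
  fixes f g :: "'w \<Rightarrow> real"
  assumes f: "integrable N f" and g: "integrable N g"
    and le: "(\<integral>\<omega>. indicator {\<omega> \<in> space N. g \<omega> < f \<omega>} \<omega> * f \<omega> \<partial>N) \<le>
      (\<integral>\<omega>. indicator {\<omega> \<in> space N. g \<omega> < f \<omega>} \<omega> * g \<omega> \<partial>N)"
  shows "AE \<omega> in N. f \<omega> \<le> g \<omega>"
proof -
  define A where "A = {\<omega> \<in> space N. g \<omega> < f \<omega>}"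
  have A: "A \<in> sets N"
    unfolding A_def using borel_measurable_integrable[OF f] borel_measurable_integrable[OF g] by measurable
  have int: "integrable N (\<lambda>\<omega>. indicator A \<omega> * f \<omega>)" "integrable N (\<lambda>\<omega>. indicator A \<omega> * g \<omega>)"
    using integrable_real_mult_indicator[OF A f] integrable_real_mult_indicator[OF A g]
    by (simp_all add: mult.commute)
  have i: "integrable N (\<lambda>\<omega>. indicator A \<omega> * (f \<omega> - g \<omega>))"
    using int by (simp add: right_diff_distrib)
  have n: "AE \<omega> in N. 0 \<le> indicator A \<omega> * (f \<omega> - g \<omega>)"
    by (intro AE_I2) (auto simp: A_def split: split_indicator)
  have "(\<integral>\<omega>. indicator A \<omega> * (f \<omega> - g \<omega>) \<partial>N) \<le> 0"
    using int le unfolding A_def[symmetric] by (simp add: right_diff_distrib)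
  then have "AE \<omega> in N. indicator A \<omega> * (f \<omega> - g \<omega>) = 0"
    using integral_nonneg_eq_0_iff_AE[OF i n] integral_nonneg_AE[OF n] by simp
  then show ?thesis
    using AE_space by eventually_elim (auto simp: A_def split: split_indicator_asm)
qed

text \<open>The supermartingale inequality is stated for nonnegative integrals over sets of the
  past, the form in which Tonelli and monotone convergence deliver it. Assumption \<open>lsc\<close>
  is the regularity in time: together with \<open>super\<close> it amounts to right continuity of
  the expectation.\<close>

locale nonneg_supermartingale =
  fixes N :: "'w measure" and F :: "real \<Rightarrow> 'w measure" and X :: "real \<Rightarrow> 'w \<Rightarrow> real"
  assumes prob: "prob_space N"
    and filt: "complete_rc_filtration N F"
    and nonneg: "0 \<le> t \<Longrightarrow> 0 \<le> X t \<omega>"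
    and adapted: "0 \<le> t \<Longrightarrow> X t \<in> borel_measurable (F t)"
    and super: "0 \<le> s \<Longrightarrow> s \<le> t \<Longrightarrow> A \<in> sets (F s) \<Longrightarrow>
      (\<integral>\<^sup>+\<omega>\<in>A. ennreal (X t \<omega>) \<partial>N) \<le> (\<integral>\<^sup>+\<omega>\<in>A. ennreal (X s \<omega>) \<partial>N)"
    and finite_init: "(\<integral>\<^sup>+\<omega>. ennreal (X 0 \<omega>) \<partial>N) < \<infinity>"
    and lsc: "0 \<le> t \<Longrightarrow> (\<And>n. t < r n) \<Longrightarrow> r \<longlonglongrightarrow> t \<Longrightarrow>
      (\<integral>\<^sup>+\<omega>. ennreal (X t \<omega>) \<partial>N) \<le> liminf (\<lambda>n. \<integral>\<^sup>+\<omega>. ennreal (X (r n) \<omega>) \<partial>N)"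
begin

interpretation prob_space N by (rule prob)

lemma subalg: "0 \<le> t \<Longrightarrow> subalgebra N (F t)"
  using filt by (simp add: complete_rc_filtration_def)

lemma sets_F_N: "0 \<le> t \<Longrightarrow> A \<in> sets (F t) \<Longrightarrow> A \<in> sets N"
  using subalg[of t] by (auto simp: subalgebra_def)

lemma space_F: "0 \<le> t \<Longrightarrow> space (F t) = space N"
  using subalg[of t] by (auto simp: subalgebra_def)

lemma sets_F_mono: "0 \<le> s \<Longrightarrow> s \<le> t \<Longrightarrow> A \<in> sets (F s) \<Longrightarrow> A \<in> sets (F t)"
  using filt unfolding complete_rc_filtration_def by blast

lemma meas: "0 \<le> t \<Longrightarrow> X t \<in> borel_measurable N"
  by (rule measurable_from_subalg[OF subalg adapted])

lemma nn_integral_le_init: "0 \<le> t \<Longrightarrow> (\<integral>\<^sup>+\<omega>. ennreal (X t \<omega>) \<partial>N) \<le> (\<integral>\<^sup>+\<omega>. ennreal (X 0 \<omega>) \<partial>N)"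
  using super[of 0 t "space N"] sets.top[of "F 0"] by (simp add: space_F set_nn_integral_space)

lemma integrable_X: "0 \<le> t \<Longrightarrow> integrable N (X t)"
  by (intro integrableI_nonneg meas AE_I2 nonneg le_less_trans[OF nn_integral_le_init finite_init])

lemma nn_set_integral_eq:
  assumes "0 \<le> t" "A \<in> sets N"
  shows "(\<integral>\<^sup>+\<omega>\<in>A. ennreal (X t \<omega>) \<partial>N) = ennreal (\<integral>\<omega>. indicator A \<omega> * X t \<omega> \<partial>N)"
proof -
  have "(\<integral>\<^sup>+\<omega>\<in>A. ennreal (X t \<omega>) \<partial>N) = (\<integral>\<^sup>+\<omega>. ennreal (indicator A \<omega> * X t \<omega>) \<partial>N)"
    by (intro nn_integral_cong) (auto split: split_indicator)
  also have "\<dots> = ennreal (\<integral>\<omega>. indicator A \<omega> * X t \<omega> \<partial>N)"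
    using assms integrable_X[of t] nonneg[of t]
    by (intro nn_integral_eq_integral integrable_real_mult_indicator AE_I2)
       (auto split: split_indicator simp: mult.commute[of "indicator A _"] integrable_real_mult_indicator)
  finally show ?thesis .
qed

lemma super_integral:
  assumes "0 \<le> s" "s \<le> t" "A \<in> sets (F s)"
  shows "(\<integral>\<omega>. indicator A \<omega> * X t \<omega> \<partial>N) \<le> (\<integral>\<omega>. indicator A \<omega> * X s \<omega> \<partial>N)"
proof -
  have "0 \<le> (\<integral>\<omega>. indicator A \<omega> * X s \<omega> \<partial>N)"
    using nonneg assms by (intro integral_nonneg_AE AE_I2) simp
  then show ?thesis
    using super[OF assms] sets_F_N[OF assms(1,3)] assms by (simp add: nn_set_integral_eq)
qed

text \<open>The set where the conditional expectation exceeds \<open>X s\<close> belongs to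
  \<open>F s\<close>, so both the defining property of conditional expectation and
  \<open>super\<close> apply to it.\<close>

lemma supermartingale_X: "supermartingale N F X"
  unfolding supermartingale_def
proof (intro conjI allI impI)
  fix s t :: real assume "0 \<le> s \<and> s \<le> t"
  then have s: "0 \<le> s" "s \<le> t" and t: "0 \<le> t" by auto
  interpret sub: finite_measure_subalgebra N "F s" by standard (rule subalg[OF s(1)])
  define Y where "Y = real_cond_exp N (F s) (X t)"
  have Y: "Y \<in> borel_measurable (F s)" "integrable N Y"
    unfolding Y_def by (auto intro: sub.real_cond_exp_int integrable_X t)
  define A where "A = {\<omega> \<in> space N. X s \<omega> < Y \<omega>}"
  have "A = {\<omega> \<in> space (F s). X s \<omega> < Y \<omega>}" by (simp add: A_def space_F[OF s(1)])
  also have "\<dots> \<in> sets (F s)" using Y(1) adapted[OF s(1)] by measurable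
  finally have A: "A \<in> sets (F s)" .
  have "(\<integral>\<omega>. indicator A \<omega> * Y \<omega> \<partial>N) = (\<integral>\<omega>. indicator A \<omega> * X t \<omega> \<partial>N)"
    using sub.real_cond_exp_intA[OF integrable_X[OF t] A]
    by (simp add: set_lebesgue_integral_def Y_def)
  also have "\<dots> \<le> (\<integral>\<omega>. indicator A \<omega> * X s \<omega> \<partial>N)"
    by (rule super_integral[OF s A])
  finally show "AE \<omega> in N. real_cond_exp N (F s) (X t) \<omega> \<le> X s \<omega>"
    using Y(2) integrable_X[OF s(1)] unfolding Y_def[symmetric] A_def by (intro AE_le_if_set_integral_le)
qed (rule adapted integrable_X; assumption)+

text \<open>The strategy is previsible: what is held from grid time \<open>j\<close> to the next is
  decided by the values up to \<open>j\<close>.\<close>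

lemma sets_hold:
  "{\<omega> \<in> space N. hold a b (\<lambda>j. X (real j / 2 ^ n) \<omega>) j} \<in> sets (F (real j / 2 ^ n))"
proof (induction j)
  case 0
  have "X 0 \<in> borel_measurable (F 0)" by (rule adapted) simp
  then have "{\<omega> \<in> space (F 0). X 0 \<omega> < a} \<in> sets (F 0)" by measurable
  then show ?case by (simp add: space_F)
next
  case (Suc j)
  let ?t = "real (Suc j) / 2 ^ n"
  let ?H = "{\<omega> \<in> space N. hold a b (\<lambda>j. X (real j / 2 ^ n) \<omega>) j}"
  have t: "0 \<le> ?t" by simp
  have [measurable]: "?H \<in> sets (F ?t)"
    by (rule sets_F_mono[OF _ _ Suc]) (auto simp: divide_right_mono)
  have [measurable]: "X ?t \<in> borel_measurable (F ?t)" by (rule adapted[OF t])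
  have "{\<omega> \<in> space N. hold a b (\<lambda>j. X (real j / 2 ^ n) \<omega>) (Suc j)} =
    (?H \<inter> {\<omega> \<in> space (F ?t). X ?t \<omega> \<le> b}) \<union> ({\<omega> \<in> space (F ?t). X ?t \<omega> < a} - ?H)"
    using space_F[OF t] by auto
  also have "\<dots> \<in> sets (F ?t)" by measurable
  finally show ?case .
qed

lemma integrable_indicator_mult: "0 \<le> t \<Longrightarrow> A \<in> sets N \<Longrightarrow> integrable N (\<lambda>\<omega>. indicator A \<omega> * X t \<omega>)"
  using integrable_real_mult_indicator[OF _ integrable_X, of A t] by (simp add: mult.commute)

text \<open>A supermartingale transform: each summand of the gain is an increment restricted to a
  set of the past, so its mean is at most 0.\<close>

lemma integrable_gain_and_le:
  shows "integrable N (\<lambda>\<omega>. gain a b (\<lambda>j. X (real j / 2 ^ n) \<omega>) m)"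
    and "(\<integral>\<omega>. gain a b (\<lambda>j. X (real j / 2 ^ n) \<omega>) m \<partial>N) \<le> 0"
proof -
  define H where "H j = {\<omega> \<in> space N. hold a b (\<lambda>j. X (real j / 2 ^ n) \<omega>) j}" for j
  let ?g = "\<lambda>\<omega>. \<Sum>j<m. indicator (H j) \<omega> * X (real (Suc j) / 2 ^ n) \<omega> - indicator (H j) \<omega> * X (real j / 2 ^ n) \<omega>"
  have H: "H j \<in> sets (F (real j / 2 ^ n))" for j unfolding H_def by (rule sets_hold)
  then have HN: "H j \<in> sets N" for j by (rule sets_F_N[rotated]) simp
  have int: "integrable N (\<lambda>\<omega>. indicator (H j) \<omega> * X (real k / 2 ^ n) \<omega>)" for j k
    by (rule integrable_indicator_mult) (auto simp: HN)
  have eq: "gain a b (\<lambda>j. X (real j / 2 ^ n) \<omega>) m = ?g \<omega>" if "\<omega> \<in> space N" for \<omega>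
    using that unfolding gain_def H_def
    by (intro sum.cong) (auto simp: algebra_simps split: split_indicator)
  have ig: "integrable N ?g"
    by (intro Bochner_Integration.integrable_sum Bochner_Integration.integrable_diff int)
  then show "integrable N (\<lambda>\<omega>. gain a b (\<lambda>j. X (real j / 2 ^ n) \<omega>) m)"
    by (subst Bochner_Integration.integrable_cong[OF refl eq])
  have "(\<integral>\<omega>. gain a b (\<lambda>j. X (real j / 2 ^ n) \<omega>) m \<partial>N) = (\<integral>\<omega>. ?g \<omega> \<partial>N)"
    by (intro Bochner_Integration.integral_cong refl eq)
  also have "\<dots> = (\<Sum>j<m. (\<integral>\<omega>. indicator (H j) \<omega> * X (real (Suc j) / 2 ^ n) \<omega> \<partial>N) -
      (\<integral>\<omega>. indicator (H j) \<omega> * X (real j / 2 ^ n) \<omega> \<partial>N))"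
    by (subst Bochner_Integration.integral_sum)
       (auto intro!: Bochner_Integration.integrable_diff int sum.cong Bochner_Integration.integral_diff simp del: of_nat_Suc)
  also have "\<dots> \<le> 0"
    by (intro sum_nonpos) (auto intro!: super_integral H divide_right_mono simp del: of_nat_Suc)
  finally show "(\<integral>\<omega>. gain a b (\<lambda>j. X (real j / 2 ^ n) \<omega>) m \<partial>N) \<le> 0" .
qed

lemma measurable_upcr:
  "(\<lambda>\<omega>. real (upcr a b (\<lambda>j. X (real j / 2 ^ n) \<omega>) m)) \<in> borel_measurable N"
proof (induction m)
  case (Suc m)
  let ?H = "{\<omega> \<in> space N. hold a b (\<lambda>j. X (real j / 2 ^ n) \<omega>) m}"
  have [measurable]: "?H \<in> sets N" by (rule sets_F_N[OF _ sets_hold]) simp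
  have [measurable]: "X (real (Suc m) / 2 ^ n) \<in> borel_measurable N" by (rule meas) simp
  note Suc[measurable]
  have "(\<lambda>\<omega>. real (upcr a b (\<lambda>j. X (real j / 2 ^ n) \<omega>) m) +
      indicator (?H \<inter> {\<omega> \<in> space N. b < X (real (Suc m) / 2 ^ n) \<omega>}) \<omega>) \<in> borel_measurable N"
    by measurable
  then show ?case
    by (rule measurable_cong[THEN iffD1, rotated]) (auto split: split_indicator)
qed simp

text \<open>Doob's upcrossing inequality. The bound is the same for all levels \<open>n\<close>,
  which lets it survive refinement of the grid.\<close>

lemma nn_integral_upcr_le:
  assumes "0 \<le> a" "a < b"
  shows "(\<integral>\<^sup>+\<omega>. ennreal (grid_upcr (\<lambda>t. X t \<omega>) a b T n) \<partial>N) \<le> ennreal (a / (b - a))"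
proof -
  let ?y = "\<lambda>\<omega> j. X (real j / 2 ^ n) \<omega>"
  let ?g = "\<lambda>\<omega>. (gain a b (?y \<omega>) (T * 2 ^ n) + a) / (b - a)"
  have le: "real (grid_upcr (\<lambda>t. X t \<omega>) a b T n) \<le> ?g \<omega>" for \<omega>
    using upcr_le_gain[OF assms, of "?y \<omega>" "T * 2 ^ n"] nonneg assms
    by (simp add: grid_upcr_def field_simps)
  have "(\<integral>\<^sup>+\<omega>. ennreal (grid_upcr (\<lambda>t. X t \<omega>) a b T n) \<partial>N) \<le> (\<integral>\<^sup>+\<omega>. ennreal (?g \<omega>) \<partial>N)"
    by (intro nn_integral_mono ennreal_leI le)
  also have "\<dots> = ennreal (\<integral>\<omega>. ?g \<omega> \<partial>N)"
  proof (intro nn_integral_eq_integral AE_I2)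
    show "integrable N ?g"
      by (intro integrable_divide Bochner_Integration.integrable_add integrable_gain_and_le(1) integrable_const)
    show "0 \<le> ?g \<omega>" for \<omega> using le[of \<omega>] of_nat_0_le_iff order_trans by blast
  qed
  also have "(\<integral>\<omega>. ?g \<omega> \<partial>N) = ((\<integral>\<omega>. gain a b (?y \<omega>) (T * 2 ^ n) \<partial>N) + a) / (b - a)"
    using integrable_gain_and_le(1) by (simp add: prob_space)
  also have "\<dots> \<le> a / (b - a)"
    using integrable_gain_and_le(2) assms by (intro divide_right_mono) auto
  finally show ?thesis using ennreal_leI order_trans by blast
qed

lemma measurable_grid_upcr[measurable]:
  "(\<lambda>\<omega>. real (grid_upcr (\<lambda>t. X t \<omega>) a b T n)) \<in> borel_measurable N"
  unfolding grid_upcr_def by (rule measurable_upcr)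

text \<open>A liminf over the levels is controlled by Fatou's lemma, and it is at least
  \<open>k\<close> as soon as all fine grids see \<open>k\<close> upcrossings.\<close>

definition upcr_bound :: "real \<Rightarrow> real \<Rightarrow> nat \<Rightarrow> 'w \<Rightarrow> ennreal" where
  "upcr_bound a b T \<omega> = liminf (\<lambda>n. ennreal (grid_upcr (\<lambda>t. X t \<omega>) a b T n))"

lemma measurable_upcr_bound[measurable]: "upcr_bound a b T \<in> borel_measurable N"
  unfolding upcr_bound_def by measurable

lemma nn_integral_upcr_bound:
  assumes "0 \<le> a" "a < b"
  shows "(\<integral>\<^sup>+\<omega>. upcr_bound a b T \<omega> \<partial>N) \<le> ennreal (a / (b - a))"
proof -
  have "(\<integral>\<^sup>+\<omega>. upcr_bound a b T \<omega> \<partial>N) \<le> liminf (\<lambda>n. \<integral>\<^sup>+\<omega>. ennreal (grid_upcr (\<lambda>t. X t \<omega>) a b T n) \<partial>N)"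
    unfolding upcr_bound_def by (intro nn_integral_liminf) measurable
  also have "\<dots> \<le> liminf (\<lambda>n::nat. ennreal (a / (b - a)))"
    by (intro Liminf_mono always_eventually allI nn_integral_upcr_le assms)
  finally show ?thesis by (simp add: Liminf_const)
qed

lemma upcr_bound_ge:
  "\<forall>\<^sub>F n in sequentially. k \<le> grid_upcr (\<lambda>t. X t \<omega>) a b T n \<Longrightarrow> of_nat k \<le> upcr_bound a b T \<omega>"
  unfolding upcr_bound_def
  by (intro Liminf_bounded, erule eventually_mono) (simp add: ennreal_of_nat_eq_real_of_nat ennreal_leI)

lemma AE_finite_crossings:
  assumes "0 \<le> a" "a < b"
  shows "AE \<omega> in N. \<exists>k. \<not> (\<forall>\<^sub>F n in sequentially. k \<le> grid_upcr (\<lambda>t. X t \<omega>) a b T n)"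
proof -
  have "(\<integral>\<^sup>+\<omega>. upcr_bound a b T \<omega> \<partial>N) \<noteq> \<infinity>"
    using nn_integral_upcr_bound[OF assms, of T] by (auto simp: top_unique)
  then have "AE \<omega> in N. upcr_bound a b T \<omega> \<noteq> \<infinity>"
    by (intro nn_integral_PInf_AE) auto
  then show ?thesis
  proof eventually_elim
    case (elim \<omega>)
    then obtain k where "upcr_bound a b T \<omega> < of_nat k"
      using ennreal_Ex_less_of_nat by (auto simp: less_top)
    then show ?case using upcr_bound_ge[of k \<omega> a b T] by (auto simp: not_le[symmetric])
  qed
qed

text \<open>Takes the place of a maximal inequality. A path that starts below \<open>a\<close> and
  is unbounded before \<open>T\<close> crosses from \<open>a\<close> to every higher level at least
  once, while the expected number of crossings up to \<open>a + 1 + b\<close> is at most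
  \<open>a / (1 + b)\<close>, which tends to 0.\<close>

lemma AE_bounded:
  "AE \<omega> in N. \<exists>B. \<forall>q\<in>dyadic. q \<le> real T \<longrightarrow> X q \<omega> \<le> B"
proof -
  define I where "I a \<omega> = (INF b::nat. upcr_bound (real a) (real a + 1 + real b) T \<omega>)" for a :: nat and \<omega>
  have I0: "AE \<omega> in N. I a \<omega> = 0" for a
  proof -
    have [measurable]: "I a \<in> borel_measurable N" unfolding I_def by measurable
    have "(\<integral>\<^sup>+\<omega>. I a \<omega> \<partial>N) \<le> ennreal (real a / real (Suc b))" for b
    proof -
      have "(\<integral>\<^sup>+\<omega>. I a \<omega> \<partial>N) \<le> (\<integral>\<^sup>+\<omega>. upcr_bound (real a) (real a + 1 + real b) T \<omega> \<partial>N)"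
        unfolding I_def by (intro nn_integral_mono INF_lower) simp
      also have "\<dots> \<le> ennreal (real a / (real a + 1 + real b - real a))"
        by (rule nn_integral_upcr_bound) auto
      finally show ?thesis by (simp add: add.commute)
    qed
    moreover have "(\<lambda>b. ennreal (real a / real (Suc b))) \<longlonglongrightarrow> ennreal 0"
      by (intro tendsto_ennrealI LIMSEQ_Suc lim_const_over_n)
    ultimately have "(\<integral>\<^sup>+\<omega>. I a \<omega> \<partial>N) \<le> ennreal 0"
      by (intro LIMSEQ_le_const) auto
    then have "(\<integral>\<^sup>+\<omega>. I a \<omega> \<partial>N) = 0" by simp
    then show ?thesis by (subst (asm) nn_integral_0_iff_AE) auto
  qed
  have "AE \<omega> in N. \<forall>a. I a \<omega> = 0" using I0 by (simp add: AE_all_countable)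
  then show ?thesis
  proof eventually_elim
    case (elim \<omega>)
    show ?case
    proof (rule ccontr)
      assume nb: "\<nexists>B. \<forall>q\<in>dyadic. q \<le> real T \<longrightarrow> X q \<omega> \<le> B"
      \<comment> \<open>The starting value serves as the low point of the crossing. The level
        \<open>a\<close> depends on the path, so \<open>I a\<close> was shown to vanish for all
        natural numbers \<open>a\<close> at once.\<close>
      obtain a :: nat where a: "X 0 \<omega> < real a" using reals_Archimedean2 by metis
      have "1 \<le> upcr_bound (real a) (real a + 1 + real b) T \<omega>" for b
      proof -
        let ?b = "real a + 1 + real b"
        obtain q where q: "q \<in> dyadic" "q \<le> real T" "?b < X q \<omega>" using nb by (meson not_le)
        have "q \<noteq> 0" using q(3) a by auto
        then have "0 < q" using dyadic_nonneg[OF q(1)] by simp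
        then have "crossings (\<lambda>t. X t \<omega>) (real a) ?b (Suc 0) 0 q"
          by (intro crossings.step[OF crossings.zero[OF order_refl]]) (use q a zero_in_dyadic in auto)
        from crossings_grid_upcr[OF this _ q(2)]
        have "\<forall>\<^sub>F n in sequentially. Suc 0 \<le> grid_upcr (\<lambda>t. X t \<omega>) (real a) ?b T n" by simp
        from upcr_bound_ge[OF this] show ?thesis by simp
      qed
      then have "1 \<le> I a \<omega>" unfolding I_def by (intro INF_greatest)
      with elim show False by simp
    qed
  qed
qed

lemma AE_regular_path: "AE \<omega> in N. regular_path (\<lambda>t. X t \<omega>)"
proof -
  define R :: "(real \<times> real) set" where "R = {(a, b). a \<in> \<rat> \<and> b \<in> \<rat> \<and> 0 \<le> a \<and> a < b}"
  have "countable (\<rat> \<times> \<rat> :: (real \<times> real) set)"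
    by (intro countable_SIGMA countable_rat)
  then have cR: "countable R"
    by (rule countable_subset[rotated]) (auto simp: R_def)
  have "AE \<omega> in N. \<exists>k. \<not> (\<forall>\<^sub>F n in sequentially. k \<le> grid_upcr (\<lambda>t. X t \<omega>) (fst ab) (snd ab) T n)"
    if "ab \<in> R" for ab T
    using that by (intro AE_finite_crossings) (auto simp: R_def)
  then have "AE \<omega> in N. \<forall>ab\<in>R. \<exists>k. \<not> (\<forall>\<^sub>F n in sequentially. k \<le> grid_upcr (\<lambda>t. X t \<omega>) (fst ab) (snd ab) T n)" for T
    by (subst AE_ball_countable[OF cR]) blast
  then have "AE \<omega> in N. \<forall>T. \<forall>ab\<in>R. \<exists>k. \<not> (\<forall>\<^sub>F n in sequentially. k \<le> grid_upcr (\<lambda>t. X t \<omega>) (fst ab) (snd ab) T n)"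
    by (subst AE_all_countable) blast
  moreover have "AE \<omega> in N. \<forall>T. \<exists>B. \<forall>q\<in>dyadic. q \<le> real T \<longrightarrow> X q \<omega> \<le> B"
    using AE_bounded by (simp add: AE_all_countable)
  ultimately show ?thesis
  proof eventually_elim
    case (elim \<omega>)
    show ?case
    proof (rule regular_path_if_finite_crossings)
      fix T a b assume "a \<in> \<rat>" "b \<in> \<rat>" "(0::real) \<le> a" "a < b"
      then have "(a, b) \<in> R" by (simp add: R_def)
      with elim(1) show "\<exists>k. \<not> (\<forall>\<^sub>F n in sequentially. k \<le> grid_upcr (\<lambda>t. X t \<omega>) a b T n)" by fastforce
    qed (use elim(2) nonneg dyadic_nonneg in auto)
  qed
qed

text \<open>Let \<open>Z\<close> be the limit along a dyadic sequence \<open>q\<close>. Fatou's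
  lemma gives \<open>Z \<le> X t\<close> almost surely, and equality follows once \<open>Z\<close>
  has at least the same expectation: \<open>lsc\<close> compares \<open>X t\<close> with the
  \<open>X (q n)\<close>, and \<open>q_le\<close> compares these with \<open>Z\<close>.\<close>

lemma AE_right_limit:
  assumes t: "0 \<le> t"
  shows "AE \<omega> in N. ((\<lambda>q. X q \<omega>) \<longlongrightarrow> X t \<omega>) (dright t)"
proof -
  obtain q where q: "\<And>n. q n \<in> dyadic" "\<And>n. t < q n" "q \<longlonglongrightarrow> t" "filterlim q (dright t) sequentially"
    by (rule dright_sequence[OF t]) (rule that)
  have q0: "0 \<le> q n" for n using q(2)[of n] t by simp
  define Z where "Z \<omega> = lim (\<lambda>n. X (q n) \<omega>)" for \<omega>
  have conv: "AE \<omega> in N. (\<lambda>n. X (q n) \<omega>) \<longlonglongrightarrow> Z \<omega>"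
    using AE_regular_path
  proof eventually_elim
    case (elim \<omega>)
    then obtain l where l: "((\<lambda>t. X t \<omega>) \<longlongrightarrow> l) (dright t)" using t by (auto simp: regular_path_def)
    then have "(\<lambda>n. X (q n) \<omega>) \<longlonglongrightarrow> l" using q(4) by (rule filterlim_compose)
    then show ?case unfolding Z_def by (simp add: limI)
  qed
  have nonneg_Z: "AE \<omega> in N. 0 \<le> Z \<omega>"
    using conv by eventually_elim (auto intro!: LIMSEQ_le_const nonneg q0)
  have meas_q[measurable]: "X (q n) \<in> borel_measurable N" for n by (rule meas[OF q0])
  have meas_t[measurable]: "X t \<in> borel_measurable N" by (rule meas[OF t])
  \<comment> \<open>Shifting the sequence leaves its limit unchanged and places all its times before
    \<open>s\<close>.\<close>
  have Z_meas_s: "Z \<in> borel_measurable (F s)" if s: "t < s" for s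
  proof -
    obtain m where m: "\<And>n. m \<le> n \<Longrightarrow> q n < s"
      using order_tendstoD(2)[OF q(3) s] by (auto simp: eventually_sequentially)
    have "X (q (n + m)) \<in> borel_measurable (F s)" for n
    proof (rule measurable_from_subalg[OF _ adapted[OF q0]])
      show "subalgebra (F s) (F (q (n + m)))"
        using space_F[of s] space_F[OF q0] sets_F_mono[OF q0, of "n + m" s] m[of "n + m"] t s
        by (auto simp: subalgebra_def)
    qed
    then have "(\<lambda>\<omega>. lim (\<lambda>n. X (q (n + m)) \<omega>)) \<in> borel_measurable (F s)" by measurable
    moreover have "((\<lambda>n. X (q (n + m)) \<omega>) \<longlonglongrightarrow> a) \<longleftrightarrow> (\<lambda>n. X (q n) \<omega>) \<longlonglongrightarrow> a" for a \<omega>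
      using LIMSEQ_offset[of "\<lambda>n. X (q n) \<omega>" m a] LIMSEQ_ignore_initial_segment[of "\<lambda>n. X (q n) \<omega>" a m]
      by (rule iffI)
    then have "(\<lambda>\<omega>. lim (\<lambda>n. X (q (n + m)) \<omega>)) = Z"
      unfolding Z_def lim_def by simp
    ultimately show ?thesis by simp
  qed
  \<comment> \<open>Right continuity of the filtration turns measurability at all
    \<open>s > t\<close> into measurability at \<open>t\<close>.\<close>
  have Z_meas: "Z \<in> borel_measurable (F t)"
  proof (rule measurableI)
    fix S :: "real set" assume S: "S \<in> sets borel"
    have "Z -` S \<inter> space (F t) \<in> sets (F s)" if "t < s" for s
      using measurable_sets[OF Z_meas_s[OF that] S] space_F[OF t] space_F[of s] t that by simp
    then show "Z -` S \<inter> space (F t) \<in> sets (F t)"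
      using filt t unfolding complete_rc_filtration_def by (metis (no_types, lifting) INT_I greaterThan_iff)
  qed simp
  then have [measurable]: "Z \<in> borel_measurable N" by (rule measurable_from_subalg[OF subalg[OF t]])
  have fin_t: "(\<integral>\<^sup>+\<omega>. ennreal (X t \<omega>) \<partial>N) < \<infinity>"
    using nn_integral_le_init[OF t] finite_init by (rule le_less_trans)
  have Z_le: "(\<integral>\<^sup>+\<omega>\<in>A. ennreal (Z \<omega>) \<partial>N) \<le> (\<integral>\<^sup>+\<omega>\<in>A. ennreal (X t \<omega>) \<partial>N)" if A: "A \<in> sets (F t)" for A
  proof -
    have [measurable]: "A \<in> sets N" by (rule sets_F_N[OF t A])
    have "(\<integral>\<^sup>+\<omega>\<in>A. ennreal (Z \<omega>) \<partial>N) = (\<integral>\<^sup>+\<omega>. liminf (\<lambda>n. ennreal (X (q n) \<omega>) * indicator A \<omega>) \<partial>N)"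
    proof (rule nn_integral_cong_AE, use conv in eventually_elim)
      case (elim \<omega>)
      have "(\<lambda>n. ennreal (X (q n) \<omega>) * indicator A \<omega>) \<longlonglongrightarrow> ennreal (Z \<omega>) * indicator A \<omega>"
        using tendsto_ennrealI[OF elim] by (cases "\<omega> \<in> A") auto
      then show ?case by (simp add: lim_imp_Liminf)
    qed
    also have "\<dots> \<le> liminf (\<lambda>n. \<integral>\<^sup>+\<omega>\<in>A. ennreal (X (q n) \<omega>) \<partial>N)"
      by (intro nn_integral_liminf) measurable
    also have "\<dots> \<le> liminf (\<lambda>n::nat. \<integral>\<^sup>+\<omega>\<in>A. ennreal (X t \<omega>) \<partial>N)"
      by (intro Liminf_mono always_eventually allI super t A less_imp_le q)
    finally show ?thesis by (simp add: Liminf_const)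
  qed
  \<comment> \<open>Substitute for uniform integrability. If \<open>q n < q m\<close>, the event
    \<open>X (q n) \<le> K\<close> lies in \<open>F (q n)\<close>, so the integral of
    \<open>X (q m)\<close> over it is at most that of \<open>X (q n)\<close>, which is bounded by
    \<open>K\<close> there. The truncated integrals converge by dominated convergence.\<close>
  have part: "(\<integral>\<^sup>+\<omega>. ennreal (X (q m) \<omega>) * indicator {\<omega> \<in> space N. Z \<omega> < K} \<omega> \<partial>N) \<le> (\<integral>\<^sup>+\<omega>. ennreal (Z \<omega>) \<partial>N)" for m and K :: real
  proof -
    define A where "A n = {\<omega> \<in> space N. X (q n) \<omega> \<le> K}" for n
    have [measurable]: "A n \<in> sets N" for n unfolding A_def by measurable
    have "(\<integral>\<^sup>+\<omega>. ennreal (X (q m) \<omega>) * indicator {\<omega> \<in> space N. Z \<omega> < K} \<omega> \<partial>N)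
        \<le> (\<integral>\<^sup>+\<omega>. liminf (\<lambda>n. ennreal (X (q m) \<omega>) * indicator (A n) \<omega>) \<partial>N)"
    proof (rule nn_integral_mono_AE, use conv in eventually_elim)
      case (elim \<omega>)
      show ?case
      proof (cases "\<omega> \<in> space N \<and> Z \<omega> < K")
        case True
        then have "\<forall>\<^sub>F n in sequentially. X (q n) \<omega> < K" using order_tendstoD(2)[OF elim] by simp
        then have "\<forall>\<^sub>F n in sequentially. ennreal (X (q m) \<omega>) \<le> ennreal (X (q m) \<omega>) * indicator (A n) \<omega>"
          by eventually_elim (use True in \<open>auto simp: A_def\<close>)
        then show ?thesis using True by (auto intro!: Liminf_bounded)
      qed auto
    qed
    also have "\<dots> \<le> liminf (\<lambda>n. \<integral>\<^sup>+\<omega>. ennreal (X (q m) \<omega>) * indicator (A n) \<omega> \<partial>N)"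
      by (intro nn_integral_liminf) measurable
    also have "\<dots> \<le> liminf (\<lambda>n. \<integral>\<^sup>+\<omega>. ennreal (min (X (q n) \<omega>) K) \<partial>N)"
    proof (intro Liminf_mono)
      have "\<forall>\<^sub>F n in sequentially. q n < q m" using order_tendstoD(2)[OF q(3) q(2)] .
      then show "\<forall>\<^sub>F n in sequentially. (\<integral>\<^sup>+\<omega>. ennreal (X (q m) \<omega>) * indicator (A n) \<omega> \<partial>N)
          \<le> (\<integral>\<^sup>+\<omega>. ennreal (min (X (q n) \<omega>) K) \<partial>N)"
      proof eventually_elim
        case (elim n)
        have "A n = {\<omega> \<in> space (F (q n)). X (q n) \<omega> \<le> K}" by (simp add: A_def space_F q0)
        also have "\<dots> \<in> sets (F (q n))" using adapted[OF q0, of n] by measurable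
        finally have "(\<integral>\<^sup>+\<omega>\<in>A n. ennreal (X (q m) \<omega>) \<partial>N) \<le> (\<integral>\<^sup>+\<omega>\<in>A n. ennreal (X (q n) \<omega>) \<partial>N)"
          using elim q0 by (intro super) auto
        also have "\<dots> \<le> (\<integral>\<^sup>+\<omega>. ennreal (min (X (q n) \<omega>) K) \<partial>N)"
          by (intro nn_integral_mono) (auto simp: A_def split: split_indicator)
        finally show ?case .
      qed
    qed
    also have "\<dots> = (\<integral>\<^sup>+\<omega>. ennreal (min (Z \<omega>) K) \<partial>N)"
    proof (rule lim_imp_Liminf)
      show "(\<lambda>n. \<integral>\<^sup>+\<omega>. ennreal (min (X (q n) \<omega>) K) \<partial>N) \<longlonglongrightarrow> (\<integral>\<^sup>+\<omega>. ennreal (min (Z \<omega>) K) \<partial>N)"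
      proof (rule nn_integral_dominated_convergence[where w = "\<lambda>_. ennreal K"])
        show "AE \<omega> in N. (\<lambda>n. ennreal (min (X (q n) \<omega>) K)) \<longlonglongrightarrow> ennreal (min (Z \<omega>) K)"
          using conv by eventually_elim (auto intro!: tendsto_ennrealI tendsto_min)
      qed (auto intro!: AE_I2 ennreal_leI simp: emeasure_space_1)
    qed simp
    also have "\<dots> \<le> (\<integral>\<^sup>+\<omega>. ennreal (Z \<omega>) \<partial>N)" by (intro nn_integral_mono ennreal_leI) simp
    finally show ?thesis .
  qed
  have q_le: "(\<integral>\<^sup>+\<omega>. ennreal (X (q m) \<omega>) \<partial>N) \<le> (\<integral>\<^sup>+\<omega>. ennreal (Z \<omega>) \<partial>N)" for m
  proof -
    have "(\<integral>\<^sup>+\<omega>. ennreal (X (q m) \<omega>) \<partial>N) =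
        (\<integral>\<^sup>+\<omega>. (SUP K::nat. ennreal (X (q m) \<omega>) * indicator {\<omega> \<in> space N. Z \<omega> < real K} \<omega>) \<partial>N)"
    proof (rule nn_integral_cong)
      fix \<omega> assume w: "\<omega> \<in> space N"
      obtain K :: nat where K: "Z \<omega> < real K" using reals_Archimedean2 by metis
      show "ennreal (X (q m) \<omega>) = (SUP K::nat. ennreal (X (q m) \<omega>) * indicator {\<omega> \<in> space N. Z \<omega> < real K} \<omega>)"
      proof (rule antisym)
        show "ennreal (X (q m) \<omega>) \<le> (SUP K::nat. ennreal (X (q m) \<omega>) * indicator {\<omega> \<in> space N. Z \<omega> < real K} \<omega>)"
          by (rule SUP_upper2[of K]) (use w K in auto)
      qed (auto intro!: SUP_least split: split_indicator)
    qed
    also have "\<dots> = (SUP K::nat. \<integral>\<^sup>+\<omega>. ennreal (X (q m) \<omega>) * indicator {\<omega> \<in> space N. Z \<omega> < real K} \<omega> \<partial>N)"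
      by (intro nn_integral_monotone_convergence_SUP)
         (auto simp: incseq_def le_fun_def split: split_indicator)
    also have "\<dots> \<le> (\<integral>\<^sup>+\<omega>. ennreal (Z \<omega>) \<partial>N)" by (intro SUP_least part)
    finally show ?thesis .
  qed
  have t_le: "(\<integral>\<^sup>+\<omega>. ennreal (X t \<omega>) \<partial>N) \<le> (\<integral>\<^sup>+\<omega>. ennreal (Z \<omega>) \<partial>N)"
  proof -
    have "(\<integral>\<^sup>+\<omega>. ennreal (X t \<omega>) \<partial>N) \<le> liminf (\<lambda>n. \<integral>\<^sup>+\<omega>. ennreal (X (q n) \<omega>) \<partial>N)"
      using t q(2,3) by (rule lsc)
    also have "\<dots> \<le> liminf (\<lambda>n::nat. \<integral>\<^sup>+\<omega>. ennreal (Z \<omega>) \<partial>N)"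
      by (intro Liminf_mono always_eventually allI q_le)
    finally show ?thesis by (simp add: Liminf_const)
  qed
  have fin_Z: "(\<integral>\<^sup>+\<omega>. ennreal (Z \<omega>) \<partial>N) < \<infinity>"
  proof -
    have "(\<integral>\<^sup>+\<omega>. ennreal (Z \<omega>) \<partial>N) \<le> (\<integral>\<^sup>+\<omega>. ennreal (X t \<omega>) \<partial>N)"
      using Z_le[of "space N"] sets.top[of "F t"] by (simp add: space_F[OF t] set_nn_integral_space)
    then show ?thesis using fin_t by (rule le_less_trans)
  qed
  have int_Z: "integrable N Z"
    using fin_Z nonneg_Z by (intro integrableI_nonneg) auto
  note int_t = integrable_X[OF t]
  define A where "A = {\<omega> \<in> space N. X t \<omega> < Z \<omega>}"
  have A: "A \<in> sets (F t)"
  proof -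
    have "A = {\<omega> \<in> space (F t). X t \<omega> < Z \<omega>}" by (simp add: A_def space_F[OF t])
    also have "\<dots> \<in> sets (F t)" using Z_meas adapted[OF t] by measurable
    finally show ?thesis .
  qed
  have [measurable]: "A \<in> sets N" by (rule sets_F_N[OF t A])
  have intA: "integrable N (\<lambda>\<omega>. indicator A \<omega> * Z \<omega>)" "integrable N (\<lambda>\<omega>. indicator A \<omega> * X t \<omega>)"
    using integrable_real_mult_indicator[OF \<open>A \<in> sets N\<close> int_Z] integrable_indicator_mult[OF t]
    by (simp_all add: mult.commute)
  have "(\<integral>\<omega>. indicator A \<omega> * Z \<omega> \<partial>N) \<le> (\<integral>\<omega>. indicator A \<omega> * X t \<omega> \<partial>N)"
  proof -
    have "ennreal (\<integral>\<omega>. indicator A \<omega> * Z \<omega> \<partial>N) = (\<integral>\<^sup>+\<omega>. ennreal (indicator A \<omega> * Z \<omega>) \<partial>N)"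
      using nonneg_Z by (intro nn_integral_eq_integral[symmetric] intA) auto
    also have "\<dots> = (\<integral>\<^sup>+\<omega>\<in>A. ennreal (Z \<omega>) \<partial>N)"
      by (intro nn_integral_cong) (auto split: split_indicator)
    also have "\<dots> \<le> ennreal (\<integral>\<omega>. indicator A \<omega> * X t \<omega> \<partial>N)"
      using Z_le[OF A] by (simp add: nn_set_integral_eq[OF t])
    finally show ?thesis
      using nonneg[OF t] by (subst (asm) ennreal_le_iff) (auto intro!: integral_nonneg_AE)
  qed
  then have "AE \<omega> in N. Z \<omega> \<le> X t \<omega>"
    using int_Z int_t unfolding A_def by (intro AE_le_if_set_integral_le)
  then have le: "AE \<omega> in N. 0 \<le> X t \<omega> - Z \<omega>" by simp
  have "(\<integral>\<omega>. X t \<omega> \<partial>N) \<le> (\<integral>\<omega>. Z \<omega> \<partial>N)"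
  proof -
    have "ennreal (\<integral>\<omega>. X t \<omega> \<partial>N) \<le> ennreal (\<integral>\<omega>. Z \<omega> \<partial>N)"
      using t_le nn_integral_eq_integral[OF int_t] nn_integral_eq_integral[OF int_Z nonneg_Z] nonneg[OF t] by simp
    then show ?thesis by (subst (asm) ennreal_le_iff) (use nonneg_Z in \<open>auto intro!: integral_nonneg_AE\<close>)
  qed
  then have "(\<integral>\<omega>. X t \<omega> - Z \<omega> \<partial>N) = 0"
    using int_t int_Z integral_nonneg_AE[OF le] by simp
  then have "AE \<omega> in N. X t \<omega> - Z \<omega> = 0"
    using integral_nonneg_eq_0_iff_AE[OF Bochner_Integration.integrable_diff[OF int_t int_Z] le] by simp
  \<comment> \<open>So far \<open>X t\<close> is only the limit along \<open>q\<close>; regularity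
    of the path supplies a limit along the whole filter, and the two agree.\<close>
  with conv AE_regular_path show ?thesis
  proof eventually_elim
    case (elim \<omega>)
    then obtain l where l: "((\<lambda>t. X t \<omega>) \<longlongrightarrow> l) (dright t)" using t by (auto simp: regular_path_def)
    then have "(\<lambda>n. X (q n) \<omega>) \<longlonglongrightarrow> l" using q(4) by (rule filterlim_compose)
    then have "l = X t \<omega>" using elim LIMSEQ_unique by fastforce
    with l show ?case by simp
  qed
qed

end

section \<open>Compactness and right continuity\<close>

text \<open>The filter \<open>inf (nhds x) F\<close> approaches \<open>x\<close> along
  \<open>F\<close>; when it is nontrivial, \<open>x\<close> is a cluster point of \<open>F\<close>.
  It takes the part of a convergent subsequence.\<close>

lemma tendsto_inf_nhds:
  assumes f: "continuous_on K f" and x: "x \<in> K" and F: "eventually (\<lambda>y. y \<in> K) F"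
  shows "(f \<longlongrightarrow> f x) (inf (nhds x) F)"
  unfolding tendsto_def
proof (intro allI impI)
  fix S assume S: "open S" "f x \<in> S"
  have "(f \<longlongrightarrow> f x) (at x within K)" using f x by (simp add: continuous_on_def)
  then have "eventually (\<lambda>y. f y \<in> S) (at x within K)" using S by (simp add: tendsto_def)
  then have "eventually (\<lambda>y. y \<noteq> x \<longrightarrow> y \<in> K \<longrightarrow> f y \<in> S) (nhds x)"
    by (simp add: eventually_at_filter)
  then have "eventually (\<lambda>y. y \<in> K \<longrightarrow> f y \<in> S) (nhds x)"
    by eventually_elim (use S in auto)
  then show "eventually (\<lambda>y. f y \<in> S) (inf (nhds x) F)"
    unfolding eventually_inf using F by blast
qed

text \<open>Compactness provides a cluster point, and uniqueness of real limits identifies its value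
  under every \<open>h k\<close>.\<close>

lemma compact_cluster_point:
  fixes h :: "'i \<Rightarrow> 'a::topological_space \<Rightarrow> real"
  assumes K: "compact K" and F: "F \<noteq> bot" "eventually (\<lambda>y. y \<in> K) F"
    and h: "\<And>k. continuous_on K (h k)" "\<And>k. (h k \<longlongrightarrow> c k) F"
  obtains x where "x \<in> K" "\<And>k. h k x = c k" "inf (nhds x) F \<noteq> bot"
proof -
  obtain x where x: "x \<in> K" "inf (nhds x) F \<noteq> bot"
    using K F unfolding compact_filter by blast
  have "h k x = c k" for k
    using x(2) tendsto_inf_nhds[OF h(1) x(1) F(2)] tendsto_mono[OF inf_le2 h(2)]
    by (rule tendsto_unique)
  with x that show thesis by blast
qed

text \<open>If \<open>f\<close> were frequently outside \<open>V\<close>, that part of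
  \<open>F\<close> would have a cluster point with the same values under all \<open>h k\<close> as
  \<open>z\<close>, hence with the same value of \<open>f\<close>, which contradicts continuity of
  \<open>f\<close> there. Taking the identity for \<open>f\<close> gives convergence of points in
  \<open>E\<close>.\<close>

lemma compact_determined_tendsto:
  fixes h :: "'i \<Rightarrow> 'a::topological_space \<Rightarrow> real" and f :: "'a \<Rightarrow> 'b::topological_space"
  assumes K: "compact K" and F: "eventually (\<lambda>y. y \<in> K) F"
    and h: "\<And>k. continuous_on K (h k)" "\<And>k. (h k \<longlongrightarrow> c k) F"
    and f: "continuous_on K f"
    and det: "\<And>x y. x \<in> K \<Longrightarrow> y \<in> K \<Longrightarrow> (\<And>k. h k x = h k y) \<Longrightarrow> f x = f y"
    and z: "z \<in> K" "\<And>k. h k z = c k"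
  shows "(f \<longlongrightarrow> f z) F"
  unfolding tendsto_def
proof (intro allI impI)
  fix V assume V: "open V" "f z \<in> V"
  let ?G = "inf F (principal {x. f x \<notin> V})"
  show "eventually (\<lambda>x. f x \<in> V) F"
  proof (rule ccontr)
    assume "\<not> eventually (\<lambda>x. f x \<in> V) F"
    then have ne: "?G \<noteq> bot" by (simp add: trivial_limit_def eventually_inf_principal)
    have G: "?G \<le> F" by simp
    have GK: "eventually (\<lambda>y. y \<in> K) ?G" using F G by (rule filter_leD[rotated])
    obtain x where x: "x \<in> K" "\<And>k. h k x = c k" "inf (nhds x) ?G \<noteq> bot"
      using compact_cluster_point[OF K ne GK h(1) tendsto_mono[OF G h(2)]] by metis
    have "f x = f z" using x z by (intro det) auto
    then have "eventually (\<lambda>x. f x \<in> V) (inf (nhds x) ?G)"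
      using tendsto_inf_nhds[OF f x(1) GK] V by (simp add: tendsto_def)
    moreover have "eventually (\<lambda>x. f x \<notin> V) (inf (nhds x) ?G)"
      by (rule filter_leD[of _ "principal {x. f x \<notin> V}"]) (auto intro: le_infI2 simp: eventually_principal)
    ultimately have "eventually (\<lambda>_. False) (inf (nhds x) ?G)" by eventually_elim simp
    with x(3) show False by (simp add: trivial_limit_def)
  qed
qed

text \<open>Rounding the time up to a grid of width \<open>1 / (n + 1)\<close> leaves countably many
  times, and right continuity gives pointwise convergence as the grid is refined.\<close>

lemma measurable_pair_right_continuous:
  fixes h :: "real \<Rightarrow> 'w \<Rightarrow> real"
  assumes h[measurable]: "\<And>u. h u \<in> borel_measurable N"
    and rc: "\<And>u \<omega>. \<omega> \<in> space N \<Longrightarrow> ((\<lambda>s. h s \<omega>) \<longlongrightarrow> h u \<omega>) (at_right u)"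
  shows "(\<lambda>(u, \<omega>). h u \<omega>) \<in> borel_measurable (borel \<Otimes>\<^sub>M N)"
proof -
  \<comment> \<open>Floor plus one, so that the rounded time exceeds \<open>u\<close> strictly even
    at grid points, as \<open>at_right\<close> demands.\<close>
  define a where "a n u = (of_int \<lfloor>u * real (Suc n)\<rfloor> + 1) / real (Suc n)" for n and u :: real
  have a: "u < a n u" "a n u \<le> u + 1 / real (Suc n)" for n u
  proof -
    have "u * real (Suc n) < of_int \<lfloor>u * real (Suc n)\<rfloor> + 1" "of_int \<lfloor>u * real (Suc n)\<rfloor> + 1 \<le> u * real (Suc n) + 1"
      by linarith+
    then show "u < a n u" "a n u \<le> u + 1 / real (Suc n)"
      unfolding a_def by (simp_all add: pos_less_divide_eq pos_divide_le_eq distrib_right del: of_nat_Suc)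
  qed
  have lim: "filterlim (\<lambda>n. a n u) (at_right u) sequentially" for u
  proof -
    have "(\<lambda>n. u + 1 / real (Suc n)) \<longlonglongrightarrow> u + 0"
      by (intro tendsto_intros LIMSEQ_Suc lim_1_over_n)
    then have "(\<lambda>n. a n u) \<longlonglongrightarrow> u"
      by (intro tendsto_sandwich[of "\<lambda>_. u" "\<lambda>n. a n u" sequentially "\<lambda>n. u + 1 / real (Suc n)"])
         (use a in \<open>auto intro!: always_eventually less_imp_le simp del: of_nat_Suc\<close>)
    then show ?thesis unfolding filterlim_at using a(1) by (simp add: less_imp_neq[OF a(1), symmetric])
  qed
  show ?thesis
  proof (rule borel_measurable_LIMSEQ_real)
    fix n
    have 1: "(\<lambda>p. h ((of_int i + 1) / real (Suc n)) (snd p)) \<in> borel_measurable (borel \<Otimes>\<^sub>M N)" for i :: int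
      by measurable
    have 2: "(\<lambda>p. \<lfloor>fst p * real (Suc n)\<rfloor>) \<in> (borel \<Otimes>\<^sub>M N) \<rightarrow>\<^sub>M count_space UNIV"
      by measurable
    from measurable_compose_countable[OF 1 2]
    show "(\<lambda>(u, \<omega>). h (a n u) \<omega>) \<in> borel_measurable (borel \<Otimes>\<^sub>M N)"
      by (simp add: a_def case_prod_beta)
  next
    fix p :: "real \<times> 'w" assume "p \<in> space (borel \<Otimes>\<^sub>M N)"
    then have "snd p \<in> space N" by (auto simp: space_pair_measure)
    from filterlim_compose[OF rc[OF this] lim]
    show "(\<lambda>n. case p of (u, \<omega>) \<Rightarrow> h (a n u) \<omega>) \<longlonglongrightarrow> (case p of (u, \<omega>) \<Rightarrow> h u \<omega>)"
      by (simp add: case_prod_beta)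
  qed
qed

lemma borel_measurable_right_continuous:
  fixes h :: "real \<Rightarrow> real"
  assumes "\<And>u. (h \<longlongrightarrow> h u) (at_right u)"
  shows "h \<in> borel_measurable borel"
proof -
  have "(\<lambda>(u, _). h u) \<in> borel_measurable (borel \<Otimes>\<^sub>M count_space (UNIV :: unit set))"
    using measurable_pair_right_continuous[of "\<lambda>u _. h u"] assms by simp
  from measurable_compose[OF _ this, of "\<lambda>u. (u, ())" borel] show ?thesis by simp
qed

text \<open>For a net \<open>x \<rightarrow> x0\<close> dominated convergence is not available; a sequence of bad points
  converging to \<open>x0\<close> only at countably many times suffices, because compactness and right
  continuity propagate this convergence to all times.\<close>

lemma continuous_on_integral_right_continuous:
  fixes \<phi> :: "real \<Rightarrow> 'a::topological_space \<Rightarrow> real"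
  assumes K: "compact K"
    and cont: "\<And>s. 0 \<le> s \<Longrightarrow> continuous_on K (\<phi> s)"
    and rc: "\<And>s x. 0 \<le> s \<Longrightarrow> x \<in> K \<Longrightarrow> ((\<lambda>u. \<phi> u x) \<longlongrightarrow> \<phi> s x) (at_right s)"
    and meas: "\<And>x. x \<in> K \<Longrightarrow> set_borel_measurable lborel {0..} (\<lambda>s. \<phi> s x)"
    and bound: "\<And>s x. 0 \<le> s \<Longrightarrow> x \<in> K \<Longrightarrow> \<bar>\<phi> s x\<bar> \<le> b s"
    and int: "set_integrable lborel {0..} b"
  shows "continuous_on K (\<lambda>x. LBINT s:{0..}. \<phi> s x)"
  unfolding continuous_on_def
proof (intro ballI, rule ccontr)
  let ?I = "\<lambda>x. LBINT s:{0..}. \<phi> s x"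
  fix x0 assume x0: "x0 \<in> K" and "\<not> (?I \<longlongrightarrow> ?I x0) (at x0 within K)"
  then obtain e where e: "e > 0" "\<not> eventually (\<lambda>x. dist (?I x) (?I x0) < e) (at x0 within K)"
    by (auto simp: tendsto_iff)
  define q where "q i = from_nat_into dyadic i" for i
  have q: "q i \<in> dyadic" for i unfolding q_def using zero_in_dyadic by (intro from_nat_into) auto
  have q0: "0 \<le> q i" for i using q dyadic_nonneg by blast
  have q_surj: "\<exists>i. r = q i" if "r \<in> dyadic" for r
    using from_nat_into_to_nat_on[OF countable_dyadic that] by (metis q_def)
  \<comment> \<open>Closeness to \<open>x0\<close> is demanded at the first \<open>n + 1\<close>
    dyadic times only, a finite condition that holds eventually near \<open>x0\<close>.\<close>
  define bad where "bad n x \<longleftrightarrow> x \<in> K \<and> (\<forall>i\<le>n. dist (\<phi> (q i) x) (\<phi> (q i) x0) < 1 / real (Suc n)) \<and>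
    e \<le> dist (?I x) (?I x0)" for n x
  have "\<exists>x. bad n x" for n
  proof (rule ccontr)
    assume no: "\<nexists>x. bad n x"
    have "eventually (\<lambda>x. dist (\<phi> (q i) x) (\<phi> (q i) x0) < 1 / real (Suc n)) (at x0 within K)" for i
      using cont[OF q0] x0 by (intro tendstoD) (auto simp: continuous_on_def)
    then have "eventually (\<lambda>x. \<forall>i\<in>{..n}. dist (\<phi> (q i) x) (\<phi> (q i) x0) < 1 / real (Suc n)) (at x0 within K)"
      by (intro eventually_ball_finite) auto
    moreover have "eventually (\<lambda>x. x \<in> K) (at x0 within K)" by (simp add: eventually_at_filter)
    ultimately have "eventually (\<lambda>x. dist (?I x) (?I x0) < e) (at x0 within K)"
    proof eventually_elim
      case (elim x)
      with no have "\<not> e \<le> dist (?I x) (?I x0)" by (auto simp: bad_def)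
      then show ?case by simp
    qed
    with e(2) show False by contradiction
  qed
  then obtain x where "\<And>n. bad n (x n)" by metis
  then have x: "\<And>n. x n \<in> K"
    "\<And>n i. i \<le> n \<Longrightarrow> dist (\<phi> (q i) (x n)) (\<phi> (q i) x0) < 1 / real (Suc n)"
    "\<And>n. e \<le> dist (?I (x n)) (?I x0)" unfolding bad_def by simp_all
  have lim_q: "(\<lambda>n. \<phi> (q i) (x n)) \<longlonglongrightarrow> \<phi> (q i) x0" for i
  proof (rule metric_tendsto_imp_tendsto[where f = "\<lambda>n. 1 / real (Suc n)"])
    show "(\<lambda>n. 1 / real (Suc n)) \<longlonglongrightarrow> 0" by (intro LIMSEQ_Suc lim_1_over_n)
    show "\<forall>\<^sub>F n in sequentially. dist (\<phi> (q i) (x n)) (\<phi> (q i) x0) \<le> dist (1 / real (Suc n)) 0"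
      unfolding eventually_sequentially using x(2)
      by (intro exI[of _ i] allI impI) (simp add: less_imp_le del: of_nat_Suc)
  qed
  \<comment> \<open>Two points of \<open>K\<close> with equal values at all dyadic times have equal
    values at time \<open>s\<close> by right continuity. This is the determination that
    \<open>compact_determined_tendsto\<close> asks for.\<close>
  have lim_s: "(\<lambda>n. \<phi> s (x n)) \<longlonglongrightarrow> \<phi> s x0" if s: "0 \<le> s" for s
  proof -
    have "(\<phi> s \<longlongrightarrow> \<phi> s x0) (filtermap x sequentially)"
    proof (rule compact_determined_tendsto[OF K, where h = "\<lambda>i. \<phi> (q i)" and c = "\<lambda>i. \<phi> (q i) x0"])
      fix y y' assume y: "y \<in> K" "y' \<in> K" and eq: "\<And>i. \<phi> (q i) y = \<phi> (q i) y'"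
      have le: "dright s \<le> at_right s" by (rule at_le) auto
      have "((\<lambda>u. \<phi> u y) \<longlongrightarrow> \<phi> s y) (dright s)" "((\<lambda>u. \<phi> u y') \<longlongrightarrow> \<phi> s y') (dright s)"
        using rc[OF s y(1)] rc[OF s y(2)] tendsto_mono[OF le] by blast+
      moreover have "\<phi> u y = \<phi> u y'" if "u \<in> dyadic" for u using q_surj[OF that] eq by auto
      then have "\<forall>\<^sub>F u in dright s. \<phi> u y = \<phi> u y'"
        unfolding eventually_dright by (intro exI[of _ "s + 1"]) simp
      ultimately have "((\<lambda>u. \<phi> u y') \<longlongrightarrow> \<phi> s y) (dright s)"
        using tendsto_cong[of "\<lambda>u. \<phi> u y" "\<lambda>u. \<phi> u y'"] by simp
      then show "\<phi> s y = \<phi> s y'"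
        using \<open>((\<lambda>u. \<phi> u y') \<longlongrightarrow> \<phi> s y') (dright s)\<close> dright_neq_bot[OF s] tendsto_unique by blast
    qed (use lim_q cont[OF q0] cont[OF s] x x0 in \<open>auto simp: eventually_filtermap filterlim_filtermap\<close>)
    then show ?thesis by (simp add: filterlim_filtermap)
  qed
  have "(\<lambda>n. ?I (x n)) \<longlonglongrightarrow> ?I x0"
    unfolding set_lebesgue_integral_def
  proof (rule integral_dominated_convergence[where w = "\<lambda>s. indicator {0..} s *\<^sub>R b s"])
    show "integrable lborel (\<lambda>s. indicator {0..} s *\<^sub>R b s)" using int by (simp add: set_integrable_def)
    show "AE s in lborel. (\<lambda>n. indicator {0..} s *\<^sub>R \<phi> s (x n)) \<longlonglongrightarrow> indicator {0..} s *\<^sub>R \<phi> s x0"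
      by (intro AE_I2) (auto split: split_indicator intro: lim_s)
  qed (use meas[OF x(1)] meas[OF x0] bound[OF _ x(1)] in
      \<open>auto simp: set_borel_measurable_def split: split_indicator\<close>)
  then have "\<forall>\<^sub>F n in sequentially. dist (?I (x n)) (?I x0) < e" using e(1) by (rule tendstoD)
  then show False using x(3) by (auto simp: eventually_sequentially not_less[symmetric])
qed

section \<open>Generalized Feller semigroups\<close>

lemma set_integrable_exp_Ici:
  assumes "0 < a"
  shows "set_integrable lborel {0..} (\<lambda>s::real. exp (- a * s))"
proof -
  have "(\<integral>\<^sup>+s. ennreal (exp (- a * s)) * indicator {0..} s \<partial>lborel) = 0 - (- exp (- a * 0) / a)"
  proof (rule nn_integral_FTC_atLeast)
    show "((\<lambda>s. - exp (- a * s) / a) \<longlongrightarrow> 0) at_top"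
      using assms by real_asymp
  qed (use assms in \<open>auto intro!: derivative_eq_intros\<close>)
  then have *: "(\<integral>\<^sup>+s. ennreal (exp (- a * s)) * indicator {0..} s \<partial>lborel) < \<infinity>"
    by simp
  have "(\<integral>\<^sup>+s. ennreal (indicator {0..} s *\<^sub>R exp (- a * s)) \<partial>lborel) =
      (\<integral>\<^sup>+s. ennreal (exp (- a * s)) * indicator {0..} s \<partial>lborel)"
    by (intro nn_integral_cong) (auto split: split_indicator)
  with * show ?thesis unfolding set_integrable_def
    by (intro integrableI_nonneg) (auto intro!: AE_I2)
qed

locale weighted_semigroup =
  fixes \<rho> :: "'a::topological_space \<Rightarrow> real"
    and P :: "real \<Rightarrow> ('a \<Rightarrow> real) \<Rightarrow> ('a \<Rightarrow> real)"
    and M w :: real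
  assumes haus: "Hausdorff_space (euclidean :: 'a topology)"
    and adm: "admissible_weight \<rho>"
    and feller: "gen_feller_semigroup \<rho> P"
    and growth: "\<forall>t\<ge>0. \<forall>f\<in>Brho \<rho>. rho_norm \<rho> (P t f) \<le> M * exp (w * t) * rho_norm \<rho> f"
begin

lemma rho_pos: "0 < \<rho> x"
  using adm by (simp add: admissible_weight_def)

lemma compact_sublevel: "compact {x. \<rho> x \<le> R}"
proof (cases "0 \<le> R")
  case True
  then show ?thesis using adm by (simp add: admissible_weight_def)
next
  case False
  have "\<not> \<rho> x \<le> R" for x using False rho_pos[of x] by linarith
  then show ?thesis by simp
qed

lemma closed_sublevel: "closed {x. \<rho> x \<le> R}"
  using compactin_imp_closedin[OF haus, of "{x. \<rho> x \<le> R}"] compact_sublevel by simp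

lemma measurable_rho[measurable]: "\<rho> \<in> borel_measurable borel"
  by (rule borel_measurableI_le) (simp add: closed_sublevel)

text \<open>Closed sublevel sets make the weight lower semicontinuous, so it has a positive lower
  bound on the compact set where it is at most 1; the open sets \<open>U n\<close> carry this out by
  covering. This bound makes bounded functions \<open>\<rho>\<close>-bounded.\<close>

lemma rho_bounded_below: "\<exists>c>0. \<forall>x. c \<le> \<rho> x"
proof -
  define U where "U n = - {x. \<rho> x \<le> 1 / real (Suc n)}" for n
  have cover: "{x. \<rho> x \<le> 1} \<subseteq> (\<Union>n\<in>UNIV. U n)"
  proof
    fix x
    obtain n where "1 / real (Suc n) < \<rho> x" using nat_approx_posE[OF rho_pos[of x]] by metis
    then show "x \<in> (\<Union>n\<in>UNIV. U n)" by (auto simp: U_def not_le simp del: of_nat_Suc)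
  qed
  have op: "open (U n)" for n unfolding U_def using closed_sublevel by (rule open_Compl)
  obtain C where C: "finite C" "{x. \<rho> x \<le> 1} \<subseteq> (\<Union>n\<in>C. U n)"
    using compactE_image[OF compact_sublevel _ cover] op by metis
  define c where "c = 1 / real (Suc (Max (insert 0 C)))"
  have "c \<le> \<rho> x" for x
  proof (cases "\<rho> x \<le> 1")
    case True
    then have "x \<in> (\<Union>n\<in>C. U n)" using C(2) by blast
    then obtain n where n: "n \<in> C" "1 / real (Suc n) < \<rho> x"
      unfolding U_def by (auto simp: not_le simp del: of_nat_Suc)
    have "n \<le> Max (insert 0 C)" using C(1) n(1) by simp
    then have "c \<le> 1 / real (Suc n)" unfolding c_def by (intro divide_left_mono) auto
    with n(2) show ?thesis by simp
  next
    case False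
    have "c \<le> 1" by (simp add: c_def)
    with False show ?thesis by simp
  qed
  moreover have "c > 0" by (simp add: c_def)
  ultimately show ?thesis by blast
qed

section \<open>The weighted norm and the space \<open>Brho\<close>\<close>

lemma abs_le_rho_norm:
  assumes "rho_bounded \<rho> f"
  shows "\<bar>f x\<bar> \<le> rho_norm \<rho> f * \<rho> x"
proof -
  obtain C where C: "\<And>x. \<bar>f x\<bar> \<le> C * \<rho> x" using assms by (auto simp: rho_bounded_def)
  have "bdd_above (range (\<lambda>x. \<bar>f x\<bar> / \<rho> x))"
    by (rule bdd_aboveI2[of _ _ C]) (use C rho_pos in \<open>simp add: pos_divide_le_eq\<close>)
  then have "\<bar>f x\<bar> / \<rho> x \<le> rho_norm \<rho> f" unfolding rho_norm_def by (rule cSUP_upper2) auto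
  then show ?thesis using rho_pos[of x] by (simp add: pos_divide_le_eq)
qed

lemma rho_norm_le: "(\<And>x. \<bar>f x\<bar> \<le> C * \<rho> x) \<Longrightarrow> rho_norm \<rho> f \<le> C"
  unfolding rho_norm_def by (rule cSUP_least) (use rho_pos in \<open>auto simp: pos_divide_le_eq\<close>)

lemma Cb_rho_bounded:
  assumes "g \<in> Cb" shows "rho_bounded \<rho> g"
proof -
  obtain c where c: "c > 0" "\<And>x. c \<le> \<rho> x" using rho_bounded_below by blast
  obtain B where B: "\<And>x. \<bar>g x\<bar> \<le> B" using assms by (auto simp: Cb_def bounded_iff)
  have "\<bar>g x\<bar> \<le> B / c * \<rho> x" for x
  proof -
    have "0 \<le> B" using B[of x] by linarith
    have "\<bar>g x\<bar> \<le> B / c * c" using B[of x] c(1) by simp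
    also have "\<dots> \<le> B / c * \<rho> x" using \<open>0 \<le> B\<close> c by (intro mult_left_mono) auto
    finally show ?thesis .
  qed
  then show ?thesis unfolding rho_bounded_def by blast
qed

lemma rho_bounded_diff:
  assumes "rho_bounded \<rho> f" "rho_bounded \<rho> g"
  shows "rho_bounded \<rho> (\<lambda>x. f x - g x)"
proof -
  obtain C D where CD: "\<And>x. \<bar>f x\<bar> \<le> C * \<rho> x" "\<And>x. \<bar>g x\<bar> \<le> D * \<rho> x"
    using assms by (auto simp: rho_bounded_def)
  have "\<bar>f x - g x\<bar> \<le> (C + D) * \<rho> x" for x
    using CD(1)[of x] CD(2)[of x] by (auto simp: distrib_right abs_le_iff)
  then show ?thesis unfolding rho_bounded_def by blast
qed

lemma Brho_rho_bounded: "f \<in> Brho \<rho> \<Longrightarrow> rho_bounded \<rho> f"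
  by (simp add: Brho_def)

lemma Brho_approx:
  assumes "f \<in> Brho \<rho>" "0 < e"
  obtains g where "g \<in> Cb" "\<And>x. \<bar>f x - g x\<bar> \<le> e * \<rho> x"
proof -
  obtain g where g: "g \<in> Cb" "rho_norm \<rho> (\<lambda>x. f x - g x) < e"
    using assms by (auto simp: Brho_def)
  have "\<bar>f x - g x\<bar> \<le> e * \<rho> x" for x
  proof -
    have "\<bar>f x - g x\<bar> \<le> rho_norm \<rho> (\<lambda>x. f x - g x) * \<rho> x"
      using abs_le_rho_norm[OF rho_bounded_diff[OF Brho_rho_bounded[OF assms(1)] Cb_rho_bounded[OF g(1)]]] .
    also have "\<dots> \<le> e * \<rho> x" using g(2) rho_pos[of x] by (intro mult_right_mono) auto
    finally show ?thesis .
  qed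
  with g(1) that show thesis by blast
qed

lemma BrhoI:
  assumes "rho_bounded \<rho> f" "\<And>e. 0 < e \<Longrightarrow> \<exists>g\<in>Cb. \<forall>x. \<bar>f x - g x\<bar> \<le> e * \<rho> x"
  shows "f \<in> Brho \<rho>"
  unfolding Brho_def
proof (intro CollectI conjI allI impI)
  fix e :: real assume e: "0 < e"
  then obtain g where g: "g \<in> Cb" "\<And>x. \<bar>f x - g x\<bar> \<le> e / 2 * \<rho> x" using assms(2)[of "e / 2"] by auto
  have "rho_norm \<rho> (\<lambda>x. f x - g x) \<le> e / 2" by (rule rho_norm_le[OF g(2)])
  then show "\<exists>g\<in>Cb. rho_norm \<rho> (\<lambda>x. f x - g x) < e" using g(1) e by (intro bexI[of _ g]) auto
qed (rule assms(1))

lemma Cb_Brho: "g \<in> Cb \<Longrightarrow> g \<in> Brho \<rho>"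
  by (intro BrhoI Cb_rho_bounded bexI[of _ g]) (simp_all add: less_imp_le rho_pos)

text \<open>Composing an approximant in \<open>Cb\<close> with a 1-Lipschitz function does not
  increase the error. Positive and negative parts are the cases of interest.\<close>

lemma Brho_compose_lipschitz:
  assumes f: "f \<in> Brho \<rho>" and \<phi>: "\<And>a b. \<bar>\<phi> a - \<phi> b\<bar> \<le> \<bar>a - b\<bar>" "\<phi> 0 = 0" "continuous_on UNIV \<phi>"
  shows "(\<lambda>x. \<phi> (f x)) \<in> Brho \<rho>"
proof (rule BrhoI)
  have 0: "\<bar>\<phi> a\<bar> \<le> \<bar>a\<bar>" for a using \<phi>(1)[of a 0] \<phi>(2) by simp
  show "rho_bounded \<rho> (\<lambda>x. \<phi> (f x))"
    using Brho_rho_bounded[OF f] 0 order_trans unfolding rho_bounded_def by blast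
  fix e :: real assume "0 < e"
  then obtain g where g: "g \<in> Cb" "\<And>x. \<bar>f x - g x\<bar> \<le> e * \<rho> x" using Brho_approx[OF f] by metis
  obtain B where B: "\<And>x. \<bar>g x\<bar> \<le> B" using g(1) by (auto simp: Cb_def bounded_iff)
  have "continuous_on UNIV (\<lambda>x. \<phi> (g x))"
    using g(1) by (intro continuous_on_compose2[OF \<phi>(3)]) (auto simp: Cb_def)
  moreover have "bounded (range (\<lambda>x. \<phi> (g x)))"
    unfolding bounded_iff using 0 B order_trans by (metis rangeE real_norm_def)
  ultimately have "(\<lambda>x. \<phi> (g x)) \<in> Cb" by (simp add: Cb_def)
  moreover have "\<bar>\<phi> (f x) - \<phi> (g x)\<bar> \<le> e * \<rho> x" for x using \<phi>(1) g(2) order_trans by blast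
  ultimately show "\<exists>g\<in>Cb. \<forall>x. \<bar>\<phi> (f x) - g x\<bar> \<le> e * \<rho> x"
    by (intro bexI[of _ "\<lambda>x. \<phi> (g x)"]) auto
qed

lemma Brho_pos_part: "f \<in> Brho \<rho> \<Longrightarrow> (\<lambda>x. max (f x) 0) \<in> Brho \<rho>"
  by (rule Brho_compose_lipschitz[where \<phi> = "\<lambda>a. max a 0"]) (auto intro!: continuous_intros)

lemma Brho_neg_part: "f \<in> Brho \<rho> \<Longrightarrow> (\<lambda>x. max (- f x) 0) \<in> Brho \<rho>"
  by (rule Brho_compose_lipschitz[where \<phi> = "\<lambda>a. max (- a) 0"]) (auto intro!: continuous_intros)

text \<open>Where the weight is at most \<open>R\<close>, approximation in the weighted norm is
  uniform approximation by continuous functions.\<close>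

lemma Brho_continuous_on_sublevel:
  assumes f: "f \<in> Brho \<rho>"
  shows "continuous_on {x. \<rho> x \<le> R} f"
proof -
  have "\<exists>g. g \<in> Cb \<and> (\<forall>x. \<bar>f x - g x\<bar> \<le> 1 / real (Suc n) * \<rho> x)" for n
    using Brho_approx[OF f, of "1 / real (Suc n)"] by (metis of_nat_0_less_iff zero_less_Suc zero_less_divide_1_iff)
  then obtain g where g: "\<And>n. g n \<in> Cb" "\<And>n x. \<bar>f x - g n x\<bar> \<le> 1 / real (Suc n) * \<rho> x" by metis
  have "uniform_limit {x. \<rho> x \<le> R} g f sequentially"
  proof (rule uniform_limitI)
    fix e :: real assume e: "0 < e"
    obtain m :: nat where m: "\<bar>R\<bar> / e < real m" using reals_Archimedean2 by metis
    have "dist (g n x) (f x) < e" if "m \<le> n" "\<rho> x \<le> R" for n x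
    proof -
      have "\<bar>R\<bar> < real m * e" using m e by (simp add: pos_divide_less_eq)
      also have "\<dots> \<le> real (Suc n) * e" using that e by (intro mult_right_mono) auto
      finally have R: "\<bar>R\<bar> / real (Suc n) < e" by (simp add: pos_divide_less_eq mult.commute del: of_nat_Suc)
      have "dist (g n x) (f x) \<le> 1 / real (Suc n) * \<rho> x"
        using g(2)[of x n] by (simp add: dist_real_def abs_minus_commute)
      also have "\<dots> \<le> \<bar>R\<bar> / real (Suc n)" using that by (simp add: divide_right_mono)
      finally show ?thesis using R by simp
    qed
    then show "\<forall>\<^sub>F n in sequentially. \<forall>x\<in>{x. \<rho> x \<le> R}. dist (g n x) (f x) < e"
      unfolding eventually_sequentially by blast
  qed
  moreover have "continuous_on {x. \<rho> x \<le> R} (g n)" for n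
    using g(1)[of n] by (auto simp: Cb_def intro: continuous_on_subset)
  ultimately show ?thesis by (intro uniform_limit_theorem[of _ g sequentially]) auto
qed

lemma Brho_measurable:
  assumes f: "f \<in> Brho \<rho>"
  shows "f \<in> borel_measurable borel"
proof -
  have "\<exists>g. g \<in> Cb \<and> (\<forall>x. \<bar>f x - g x\<bar> \<le> 1 / real (Suc n) * \<rho> x)" for n
    using Brho_approx[OF f, of "1 / real (Suc n)"] by (metis of_nat_0_less_iff zero_less_Suc zero_less_divide_1_iff)
  then obtain g where g: "\<And>n. g n \<in> Cb" "\<And>n x. \<bar>f x - g n x\<bar> \<le> 1 / real (Suc n) * \<rho> x" by metis
  show ?thesis
  proof (rule borel_measurable_LIMSEQ_real)
    show "g n \<in> borel_measurable borel" for n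
      using g(1)[of n] by (intro borel_measurable_continuous_onI) (simp add: Cb_def)
    fix x
    have "(\<lambda>n. 1 / real (Suc n) * \<rho> x) \<longlonglongrightarrow> 0 * \<rho> x"
      by (intro tendsto_intros LIMSEQ_Suc lim_1_over_n)
    then have "(\<lambda>n. f x - g n x) \<longlonglongrightarrow> 0"
      by (intro Lim_null_comparison[of "\<lambda>n. f x - g n x" "\<lambda>n. 1 / real (Suc n) * \<rho> x"] always_eventually allI)
         (use g(2) in auto)
    then have "(\<lambda>n. f x - (f x - g n x)) \<longlonglongrightarrow> f x - 0" by (intro tendsto_intros)
    then show "(\<lambda>n. g n x) \<longlonglongrightarrow> f x" by simp
  qed
qed

section \<open>The semigroup, its right continuity in time, and its resolvent\<close>

lemma semigroup:
  "\<forall>t\<ge>0. \<forall>f\<in>Brho \<rho>. P t f \<in> Brho \<rho>"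
  "\<forall>t\<ge>0. \<forall>f\<in>Brho \<rho>. \<forall>g\<in>Brho \<rho>. \<forall>a b.
     P t (\<lambda>x. a * f x + b * g x) = (\<lambda>x. a * P t f x + b * P t g x)"
  "\<forall>f\<in>Brho \<rho>. P 0 f = f"
  "\<forall>s\<ge>0. \<forall>t\<ge>0. \<forall>f\<in>Brho \<rho>. P (t + s) f = P s (P t f)"
  "\<forall>f\<in>Brho \<rho>. \<forall>x. ((\<lambda>t. P t f x) \<longlongrightarrow> f x) (at_right 0)"
  "\<forall>t\<ge>0. \<forall>f\<in>Brho \<rho>. (\<forall>x. 0 \<le> f x) \<longrightarrow> (\<forall>x. 0 \<le> P t f x)"
  using feller unfolding gen_feller_semigroup_def by - (elim conjE, assumption)+

lemma P_Brho: "0 \<le> t \<Longrightarrow> f \<in> Brho \<rho> \<Longrightarrow> P t f \<in> Brho \<rho>"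
  by (rule semigroup(1)[rule_format])

lemma P_diff:
  assumes "0 \<le> t" "f \<in> Brho \<rho>" "g \<in> Brho \<rho>"
  shows "P t (\<lambda>x. f x - g x) = (\<lambda>x. P t f x - P t g x)"
  using semigroup(2)[rule_format, OF assms, of 1 "- 1"] by simp

lemma P_zero: "f \<in> Brho \<rho> \<Longrightarrow> P 0 f = f"
  by (rule semigroup(3)[rule_format])

lemma P_add: "0 \<le> s \<Longrightarrow> 0 \<le> t \<Longrightarrow> f \<in> Brho \<rho> \<Longrightarrow> P (t + s) f = P s (P t f)"
  by (rule semigroup(4)[rule_format])

lemma P_nonneg: "0 \<le> t \<Longrightarrow> f \<in> Brho \<rho> \<Longrightarrow> (\<And>x. 0 \<le> f x) \<Longrightarrow> 0 \<le> P t f x"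
  by (rule semigroup(6)[rule_format])

lemma P_bound:
  assumes "0 \<le> t" "f \<in> Brho \<rho>"
  shows "\<bar>P t f x\<bar> \<le> M * exp (w * t) * rho_norm \<rho> f * \<rho> x"
proof -
  have "\<bar>P t f x\<bar> \<le> rho_norm \<rho> (P t f) * \<rho> x"
    by (intro abs_le_rho_norm Brho_rho_bounded P_Brho assms)
  also have "\<dots> \<le> M * exp (w * t) * rho_norm \<rho> f * \<rho> x"
    using growth assms rho_pos[of x] by (intro mult_right_mono) auto
  finally show ?thesis .
qed

text \<open>Continuity at time 0 is applied to \<open>P t f\<close>, which lies in
  \<open>Brho\<close> again; the semigroup property moves the result to time \<open>t\<close>, from
  the right.\<close>

lemma P_right_continuous:
  assumes t: "0 \<le> t" and f: "f \<in> Brho \<rho>"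
  shows "((\<lambda>s. P s f x) \<longlongrightarrow> P t f x) (at_right t)"
proof -
  have "((\<lambda>h. P h (P t f) x) \<longlongrightarrow> P t f x) (at_right 0)"
    by (rule semigroup(5)[rule_format, OF P_Brho[OF t f]])
  moreover have "\<forall>\<^sub>F h in at_right 0. P h (P t f) x = P (h + t) f x"
    unfolding eventually_at_right_field using P_add[of _ t f] t f
    by (intro exI[of _ 1]) (auto simp: add.commute)
  ultimately have "((\<lambda>h. P (h + t) f x) \<longlongrightarrow> P t f x) (at_right 0)"
    by (rule Lim_transform_eventually)
  then show ?thesis by (subst filterlim_at_right_to_0)
qed

text \<open>Nothing is assumed about \<open>P\<close> at negative times. Clamping the time at 0
  extends the family constantly to a right continuous one on the whole line, the form required by
  the measurability lemmas.\<close>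

lemma P_max_right_continuous:
  assumes f: "f \<in> Brho \<rho>"
  shows "((\<lambda>s. P (max 0 s) f x) \<longlongrightarrow> P (max 0 t) f x) (at_right t)"
proof (cases "0 \<le> t")
  case True
  have "\<forall>\<^sub>F s in at_right t. P s f x = P (max 0 s) f x"
    unfolding eventually_at_right_field using True by (intro exI[of _ "t + 1"]) auto
  then have "((\<lambda>s. P (max 0 s) f x) \<longlongrightarrow> P t f x) (at_right t)"
    using P_right_continuous[OF True f, of x] by (rule Lim_transform_eventually[rotated])
  then show ?thesis using True by (simp add: max_def)
next
  case False
  have "\<forall>\<^sub>F s in at_right t. P (max 0 t) f x = P (max 0 s) f x"
    unfolding eventually_at_right_field using False by (intro exI[of _ 0]) (auto simp: max_def)
  then show ?thesis by (rule Lim_transform_eventually[OF tendsto_const])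
qed

lemma P_max_measurable: "f \<in> Brho \<rho> \<Longrightarrow> (\<lambda>s. P (max 0 s) f x) \<in> borel_measurable borel"
  by (rule borel_measurable_right_continuous) (rule P_max_right_continuous)

lemma resolvent_measurable:
  assumes f: "f \<in> Brho \<rho>"
  shows "set_borel_measurable lborel {0..} (\<lambda>s. exp (- \<beta> * s) * P s f x)"
proof -
  have "(\<lambda>s. indicator {0..} s *\<^sub>R (exp (- \<beta> * s) * P (max 0 s) f x)) \<in> borel_measurable lborel"
    using P_max_measurable[OF f, of x] by measurable
  moreover have "(\<lambda>s. indicator {0..} s *\<^sub>R (exp (- \<beta> * s) * P (max 0 s) f x)) =
      (\<lambda>s. indicator {0..} s *\<^sub>R (exp (- \<beta> * s) * P s f x))"
    by (auto split: split_indicator simp: max_def)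
  ultimately show ?thesis by (simp add: set_borel_measurable_def)
qed

lemma resolvent_integrand_bound:
  assumes f: "f \<in> Brho \<rho>" and s: "0 \<le> s"
  shows "\<bar>exp (- \<beta> * s) * P s f x\<bar> \<le> exp (- (\<beta> - w) * s) * (M * rho_norm \<rho> f * \<rho> x)"
proof -
  have "\<bar>exp (- \<beta> * s) * P s f x\<bar> \<le> exp (- \<beta> * s) * (M * exp (w * s) * rho_norm \<rho> f * \<rho> x)"
    using P_bound[OF s f, of x] by (simp add: abs_mult)
  also have "\<dots> = (exp (- \<beta> * s) * exp (w * s)) * (M * rho_norm \<rho> f * \<rho> x)" by simp
  also have "exp (- \<beta> * s) * exp (w * s) = exp (- (\<beta> - w) * s)"
    by (simp add: exp_add[symmetric] algebra_simps)
  finally show ?thesis .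
qed

lemma resolvent_integrable:
  assumes f: "f \<in> Brho \<rho>" and \<beta>: "w < \<beta>"
  shows "set_integrable lborel {0..} (\<lambda>s. exp (- \<beta> * s) * P s f x)"
proof (rule set_integrable_bound)
  show "set_integrable lborel {0..} (\<lambda>s. exp (- (\<beta> - w) * s) * (M * rho_norm \<rho> f * \<rho> x))"
    by (intro set_integrable_mult_left set_integrable_exp_Ici) (use \<beta> in simp)
  show "set_borel_measurable lborel {0..} (\<lambda>s. exp (- \<beta> * s) * P s f x)"
    by (rule resolvent_measurable[OF f])
  show "AE s in lborel. s \<in> {0..} \<longrightarrow> norm (exp (- \<beta> * s) * P s f x) \<le> norm (exp (- (\<beta> - w) * s) * (M * rho_norm \<rho> f * \<rho> x))"
    unfolding real_norm_def
    by (intro AE_I2 impI order_trans[OF resolvent_integrand_bound[OF f] abs_ge_self]) simp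
qed

text \<open>Reduces signed functions to nonnegative ones, whose resolvents give nonnegative
  supermartingales.\<close>

lemma resolvent_diff:
  assumes f: "f \<in> Brho \<rho>" and \<beta>: "w < \<beta>"
  shows "resolvent P \<beta> f x = resolvent P \<beta> (\<lambda>x. max (f x) 0) x - resolvent P \<beta> (\<lambda>x. max (- f x) 0) x"
proof -
  have eq: "(\<lambda>x. max (f x) 0 - max (- f x) 0) = f" by (auto simp: max_def)
  have "resolvent P \<beta> f x = (LBINT s:{0..}. exp (- \<beta> * s) * P s (\<lambda>x. max (f x) 0) x - exp (- \<beta> * s) * P s (\<lambda>x. max (- f x) 0) x)"
    unfolding resolvent_def
    using P_diff[OF _ Brho_pos_part[OF f] Brho_neg_part[OF f]]
    by (intro set_lebesgue_integral_cong) (auto simp: eq right_diff_distrib)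
  also have "\<dots> = resolvent P \<beta> (\<lambda>x. max (f x) 0) x - resolvent P \<beta> (\<lambda>x. max (- f x) 0) x"
    unfolding resolvent_def
    by (intro set_integral_diff resolvent_integrable Brho_pos_part Brho_neg_part f \<beta>)
  finally show ?thesis .
qed

lemma resolvent_nonneg:
  assumes f: "f \<in> Brho \<rho>" "\<And>x. 0 \<le> f x"
  shows "0 \<le> resolvent P \<beta> f x"
  unfolding resolvent_def set_lebesgue_integral_def
  using P_nonneg[OF _ f] by (intro integral_nonneg_AE AE_I2) (auto split: split_indicator)

lemma ennreal_resolvent:
  assumes f: "f \<in> Brho \<rho>" "\<And>x. 0 \<le> f x" and \<beta>: "w < \<beta>"
  shows "ennreal (resolvent P \<beta> f x) = (\<integral>\<^sup>+s. ennreal (exp (- \<beta> * s)) * ennreal (P (max 0 s) f x) * indicator {0..} s \<partial>lborel)"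
proof -
  have "ennreal (resolvent P \<beta> f x) = (\<integral>\<^sup>+s. ennreal (indicator {0..} s *\<^sub>R (exp (- \<beta> * s) * P s f x)) \<partial>lborel)"
    unfolding resolvent_def set_lebesgue_integral_def
    using resolvent_integrable[OF f(1) \<beta>, of x] P_nonneg[OF _ f]
    by (intro nn_integral_eq_integral[symmetric] AE_I2) (auto simp: set_integrable_def split: split_indicator)
  also have "\<dots> = (\<integral>\<^sup>+s. ennreal (exp (- \<beta> * s)) * ennreal (P (max 0 s) f x) * indicator {0..} s \<partial>lborel)"
    using P_nonneg[OF _ f]
    by (intro nn_integral_cong) (auto split: split_indicator simp: max_def ennreal_mult)
  finally show ?thesis .
qed

lemma resolvent_continuous_on_sublevel:
  assumes f: "f \<in> Brho \<rho>" and \<beta>: "w < \<beta>"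
  shows "continuous_on {x. \<rho> x \<le> R} (resolvent P \<beta> f)"
proof -
  have "continuous_on {x. \<rho> x \<le> R} (\<lambda>x. LBINT s:{0..}. exp (- \<beta> * s) * P s f x)"
  proof (rule continuous_on_integral_right_continuous[OF compact_sublevel])
    fix s :: real and x assume s: "0 \<le> s"
    show "continuous_on {x. \<rho> x \<le> R} (\<lambda>x. exp (- \<beta> * s) * P s f x)"
      by (intro continuous_intros Brho_continuous_on_sublevel P_Brho s f)
    show "((\<lambda>u. exp (- \<beta> * u) * P u f x) \<longlongrightarrow> exp (- \<beta> * s) * P s f x) (at_right s)"
      by (intro tendsto_intros P_right_continuous s f)
    assume x: "x \<in> {x. \<rho> x \<le> R}"
    have "\<bar>exp (- \<beta> * s) * P s f x\<bar> \<le> exp (- (\<beta> - w) * s) * (M * rho_norm \<rho> f * \<rho> x)"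
      by (rule resolvent_integrand_bound[OF f s])
    also have "\<dots> \<le> exp (- (\<beta> - w) * s) * (\<bar>M * rho_norm \<rho> f\<bar> * \<bar>R\<bar>)"
      using x rho_pos[of x] by (intro mult_left_mono mult_mono) auto
    finally show "\<bar>exp (- \<beta> * s) * P s f x\<bar> \<le> exp (- (\<beta> - w) * s) * (\<bar>M * rho_norm \<rho> f\<bar> * \<bar>R\<bar>)" .
  next
    show "set_integrable lborel {0..} (\<lambda>s. exp (- (\<beta> - w) * s) * (\<bar>M * rho_norm \<rho> f\<bar> * \<bar>R\<bar>))"
      by (intro set_integrable_mult_left set_integrable_exp_Ici) (use \<beta> in simp)
  qed (rule resolvent_measurable[OF f])
  then show ?thesis by (simp add: resolvent_def[abs_def])
qed

text \<open>Substituting \<open>s / n\<close> for the time turns the left side into the integral of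
  \<open>exp (- s) * P (s / n) f x\<close>, and \<open>P (s / n) f x\<close> tends to
  \<open>f x\<close> by right continuity at 0.\<close>

lemma resolvent_tendsto:
  assumes f: "f \<in> Brho \<rho>"
  shows "(\<lambda>n. real n * resolvent P (real n) f x) \<longlonglongrightarrow> f x"
proof -
  let ?g = "\<lambda>n s. indicator {0..} s *\<^sub>R (exp (- s) * P (max 0 s / real n) f x)"
  let ?C = "\<bar>M * rho_norm \<rho> f * \<rho> x\<bar>"
  \<comment> \<open>From \<open>m\<close> on the growth factor \<open>exp (w * (s / n))\<close> is
    at most \<open>exp (s / 2)\<close>, so half of the decay of \<open>exp (- s)\<close> is left for
    the dominating function. The extra 1 keeps \<open>m\<close> positive.\<close>
  obtain m :: nat where m: "2 * \<bar>w\<bar> + 1 < real m" using reals_Archimedean2 by metis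
  have eq: "real n * resolvent P (real n) f x = (\<integral>s. ?g n s \<partial>lborel)" if n: "0 < n" for n
  proof -
    have "resolvent P (real n) f x = \<bar>1 / real n\<bar> *\<^sub>R (\<integral>s. indicator {0..} (0 + 1 / real n * s) *\<^sub>R
        (exp (- real n * (0 + 1 / real n * s)) * P (0 + 1 / real n * s) f x) \<partial>lborel)"
      unfolding resolvent_def set_lebesgue_integral_def by (rule lborel_integral_real_affine) (use n in simp)
    also have "(\<integral>s. indicator {0..} (0 + 1 / real n * s) *\<^sub>R
        (exp (- real n * (0 + 1 / real n * s)) * P (0 + 1 / real n * s) f x) \<partial>lborel) = (\<integral>s. ?g n s \<partial>lborel)"
      using n by (intro Bochner_Integration.integral_cong refl)
        (auto split: split_indicator simp: zero_le_divide_iff max_def)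
    finally show ?thesis using n by simp
  qed
  have "(\<lambda>n. \<integral>s. ?g (n + m) s \<partial>lborel) \<longlonglongrightarrow> (\<integral>s. indicator {0..} s *\<^sub>R (exp (- s) * f x) \<partial>lborel)"
  proof (rule integral_dominated_convergence[where w = "\<lambda>s. indicator {0..} s *\<^sub>R (exp (- (1/2) * s) * ?C)"])
    show "integrable lborel (\<lambda>s. indicator {0..} s *\<^sub>R (exp (- (1/2) * s) * ?C))"
      using set_integrable_mult_left[OF set_integrable_exp_Ici[of "1/2"], of ?C]
      by (simp add: set_integrable_def)
    show "?g (n + m) \<in> borel_measurable lborel" for n
    proof -
      have "(\<lambda>s. P (max 0 s / real (n + m)) f x) = (\<lambda>s. P (max 0 (s / real (n + m))) f x)"
        by (auto simp: max_def zero_le_divide_iff divide_nonpos_nonneg intro!: arg_cong[of _ _ "\<lambda>s. P s f x"])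
      also have "\<dots> \<in> borel_measurable lborel"
        using measurable_compose[OF _ P_max_measurable[OF f, of x], of "\<lambda>s. s / real (n + m)" lborel] by simp
      finally show ?thesis by measurable
    qed
    show "AE s in lborel. (\<lambda>n. ?g (n + m) s) \<longlonglongrightarrow> indicator {0..} s *\<^sub>R (exp (- s) * f x)"
    proof (intro AE_I2)
      fix s :: real
      consider "s < 0" | "s = 0" | "0 < s" by linarith
      then show "(\<lambda>n. ?g (n + m) s) \<longlonglongrightarrow> indicator {0..} s *\<^sub>R (exp (- s) * f x)"
      proof cases
        case 3
        have "(\<lambda>n. s / real (n + m)) \<longlonglongrightarrow> 0"
          by (rule LIMSEQ_ignore_initial_segment[OF lim_const_over_n])
        then have "filterlim (\<lambda>n. s / real (n + m)) (at_right 0) sequentially"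
          unfolding filterlim_at using 3 m by (auto simp: intro!: always_eventually divide_pos_pos)
        from filterlim_compose[OF P_right_continuous[OF order_refl f, of x] this]
        have "(\<lambda>n. P (s / real (n + m)) f x) \<longlonglongrightarrow> f x" by (simp add: P_zero[OF f])
        then show ?thesis using 3 by (auto intro!: tendsto_intros simp: max_def)
      qed (simp_all add: P_zero[OF f])
    qed
    show "AE s in lborel. norm (?g (n + m) s) \<le> indicator {0..} s *\<^sub>R (exp (- (1/2) * s) * ?C)" for n
    proof (intro AE_I2)
      fix s :: real
      show "norm (?g (n + m) s) \<le> indicator {0..} s *\<^sub>R (exp (- (1/2) * s) * ?C)"
      proof (cases "0 \<le> s")
        case True
        let ?k = "real (n + m)"
        have k: "2 * \<bar>w\<bar> \<le> ?k" "0 < ?k" using m by auto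
        have "w * (s / ?k) \<le> s / 2"
        proof -
          have "w * s \<le> \<bar>w\<bar> * s" using True by (intro mult_right_mono) auto
          also have "\<dots> \<le> (?k / 2) * s" using True k by (intro mult_right_mono) auto
          finally show ?thesis using k by (simp add: field_simps)
        qed
        then have e: "exp (w * (s / ?k)) \<le> exp (s / 2)" by simp
        have "\<bar>P (s / ?k) f x\<bar> \<le> M * exp (w * (s / ?k)) * rho_norm \<rho> f * \<rho> x"
          using True k by (intro P_bound f) auto
        also have "\<dots> = exp (w * (s / ?k)) * (M * rho_norm \<rho> f * \<rho> x)" by simp
        also have "\<dots> \<le> exp (w * (s / ?k)) * ?C" by (intro mult_left_mono) auto
        also have "\<dots> \<le> exp (s / 2) * ?C" by (intro mult_right_mono e) auto
        finally have "exp (- s) * \<bar>P (s / ?k) f x\<bar> \<le> exp (- s) * (exp (s / 2) * ?C)" by simp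
        also have "\<dots> = (exp (- s) * exp (s / 2)) * ?C" by simp
        also have "exp (- s) * exp (s / 2) = exp (- (1/2) * s)" by (simp add: exp_add[symmetric])
        finally show ?thesis using True by (simp add: abs_mult max_def)
      qed simp
    qed
  qed simp
  moreover have "(\<integral>s. indicator {0..} s *\<^sub>R (exp (- s) * f x) \<partial>lborel) = f x"
  proof -
    have "(\<integral>\<^sup>+s. ennreal (exp (- s)) * indicator {0..} s \<partial>lborel) = 0 - (- exp (- (0::real)))"
    proof (rule nn_integral_FTC_atLeast)
      show "((\<lambda>s::real. - exp (- s)) \<longlongrightarrow> 0) at_top" by real_asymp
    qed (auto intro!: derivative_eq_intros)
    also have "(\<integral>\<^sup>+s. ennreal (exp (- s)) * indicator {0..} s \<partial>lborel) =
        (\<integral>\<^sup>+s. ennreal (indicator {0..} s *\<^sub>R exp (- s)) \<partial>lborel)"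
      by (intro nn_integral_cong) (auto split: split_indicator)
    finally have "(\<integral>s. indicator {0..} s *\<^sub>R exp (- s) \<partial>lborel) = (1::real)"
      by (subst integral_eq_nn_integral) auto
    then show ?thesis by (simp flip: mult.assoc)
  qed
  ultimately have "(\<lambda>n. \<integral>s. ?g (n + m) s \<partial>lborel) \<longlonglongrightarrow> f x" by simp
  moreover have "(\<integral>s. ?g (n + m) s \<partial>lborel) = real (n + m) * resolvent P (real (n + m)) f x" for n
  proof -
    have "0 < n + m" using m by (cases m) auto
    from eq[OF this] show ?thesis by (rule sym)
  qed
  ultimately have "(\<lambda>n. real (n + m) * resolvent P (real (n + m)) f x) \<longlonglongrightarrow> f x" by simp
  then show ?thesis by (rule LIMSEQ_offset)
qed

end

section \<open>The resolvent supermartingale\<close>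

text \<open>\<open>N\<close> stands for the completed path measure and \<open>L\<close> for the
  coordinate process. From \<open>init\<close>, integrability of the weight at time 0, come the
  finite initial expectations of the supermartingales below.\<close>

locale feller_process = weighted_semigroup \<rho> P M w
  for \<rho> :: "'a::topological_space \<Rightarrow> real" and P and M w +
  fixes N :: "'w measure" and F :: "real \<Rightarrow> 'w measure" and L :: "real \<Rightarrow> 'w \<Rightarrow> 'a"
  assumes prob: "prob_space N"
    and complete: "complete_measure N"
    and filt: "complete_rc_filtration N F"
    and adapted: "0 \<le> t \<Longrightarrow> L t \<in> F t \<rightarrow>\<^sub>M borel"
    and init: "(\<integral>\<^sup>+\<omega>. ennreal (\<rho> (L 0 \<omega>)) \<partial>N) < \<infinity>"
    and markov_integrable: "0 \<le> t \<Longrightarrow> f \<in> Brho \<rho> \<Longrightarrow> integrable N (\<lambda>\<omega>. f (L t \<omega>))"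
    and markov: "0 \<le> s \<Longrightarrow> s \<le> t \<Longrightarrow> f \<in> Brho \<rho> \<Longrightarrow>
      AE \<omega> in N. real_cond_exp N (F s) (\<lambda>\<omega>. f (L t \<omega>)) \<omega> = P (t - s) f (L s \<omega>)"
begin

interpretation prob_space N by (rule prob)

lemma subalg: "0 \<le> t \<Longrightarrow> subalgebra N (F t)"
  using filt by (simp add: complete_rc_filtration_def)

lemma sets_F_N: "0 \<le> t \<Longrightarrow> A \<in> sets (F t) \<Longrightarrow> A \<in> sets N"
  using subalg[of t] by (auto simp: subalgebra_def)

lemma space_N_F0: "space N \<in> sets (F 0)"
  using subalg[of 0] sets.top[of "F 0"] by (simp add: subalgebra_def)

lemma null_sets_F0: "A \<in> null_sets N \<Longrightarrow> A \<in> sets (F 0)"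
  using filt unfolding complete_rc_filtration_def by blast

lemma measurable_L: "0 \<le> t \<Longrightarrow> L t \<in> N \<rightarrow>\<^sub>M borel"
  by (rule measurable_from_subalg[OF subalg adapted])

lemma set_integral_markov:
  assumes s: "0 \<le> s" "s \<le> t" and f: "f \<in> Brho \<rho>" and A: "A \<in> sets (F s)"
  shows "(\<integral>\<omega>\<in>A. f (L t \<omega>) \<partial>N) = (\<integral>\<omega>\<in>A. P (t - s) f (L s \<omega>) \<partial>N)"
proof -
  interpret sub: finite_measure_subalgebra N "F s" by standard (rule subalg[OF s(1)])
  have t: "0 \<le> t" using s by simp
  have [measurable]: "A \<in> sets N" by (rule sets_F_N[OF s(1) A])
  have [measurable]: "(\<lambda>\<omega>. P (t - s) f (L s \<omega>)) \<in> borel_measurable N"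
    by (rule measurable_compose[OF measurable_L[OF s(1)] Brho_measurable]) (use s f in \<open>auto intro: P_Brho\<close>)
  have "(\<integral>\<omega>\<in>A. f (L t \<omega>) \<partial>N) = (\<integral>\<omega>\<in>A. real_cond_exp N (F s) (\<lambda>\<omega>. f (L t \<omega>)) \<omega> \<partial>N)"
    by (rule sub.real_cond_exp_intA[OF markov_integrable[OF t f] A])
  also have "\<dots> = (\<integral>\<omega>\<in>A. P (t - s) f (L s \<omega>) \<partial>N)"
    unfolding set_lebesgue_integral_def
    by (intro integral_cong_AE) (use markov[OF s f] in auto)
  finally show ?thesis .
qed

lemma set_nn_integral_markov:
  assumes s: "0 \<le> s" "s \<le> t" and f: "f \<in> Brho \<rho>" "\<And>x. 0 \<le> f x" and A: "A \<in> sets (F s)"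
  shows "(\<integral>\<^sup>+\<omega>\<in>A. ennreal (f (L t \<omega>)) \<partial>N) = (\<integral>\<^sup>+\<omega>\<in>A. ennreal (P (t - s) f (L s \<omega>)) \<partial>N)"
proof -
  have AN: "A \<in> sets N" by (rule sets_F_N[OF s(1) A])
  have eq: "(\<integral>\<^sup>+\<omega>\<in>A. ennreal (g (L r \<omega>)) \<partial>N) = ennreal (\<integral>\<omega>\<in>A. g (L r \<omega>) \<partial>N)"
    if "0 \<le> r" "g \<in> Brho \<rho>" "\<And>x. 0 \<le> g x" for g r
  proof -
    have "(\<integral>\<^sup>+\<omega>\<in>A. ennreal (g (L r \<omega>)) \<partial>N) = (\<integral>\<^sup>+\<omega>. ennreal (indicator A \<omega> *\<^sub>R g (L r \<omega>)) \<partial>N)"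
      by (intro nn_integral_cong) (auto split: split_indicator)
    also have "\<dots> = ennreal (\<integral>\<omega>. indicator A \<omega> *\<^sub>R g (L r \<omega>) \<partial>N)"
      using that by (intro nn_integral_eq_integral integrable_mult_indicator AN markov_integrable AE_I2)
        (auto split: split_indicator)
    finally show ?thesis by (simp add: set_lebesgue_integral_def)
  qed
  show ?thesis
    using eq[of t f] eq[of s "P (t - s) f"] set_integral_markov[OF s f(1) A] s f
    by (simp add: P_Brho P_nonneg)
qed

text \<open>The resolvent is defined pointwise, so its measurability in \<open>x\<close> comes from
  joint measurability of the integrand in time and space.\<close>

lemma measurable_resolvent:
  assumes f: "f \<in> Brho \<rho>"
  shows "resolvent P \<beta> f \<in> borel_measurable borel"
proof -
  have [measurable]: "(\<lambda>(u, x). P (max 0 u) f x) \<in> borel_measurable (borel \<Otimes>\<^sub>M borel)"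
    by (intro measurable_pair_right_continuous Brho_measurable P_Brho f P_max_right_continuous) simp
  have "(\<lambda>x. \<integral>u. indicator {0..} u *\<^sub>R (exp (- \<beta> * u) * P (max 0 u) f x) \<partial>lborel) \<in> borel_measurable borel"
    by measurable
  also have "(\<lambda>x. \<integral>u. indicator {0..} u *\<^sub>R (exp (- \<beta> * u) * P (max 0 u) f x) \<partial>lborel) = resolvent P \<beta> f"
    unfolding resolvent_def set_lebesgue_integral_def
    by (intro ext Bochner_Integration.integral_cong refl) (auto split: split_indicator simp: max_def)
  finally show ?thesis .
qed

text \<open>On the right \<open>t\<close> occurs only as the lower end of the domain of integration.
  The supermartingale inequality becomes monotonicity in the domain, and lower semicontinuity in
  \<open>t\<close> becomes Fatou's lemma for its indicator.\<close>

lemma set_nn_integral_resolvent: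
  assumes f: "f \<in> Brho \<rho>" "\<And>x. 0 \<le> f x" and \<beta>: "w < \<beta>"
    and s: "0 \<le> s" "s \<le> t" and A: "A \<in> sets (F s)"
  shows "(\<integral>\<^sup>+\<omega>\<in>A. ennreal (exp (- \<beta> * t) * resolvent P \<beta> f (L t \<omega>)) \<partial>N) =
    (\<integral>\<^sup>+v. ennreal (exp (- \<beta> * v)) * (\<integral>\<^sup>+\<omega>\<in>A. ennreal (P (max 0 (v - s)) f (L s \<omega>)) \<partial>N) * indicator {t..} v \<partial>lborel)"
    (is "?lhs = (\<integral>\<^sup>+v. ?G v * indicator {t..} v \<partial>lborel)")
    and "(\<lambda>v. ennreal (exp (- \<beta> * v)) * (\<integral>\<^sup>+\<omega>\<in>A. ennreal (P (max 0 (v - s)) f (L s \<omega>)) \<partial>N)) \<in> borel_measurable borel"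
proof -
  have t: "0 \<le> t" using s by simp
  have [measurable]: "A \<in> sets N" by (rule sets_F_N[OF s(1) A])
  have meas: "(\<lambda>(u, \<omega>). P (max 0 u) f (L r \<omega>)) \<in> borel_measurable (borel \<Otimes>\<^sub>M N)" if "0 \<le> r" for r
    by (intro measurable_pair_right_continuous measurable_compose[OF measurable_L[OF that]]
        Brho_measurable P_Brho f P_max_right_continuous) simp
  note [measurable] = meas[OF t] meas[OF s(1)]
  have [measurable]: "(\<lambda>(u, \<omega>). P (max 0 (u - s)) f (L s \<omega>)) \<in> borel_measurable (borel \<Otimes>\<^sub>M N)"
    using measurable_compose[OF _ meas[OF s(1)], of "\<lambda>p. (fst p - s, snd p)" "borel \<Otimes>\<^sub>M N"]
    by (simp add: case_prod_beta)
  show G: "?G \<in> borel_measurable borel" by measurable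
  interpret pair_sigma_finite lborel N ..
  have ex: "exp (- \<beta> * (t + u)) = exp (- \<beta> * t) * exp (- \<beta> * u)" for u
    by (simp add: exp_add[symmetric] algebra_simps)
  have "?lhs = (\<integral>\<^sup>+\<omega>. (\<integral>\<^sup>+u. ennreal (exp (- \<beta> * (t + u))) * (ennreal (P (max 0 u) f (L t \<omega>)) * indicator A \<omega>) * indicator {0..} u \<partial>lborel) \<partial>N)"
  proof (intro nn_integral_cong)
    fix \<omega> assume w: "\<omega> \<in> space N"
    have [measurable]: "(\<lambda>u. P (max 0 u) f (L t \<omega>)) \<in> borel_measurable borel" by (rule P_max_measurable[OF f(1)])
    have "ennreal (exp (- \<beta> * t) * resolvent P \<beta> f (L t \<omega>)) * indicator A \<omega> =
      (\<integral>\<^sup>+u. ennreal (exp (- \<beta> * t)) * indicator A \<omega> * (ennreal (exp (- \<beta> * u)) * ennreal (P (max 0 u) f (L t \<omega>)) * indicator {0..} u) \<partial>lborel)"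
      by (subst nn_integral_cmult, measurable)
        (simp add: ennreal_mult resolvent_nonneg[OF f] ennreal_resolvent[OF f \<beta>] mult.assoc mult.commute mult.left_commute)
    also have "\<dots> = (\<integral>\<^sup>+u. ennreal (exp (- \<beta> * (t + u))) * (ennreal (P (max 0 u) f (L t \<omega>)) * indicator A \<omega>) * indicator {0..} u \<partial>lborel)"
      unfolding ex ennreal_mult[OF exp_ge_zero exp_ge_zero]
      by (simp only: mult.assoc mult.commute mult.left_commute)
    finally show "ennreal (exp (- \<beta> * t) * resolvent P \<beta> f (L t \<omega>)) * indicator A \<omega> =
      (\<integral>\<^sup>+u. ennreal (exp (- \<beta> * (t + u))) * (ennreal (P (max 0 u) f (L t \<omega>)) * indicator A \<omega>) * indicator {0..} u \<partial>lborel)" .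
  qed
  also have "\<dots> = (\<integral>\<^sup>+u. (\<integral>\<^sup>+\<omega>. ennreal (exp (- \<beta> * (t + u))) * (ennreal (P (max 0 u) f (L t \<omega>)) * indicator A \<omega>) * indicator {0..} u \<partial>N) \<partial>lborel)"
    by (rule Fubini') measurable
  \<comment> \<open>Prepares the substitution \<open>v = t + u\<close>; the factor 1 matches the
    affine form of the change of variables.\<close>
  also have "\<dots> = (\<integral>\<^sup>+u. ?G (t + 1 * u) * indicator {t..} (t + 1 * u) \<partial>lborel)"
  proof (intro nn_integral_cong)
    fix u :: real
    show "(\<integral>\<^sup>+\<omega>. ennreal (exp (- \<beta> * (t + u))) * (ennreal (P (max 0 u) f (L t \<omega>)) * indicator A \<omega>) * indicator {0..} u \<partial>N) =
      ?G (t + 1 * u) * indicator {t..} (t + 1 * u)"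
    proof (cases "0 \<le> u")
      case True
      have [measurable]: "(\<lambda>\<omega>. P u f (L t \<omega>)) \<in> borel_measurable N"
        by (intro measurable_compose[OF measurable_L[OF t]] Brho_measurable P_Brho f True)
      have "(\<integral>\<^sup>+\<omega>\<in>A. ennreal (P u f (L t \<omega>)) \<partial>N) = (\<integral>\<^sup>+\<omega>\<in>A. ennreal (P (t - s) (P u f) (L s \<omega>)) \<partial>N)"
        by (intro set_nn_integral_markov s A P_Brho f P_nonneg True)
      also have "P (t - s) (P u f) = P (max 0 (t + u - s)) f"
        using P_add[of "t - s" u f] True s f by (simp add: add.commute add_diff_eq max_def)
      finally have "(\<integral>\<^sup>+\<omega>\<in>A. ennreal (P u f (L t \<omega>)) \<partial>N) = (\<integral>\<^sup>+\<omega>\<in>A. ennreal (P (max 0 (t + u - s)) f (L s \<omega>)) \<partial>N)" .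
      then show ?thesis using True by (simp add: max_def nn_integral_cmult)
    qed simp
  qed
  also have "\<dots> = (\<integral>\<^sup>+v. ?G v * indicator {t..} v \<partial>lborel)"
    using nn_integral_real_affine[of "\<lambda>v. ?G v * indicator {t..} v" 1 t] G by simp
  finally show "?lhs = (\<integral>\<^sup>+v. ?G v * indicator {t..} v \<partial>lborel)" .
qed

lemma nonneg_supermartingale_resolvent:
  assumes f: "f \<in> Brho \<rho>" "\<And>x. 0 \<le> f x" and \<beta>: "w < \<beta>"
  shows "nonneg_supermartingale N F (\<lambda>t \<omega>. exp (- \<beta> * t) * resolvent P \<beta> f (L t \<omega>))"
proof (unfold_locales, rule filt)
  fix t :: real and \<omega>
  show "0 \<le> exp (- \<beta> * t) * resolvent P \<beta> f (L t \<omega>)"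
    by (intro mult_nonneg_nonneg resolvent_nonneg f) simp
next
  fix t :: real assume "0 \<le> t"
  have "(\<lambda>\<omega>. resolvent P \<beta> f (L t \<omega>)) \<in> borel_measurable (F t)"
    by (rule measurable_compose[OF adapted[OF \<open>0 \<le> t\<close>] measurable_resolvent[OF f(1)]])
  then show "(\<lambda>\<omega>. exp (- \<beta> * t) * resolvent P \<beta> f (L t \<omega>)) \<in> borel_measurable (F t)"
    by measurable
next
  fix s t :: real and A assume s: "0 \<le> s" "s \<le> t" and A: "A \<in> sets (F s)"
  show "(\<integral>\<^sup>+\<omega>\<in>A. ennreal (exp (- \<beta> * t) * resolvent P \<beta> f (L t \<omega>)) \<partial>N) \<le>
      (\<integral>\<^sup>+\<omega>\<in>A. ennreal (exp (- \<beta> * s) * resolvent P \<beta> f (L s \<omega>)) \<partial>N)"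
    unfolding set_nn_integral_resolvent(1)[OF f \<beta> s A]
      set_nn_integral_resolvent(1)[OF f \<beta> s(1) order_refl A]
    by (intro nn_integral_mono mult_left_mono) (use s in \<open>auto split: split_indicator\<close>)
next
  \<comment> \<open>The resolvent is dominated by \<open>C\<close> times the weight, and the weight
    is integrable at time 0.\<close>
  define C where "C = (LBINT s:{0..}. exp (- (\<beta> - w) * s) * (M * rho_norm \<rho> f))"
  have int: "set_integrable lborel {0..} (\<lambda>s. exp (- (\<beta> - w) * s) * (M * rho_norm \<rho> f))"
    by (intro set_integrable_mult_left set_integrable_exp_Ici) (use \<beta> in simp)
  have le: "resolvent P \<beta> f x \<le> C * \<rho> x" for x
  proof -
    have "resolvent P \<beta> f x \<le> (LBINT s:{0..}. exp (- (\<beta> - w) * s) * (M * rho_norm \<rho> f) * \<rho> x)"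
      unfolding resolvent_def
    proof (rule set_integral_mono)
      show "set_integrable lborel {0..} (\<lambda>s. exp (- \<beta> * s) * P s f x)"
        by (rule resolvent_integrable[OF f(1) \<beta>])
      show "set_integrable lborel {0..} (\<lambda>s. exp (- (\<beta> - w) * s) * (M * rho_norm \<rho> f) * \<rho> x)"
        by (intro set_integrable_mult_left int)
      show "exp (- \<beta> * s) * P s f x \<le> exp (- (\<beta> - w) * s) * (M * rho_norm \<rho> f) * \<rho> x" if "s \<in> {0..}" for s
        using resolvent_integrand_bound[OF f(1), of s \<beta> x] that by (simp add: mult.assoc)
    qed
    also have "\<dots> = C * \<rho> x" by (simp add: C_def)
    finally show ?thesis .
  qed
  have "(\<integral>\<^sup>+\<omega>. ennreal (exp (- \<beta> * 0) * resolvent P \<beta> f (L 0 \<omega>)) \<partial>N) \<le> (\<integral>\<^sup>+\<omega>. ennreal (C * \<rho> (L 0 \<omega>)) \<partial>N)"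
    by (intro nn_integral_mono ennreal_leI) (simp add: le)
  also have "\<dots> = ennreal C * (\<integral>\<^sup>+\<omega>. ennreal (\<rho> (L 0 \<omega>)) \<partial>N)"
    using measurable_compose[OF measurable_L[OF order_refl] measurable_rho]
    by (subst nn_integral_cmult[symmetric]) (auto simp: ennreal_mult'' less_imp_le[OF rho_pos])
  also have "\<dots> < \<infinity>" using init by (auto simp: ennreal_mult_less_top)
  finally show "(\<integral>\<^sup>+\<omega>. ennreal (exp (- \<beta> * 0) * resolvent P \<beta> f (L 0 \<omega>)) \<partial>N) < \<infinity>" .
next
  fix t :: real and r :: "nat \<Rightarrow> real"
  assume t: "0 \<le> t" and r: "\<And>n. t < r n" "r \<longlonglongrightarrow> t"
  let ?G = "\<lambda>v. ennreal (exp (- \<beta> * v)) * (\<integral>\<^sup>+\<omega>\<in>space N. ennreal (P (max 0 (v - 0)) f (L 0 \<omega>)) \<partial>N)"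
  have eq: "(\<integral>\<^sup>+\<omega>. ennreal (exp (- \<beta> * u) * resolvent P \<beta> f (L u \<omega>)) \<partial>N) = (\<integral>\<^sup>+v. ?G v * indicator {u..} v \<partial>lborel)"
    if "0 \<le> u" for u
    using set_nn_integral_resolvent(1)[OF f \<beta> order_refl that space_N_F0]
    by (simp only: set_nn_integral_space)
  have G: "?G \<in> borel_measurable borel"
    by (rule set_nn_integral_resolvent(2)[OF f \<beta> order_refl order_refl space_N_F0])
  have "(\<integral>\<^sup>+\<omega>. ennreal (exp (- \<beta> * t) * resolvent P \<beta> f (L t \<omega>)) \<partial>N) = (\<integral>\<^sup>+v. ?G v * indicator {t..} v \<partial>lborel)"
    by (rule eq[OF t])
  also have "\<dots> \<le> (\<integral>\<^sup>+v. liminf (\<lambda>n. ?G v * indicator {r n..} v) \<partial>lborel)"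
  \<comment> \<open>The single point \<open>v = t\<close> has measure zero, and for
    \<open>v > t\<close> eventually \<open>r n < v\<close>.\<close>
  proof (rule nn_integral_mono_AE, use AE_lborel_singleton[of t] in eventually_elim)
    case (elim v)
    show ?case
    proof (cases "t < v")
      case True
      then have "\<forall>\<^sub>F n in sequentially. r n < v" using order_tendstoD(2)[OF r(2)] by simp
      then have "\<forall>\<^sub>F n in sequentially. ?G v * indicator {t..} v \<le> ?G v * indicator {r n..} v"
        by eventually_elim (use True in simp)
      then show ?thesis by (rule Liminf_bounded)
    qed (use elim in simp)
  qed
  also have "\<dots> \<le> liminf (\<lambda>n. \<integral>\<^sup>+v. ?G v * indicator {r n..} v \<partial>lborel)"
    by (intro nn_integral_liminf) (use G in measurable)
  also have "\<dots> = liminf (\<lambda>n. \<integral>\<^sup>+\<omega>. ennreal (exp (- \<beta> * r n) * resolvent P \<beta> f (L (r n) \<omega>)) \<partial>N)"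
    using eq[OF order_trans[OF t less_imp_le[OF r(1)]]] by simp
  finally show "(\<integral>\<^sup>+\<omega>. ennreal (exp (- \<beta> * t) * resolvent P \<beta> f (L t \<omega>)) \<partial>N) \<le>
      liminf (\<lambda>n. \<integral>\<^sup>+\<omega>. ennreal (exp (- \<beta> * r n) * resolvent P \<beta> f (L (r n) \<omega>)) \<partial>N)" .
qed

end

section \<open>The weight as a supermartingale\<close>

text \<open>Being decided by countably many functions in \<open>Cb\<close> is stable under
  complements and countable unions, so it passes from the generators to all Baire sets.\<close>

lemma baire_set_determined:
  assumes "S \<in> baire_sets"
  shows "\<exists>g :: nat \<Rightarrow> 'a::topological_space \<Rightarrow> real. (\<forall>n. g n \<in> Cb) \<and>
    (\<forall>x y. (\<forall>n. g n x = g n y) \<longrightarrow> (x \<in> S \<longleftrightarrow> y \<in> S))"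
  using assms unfolding baire_sets_def
proof (induction rule: sigma_sets.induct)
  case (Basic a)
  then obtain f B where "a = f -` B" "f \<in> Cb" by blast
  then show ?case by (intro exI[of _ "\<lambda>_. f"]) auto
next
  case Empty
  have "(\<lambda>_. 0) \<in> (Cb :: ('a \<Rightarrow> real) set)" by (simp add: Cb_def)
  then show ?case by (intro exI[of _ "\<lambda>_ _. 0"]) auto
next
  case (Compl a)
  then show ?case by auto
next
  case (Union a)
  then have "\<forall>i. \<exists>g :: nat \<Rightarrow> 'a \<Rightarrow> real. (\<forall>n. g n \<in> Cb) \<and>
    (\<forall>x y. (\<forall>n. g n x = g n y) \<longrightarrow> (x \<in> a i \<longleftrightarrow> y \<in> a i))" by blast
  then obtain g :: "nat \<Rightarrow> nat \<Rightarrow> 'a \<Rightarrow> real" where g: "\<And>i n. g i n \<in> Cb"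
    "\<And>i x y. (\<And>n. g i n x = g i n y) \<Longrightarrow> (x \<in> a i \<longleftrightarrow> y \<in> a i)" by metis
  \<comment> \<open>Pairing merges the families belonging to the sets \<open>a i\<close> into one
    sequence.\<close>
  define h where "h n = g (fst (prod_decode n)) (snd (prod_decode n))" for n
  have "g i n = h (prod_encode (i, n))" for i n by (simp add: h_def)
  then have "x \<in> a i \<longleftrightarrow> y \<in> a i" if "\<forall>n. h n x = h n y" for i x y
    using that by (intro g(2)) simp
  then show ?case using g(1) by (intro exI[of _ h]) (auto simp: h_def)
qed

text \<open>The functions deciding \<open>K\<close> form a continuous map \<open>\<Phi>\<close> into
  the metrizable space of real sequences. \<open>K\<close> is the full preimage of its compact
  image, so the distance to that image is the function sought.\<close>

lemma compact_baire_zero_set: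
  fixes K :: "'a::topological_space set"
  assumes K: "compact K" "K \<in> baire_sets"
  obtains h :: "'a \<Rightarrow> real" where "continuous_on UNIV h" "\<And>x. 0 \<le> h x" "\<And>x. h x = 0 \<longleftrightarrow> x \<in> K"
proof (cases "K = {}")
  \<comment> \<open>\<open>infdist\<close> to the empty set is 0 by convention, which would give the
    wrong zero set.\<close>
  case True
  show thesis by (rule that[of "\<lambda>_. 1"]) (use True in auto)
next
  case False
  obtain g :: "nat \<Rightarrow> 'a \<Rightarrow> real" where g: "\<And>n. g n \<in> Cb"
    "\<And>x y. (\<And>n. g n x = g n y) \<Longrightarrow> (x \<in> K \<longleftrightarrow> y \<in> K)"
    using baire_set_determined[OF K(2)] by metis
  define \<Phi> where "\<Phi> x = (\<lambda>n. g n x)" for x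
  have cont: "continuous_on UNIV \<Phi>"
    unfolding \<Phi>_def using g(1) by (intro continuous_on_coordinatewise_then_product) (simp add: Cb_def)
  have "compact (\<Phi> ` K)"
    by (intro compact_continuous_image K continuous_on_subset[OF cont]) simp
  then have cl: "closed (\<Phi> ` K)" by (rule compact_imp_closed)
  have "\<Phi> x \<in> \<Phi> ` K \<longleftrightarrow> x \<in> K" for x
  proof
    assume "\<Phi> x \<in> \<Phi> ` K"
    then obtain y where "y \<in> K" "\<Phi> x = \<Phi> y" by blast
    then show "x \<in> K" using g(2)[of x y] by (simp add: \<Phi>_def fun_eq_iff)
  qed simp
  then have "infdist (\<Phi> x) (\<Phi> ` K) = 0 \<longleftrightarrow> x \<in> K" for x
    using in_closed_iff_infdist_zero[OF cl] False by blast
  then show thesis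
    by (intro that[of "\<lambda>x. infdist (\<Phi> x) (\<Phi> ` K)"] continuous_on_infdist cont infdist_nonneg)
qed

lemma Cb_max:
  assumes "f \<in> Cb" "g \<in> Cb" shows "(\<lambda>x. max (f x) (g x)) \<in> Cb"
proof -
  obtain B C where "\<And>x. \<bar>f x\<bar> \<le> B" "\<And>x. \<bar>g x\<bar> \<le> C" using assms by (auto simp: Cb_def bounded_iff)
  then have "\<bar>max (f x) (g x)\<bar> \<le> max B C" for x
    by (smt (verit))
  then have "bounded (range (\<lambda>x. max (f x) (g x)))" unfolding bounded_iff by auto
  then show ?thesis using assms by (auto simp: Cb_def intro!: continuous_intros)
qed

text \<open>The weight is the supremum over dyadic \<open>q\<close> of \<open>q\<close> times the
  indicator of \<open>\<rho> > q\<close>. If \<open>h q\<close> vanishes exactly where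
  \<open>\<rho> \<le> q\<close>, then \<open>q * min 1 (j * h q)\<close> is in \<open>Cb\<close> and
  increases to that multiple as \<open>j\<close> grows. Running maxima over an enumeration of all
  pairs of indices give the sequence.\<close>

lemma baire_weight_approx:
  fixes \<rho> :: "'a::topological_space \<Rightarrow> real"
  assumes pos: "\<And>x. 0 < \<rho> x" and K: "\<And>R. compact {x. \<rho> x \<le> R}"
    and baire: "\<forall>B\<in>sets (borel :: real measure). \<rho> -` B \<in> baire_sets"
  obtains g :: "nat \<Rightarrow> 'a \<Rightarrow> real" where "\<And>k. g k \<in> Cb" "\<And>k x. 0 \<le> g k x"
    "\<And>x. incseq (\<lambda>k. g k x)" "\<And>x. (\<lambda>k. g k x) \<longlonglongrightarrow> \<rho> x"
proof -
  have ex: "\<forall>R. \<exists>h :: 'a \<Rightarrow> real. continuous_on UNIV h \<and> (\<forall>x. 0 \<le> h x) \<and> (\<forall>x. h x = 0 \<longleftrightarrow> \<rho> x \<le> R)"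
  proof
    fix R :: real
    have "{..R} \<in> sets borel" by simp
    then have "\<rho> -` {..R} \<in> baire_sets" using baire by blast
    then have "{x. \<rho> x \<le> R} \<in> baire_sets" by (simp add: vimage_def)
    obtain h :: "'a \<Rightarrow> real" where "continuous_on UNIV h" "\<And>x. 0 \<le> h x" "\<And>x. h x = 0 \<longleftrightarrow> x \<in> {x. \<rho> x \<le> R}"
      by (rule compact_baire_zero_set[OF K \<open>{x. \<rho> x \<le> R} \<in> baire_sets\<close>]) (rule that)
    then show "\<exists>h :: 'a \<Rightarrow> real. continuous_on UNIV h \<and> (\<forall>x. 0 \<le> h x) \<and> (\<forall>x. h x = 0 \<longleftrightarrow> \<rho> x \<le> R)"
      by (intro exI[of _ h]) simp
  qed
  from choice[OF ex] obtain h :: "real \<Rightarrow> 'a \<Rightarrow> real" where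
    "\<forall>R. continuous_on UNIV (h R) \<and> (\<forall>x. 0 \<le> h R x) \<and> (\<forall>x. h R x = 0 \<longleftrightarrow> \<rho> x \<le> R)" by blast
  then have h: "\<And>R. continuous_on UNIV (h R)" "\<And>R x. 0 \<le> h R x"
    "\<And>R x. h R x = 0 \<longleftrightarrow> \<rho> x \<le> R" by simp_all
  define q where "q i = from_nat_into dyadic i" for i
  have q: "q i \<in> dyadic" for i unfolding q_def using zero_in_dyadic by (intro from_nat_into) auto
  have q0: "0 \<le> q i" for i using q dyadic_nonneg by blast
  have q_surj: "\<exists>i. r = q i" if "r \<in> dyadic" for r
    using from_nat_into_to_nat_on[OF countable_dyadic that] by (metis q_def)
  have q_min: "q i * min 1 y \<le> q i" for i y
    using mult_left_mono[OF min.cobounded1[of 1 y] q0[of i]] by simp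
  define v where "v n x = q (fst (prod_decode n)) * min 1 (real (snd (prod_decode n)) * h (q (fst (prod_decode n))) x)" for n x
  define g where "g = rec_nat (v 0) (\<lambda>k f x. max (f x) (v (Suc k) x))"
  have g_Suc: "g (Suc k) = (\<lambda>x. max (g k x) (v (Suc k) x))" and g_0: "g 0 = v 0" for k
    by (simp_all add: g_def)
  have v0: "0 \<le> v n x" for n x
    unfolding v_def by (intro mult_nonneg_nonneg q0) (simp add: h(2))
  have v_Cb: "v n \<in> Cb" for n
  proof -
    let ?q = "q (fst (prod_decode n))"
    have "continuous_on UNIV (v n)" unfolding v_def by (intro continuous_intros h(1))
    moreover have "\<bar>v n x\<bar> \<le> ?q" for x
      using v0[of n x] q_min by (simp add: v_def)
    then have "bounded (range (v n))" unfolding bounded_iff by auto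
    ultimately show ?thesis by (simp add: Cb_def)
  qed
  have v_le: "v n x \<le> \<rho> x" for n x
  proof (cases "\<rho> x \<le> q (fst (prod_decode n))")
    case True
    then have "h (q (fst (prod_decode n))) x = 0" by (simp add: h(3))
    then show ?thesis using pos[of x] by (simp add: v_def)
  next
    case False
    then show ?thesis unfolding v_def
      using q_min[of "fst (prod_decode n)" "real (snd (prod_decode n)) * h (q (fst (prod_decode n))) x"] by linarith
  qed
  have g_Cb: "g k \<in> Cb" for k
    by (induction k) (auto simp: g_Suc g_0 v_Cb intro!: Cb_max)
  have g_v: "v k x \<le> g k x" for k x by (cases k) (auto simp: g_Suc g_0)
  have g0: "0 \<le> g k x" for k x using v0 g_v order_trans by blast
  have inc: "incseq (\<lambda>k. g k x)" for x by (rule incseq_SucI) (simp add: g_Suc)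
  have g_le: "g k x \<le> \<rho> x" for k x
    by (induction k) (auto simp: g_Suc g_0 v_le)
  have "(\<lambda>k. g k x) \<longlonglongrightarrow> \<rho> x" for x
  proof (rule LIMSEQ_I)
    fix e :: real assume e: "0 < e"
    obtain r where r: "r \<in> dyadic" "max 0 (\<rho> x - e) < r" "r < \<rho> x"
      using dyadic_dense[of "max 0 (\<rho> x - e)" "\<rho> x"] e pos[of x] by auto
    obtain i where i: "r = q i" using q_surj[OF r(1)] by blast
    have "0 < h r x" using h(2)[of r x] h(3)[of r x] r(3) by (simp add: less_le)
    then obtain j :: nat where j: "1 < real j * h r x" using reals_Archimedean3 by blast
    \<comment> \<open>At \<open>x\<close> the cap 1 is reached, so this term equals the chosen
      dyadic level exactly.\<close>
    have "v (prod_encode (i, j)) x = r" using j by (simp add: v_def i[symmetric])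
    then have gt: "\<rho> x - e < g k x" if "prod_encode (i, j) \<le> k" for k
      using r(2) g_v[of "prod_encode (i, j)" x] incseqD[OF inc that, of x] by linarith
    then show "\<exists>no. \<forall>n\<ge>no. norm (g n x - \<rho> x) < e"
    proof (intro exI[of _ "prod_encode (i, j)"] allI impI)
      fix k assume "prod_encode (i, j) \<le> k"
      then have "\<rho> x - e < g k x" by (rule gt)
      then show "norm (g k x - \<rho> x) < e" using g_le[of k x] e by (simp add: abs_less_iff)
    qed
  qed
  with g_Cb g0 inc that show thesis by blast
qed

context feller_process
begin

text \<open>The functions \<open>g k\<close> have weighted norm at most 1, so the growth bound with
  constant 1 gives \<open>P t (g k) x \<le> exp (w * t) * \<rho> x\<close>, and the discount cancels
  the exponential exactly.\<close>

lemma nonneg_supermartingale_rho: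
  assumes baire: "\<forall>B\<in>sets (borel :: real measure). \<rho> -` B \<in> baire_sets"
    and contr: "\<forall>t\<ge>0. \<forall>f\<in>Brho \<rho>. rho_norm \<rho> (P t f) \<le> exp (w * t) * rho_norm \<rho> f"
  shows "nonneg_supermartingale N F (\<lambda>t \<omega>. exp (- w * t) * \<rho> (L t \<omega>))"
proof -
  obtain g where g: "\<And>k. g k \<in> Cb" "\<And>k x. 0 \<le> g k x" "\<And>x. incseq (\<lambda>k. g k x)"
    "\<And>x. (\<lambda>k. g k x) \<longlonglongrightarrow> \<rho> x"
    using baire_weight_approx[OF rho_pos compact_sublevel baire] by metis
  have gB: "g k \<in> Brho \<rho>" for k by (rule Cb_Brho[OF g(1)])
  have g_le: "g k x \<le> \<rho> x" for k x by (rule incseq_le[OF g(3,4)])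
  have Pg: "P t (g k) x \<le> exp (w * t) * \<rho> x" if "0 \<le> t" for t k x
  proof -
    have "P t (g k) x \<le> rho_norm \<rho> (P t (g k)) * \<rho> x"
      using abs_le_rho_norm[OF Brho_rho_bounded[OF P_Brho[OF that gB]], of k x] by linarith
    also have "\<dots> \<le> exp (w * t) * rho_norm \<rho> (g k) * \<rho> x"
      using contr that gB rho_pos[of x] by (intro mult_right_mono) auto
    also have "\<dots> \<le> exp (w * t) * 1 * \<rho> x"
      using rho_pos[of x] g(2) g_le by (intro mult_right_mono mult_left_mono rho_norm_le) auto
    finally show ?thesis by simp
  qed
  have measL[measurable]: "L t \<in> N \<rightarrow>\<^sub>M borel" if "0 \<le> t" for t by (rule measurable_L[OF that])
  note [measurable] = Brho_measurable[OF gB]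
  have sup: "(\<integral>\<^sup>+\<omega>\<in>A. ennreal (\<rho> (L t \<omega>)) \<partial>N) = (SUP k. \<integral>\<^sup>+\<omega>\<in>A. ennreal (g k (L t \<omega>)) \<partial>N)"
    if t: "0 \<le> t" and A[measurable]: "A \<in> sets N" for t A
  proof -
    have "(\<integral>\<^sup>+\<omega>\<in>A. ennreal (\<rho> (L t \<omega>)) \<partial>N) = (\<integral>\<^sup>+\<omega>. (SUP k. ennreal (g k (L t \<omega>)) * indicator A \<omega>) \<partial>N)"
    proof (intro nn_integral_cong)
      fix \<omega>
      have "incseq (\<lambda>k. ennreal (g k (L t \<omega>)))"
        using g(3) by (auto simp: incseq_def intro!: ennreal_leI)
      then have "(SUP k. ennreal (g k (L t \<omega>))) = ennreal (\<rho> (L t \<omega>))"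
        by (rule LIMSEQ_unique[OF LIMSEQ_SUP tendsto_ennrealI[OF g(4)]])
      then show "ennreal (\<rho> (L t \<omega>)) * indicator A \<omega> = (SUP k. ennreal (g k (L t \<omega>)) * indicator A \<omega>)"
        by (auto split: split_indicator)
    qed
    also have "\<dots> = (SUP k. \<integral>\<^sup>+\<omega>\<in>A. ennreal (g k (L t \<omega>)) \<partial>N)"
      using g(3) t by (intro nn_integral_monotone_convergence_SUP)
        (auto simp: incseq_def le_fun_def intro!: ennreal_leI mult_right_mono)
    finally show ?thesis .
  qed
  have g_super: "(\<integral>\<^sup>+\<omega>\<in>A. ennreal (g k (L t \<omega>)) \<partial>N) \<le> ennreal (exp (w * (t - s))) * (\<integral>\<^sup>+\<omega>\<in>A. ennreal (\<rho> (L s \<omega>)) \<partial>N)"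
    if s: "0 \<le> s" "s \<le> t" and A: "A \<in> sets (F s)" for s t k A
  proof -
    have [measurable]: "A \<in> sets N" by (rule sets_F_N[OF s(1) A])
    have "(\<integral>\<^sup>+\<omega>\<in>A. ennreal (g k (L t \<omega>)) \<partial>N) = (\<integral>\<^sup>+\<omega>\<in>A. ennreal (P (t - s) (g k) (L s \<omega>)) \<partial>N)"
      by (rule set_nn_integral_markov[OF s gB g(2) A])
    also have "\<dots> \<le> (\<integral>\<^sup>+\<omega>. ennreal (exp (w * (t - s))) * (ennreal (\<rho> (L s \<omega>)) * indicator A \<omega>) \<partial>N)"
      using Pg[of "t - s" k] s rho_pos
      by (intro nn_integral_mono) (auto split: split_indicator simp: ennreal_mult[symmetric] less_imp_le intro!: ennreal_leI)
    also have "\<dots> = ennreal (exp (w * (t - s))) * (\<integral>\<^sup>+\<omega>\<in>A. ennreal (\<rho> (L s \<omega>)) \<partial>N)"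
      using s(1) by (intro nn_integral_cmult) measurable
    finally show ?thesis .
  qed
  have scale: "(\<integral>\<^sup>+\<omega>\<in>A. ennreal (exp (- w * t) * \<rho> (L t \<omega>)) \<partial>N) = ennreal (exp (- w * t)) * (\<integral>\<^sup>+\<omega>\<in>A. ennreal (\<rho> (L t \<omega>)) \<partial>N)"
    if t: "0 \<le> t" and A[measurable]: "A \<in> sets N" for t A
    using t by (subst nn_integral_cmult[symmetric]) (auto simp: ennreal_mult less_imp_le[OF rho_pos] mult.assoc)
  show ?thesis
  proof (rule nonneg_supermartingale.intro, rule prob, rule filt)
    fix t :: real and \<omega>
    show "0 \<le> exp (- w * t) * \<rho> (L t \<omega>)" by (intro mult_nonneg_nonneg less_imp_le[OF rho_pos]) simp
  next
    fix t :: real assume "0 \<le> t"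
    have "(\<lambda>\<omega>. \<rho> (L t \<omega>)) \<in> borel_measurable (F t)"
      by (rule measurable_compose[OF adapted[OF \<open>0 \<le> t\<close>] measurable_rho])
    then show "(\<lambda>\<omega>. exp (- w * t) * \<rho> (L t \<omega>)) \<in> borel_measurable (F t)" by measurable
  next
    fix s t :: real and A assume s: "0 \<le> s" "s \<le> t" and A: "A \<in> sets (F s)"
    have AN: "A \<in> sets N" by (rule sets_F_N[OF s(1) A])
    have t: "0 \<le> t" using s by simp
    have "(\<integral>\<^sup>+\<omega>\<in>A. ennreal (exp (- w * t) * \<rho> (L t \<omega>)) \<partial>N) \<le>
        ennreal (exp (- w * t)) * (ennreal (exp (w * (t - s))) * (\<integral>\<^sup>+\<omega>\<in>A. ennreal (\<rho> (L s \<omega>)) \<partial>N))"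
      unfolding scale[OF t AN] sup[OF t AN] by (intro mult_left_mono SUP_least g_super s A) simp
    also have "\<dots> = ennreal (exp (- w * t) * exp (w * (t - s))) * (\<integral>\<^sup>+\<omega>\<in>A. ennreal (\<rho> (L s \<omega>)) \<partial>N)"
      by (simp add: ennreal_mult mult.assoc)
    also have "exp (- w * t) * exp (w * (t - s)) = exp (- w * s)"
      by (simp add: exp_add[symmetric] algebra_simps)
    also have "ennreal (exp (- w * s)) * (\<integral>\<^sup>+\<omega>\<in>A. ennreal (\<rho> (L s \<omega>)) \<partial>N) = (\<integral>\<^sup>+\<omega>\<in>A. ennreal (exp (- w * s) * \<rho> (L s \<omega>)) \<partial>N)"
      by (rule scale[OF s(1) AN, symmetric])
    finally show "(\<integral>\<^sup>+\<omega>\<in>A. ennreal (exp (- w * t) * \<rho> (L t \<omega>)) \<partial>N) \<le> (\<integral>\<^sup>+\<omega>\<in>A. ennreal (exp (- w * s) * \<rho> (L s \<omega>)) \<partial>N)" .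
  next
    show "(\<integral>\<^sup>+\<omega>. ennreal (exp (- w * 0) * \<rho> (L 0 \<omega>)) \<partial>N) < \<infinity>" using init by simp
  next
    fix t :: real and r :: "nat \<Rightarrow> real"
    assume t: "0 \<le> t" and r: "\<And>n. t < r n" "r \<longlonglongrightarrow> t"
    have r0: "0 \<le> r n" for n using t r(1)[of n] by simp
    have rt: "filterlim r (at_right t) sequentially"
      unfolding filterlim_at using r by (auto intro!: always_eventually simp: less_imp_neq[OF r(1), symmetric])
    have E: "(\<integral>\<^sup>+\<omega>. ennreal (g k (L u \<omega>)) \<partial>N) = (\<integral>\<^sup>+\<omega>. ennreal (P u (g k) (L 0 \<omega>)) \<partial>N)" if "0 \<le> u" for u k
      using set_nn_integral_markov[OF order_refl that gB g(2) space_N_F0] by (simp add: set_nn_integral_space)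
    \<comment> \<open>The expectation at time \<open>u\<close> is pulled back to time 0, where
      \<open>P u (g k)\<close> at the initial point is right continuous in \<open>u\<close>. Fatou's
      lemma then applies, and \<open>g k\<close> is bounded by the weight afterwards.\<close>
    have ge: "ennreal (exp (- w * t)) * (\<integral>\<^sup>+\<omega>. ennreal (g k (L t \<omega>)) \<partial>N) \<le>
        liminf (\<lambda>n. \<integral>\<^sup>+\<omega>. ennreal (exp (- w * r n) * \<rho> (L (r n) \<omega>)) \<partial>N)" for k
    proof -
      have mP: "(\<lambda>\<omega>. P u (g k) (L 0 \<omega>)) \<in> borel_measurable N" if "0 \<le> u" for u
        by (rule measurable_compose[OF measurable_L[OF order_refl] Brho_measurable[OF P_Brho[OF that gB]]])
      have c: "(\<integral>\<^sup>+\<omega>. ennreal (exp (- w * u) * P u (g k) (L 0 \<omega>)) \<partial>N) = ennreal (exp (- w * u)) * (\<integral>\<^sup>+\<omega>. ennreal (g k (L u \<omega>)) \<partial>N)"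
        if u: "0 \<le> u" for u
        unfolding E[OF u] using mP[OF u]
        by (subst nn_integral_cmult[symmetric]) (auto simp: ennreal_mult P_nonneg[OF u gB g(2)])
      have "ennreal (exp (- w * t)) * (\<integral>\<^sup>+\<omega>. ennreal (g k (L t \<omega>)) \<partial>N) = (\<integral>\<^sup>+\<omega>. liminf (\<lambda>n. ennreal (exp (- w * r n) * P (r n) (g k) (L 0 \<omega>))) \<partial>N)"
        unfolding c[OF t, symmetric]
      proof (intro nn_integral_cong)
        fix \<omega>
        have "(\<lambda>n. ennreal (exp (- w * r n) * P (r n) (g k) (L 0 \<omega>))) \<longlonglongrightarrow> ennreal (exp (- w * t) * P t (g k) (L 0 \<omega>))"
          by (intro tendsto_ennrealI tendsto_intros r(2) filterlim_compose[OF P_right_continuous[OF t gB] rt])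
        then show "ennreal (exp (- w * t) * P t (g k) (L 0 \<omega>)) = liminf (\<lambda>n. ennreal (exp (- w * r n) * P (r n) (g k) (L 0 \<omega>)))"
          by (simp add: lim_imp_Liminf)
      qed
      also have "\<dots> \<le> liminf (\<lambda>n. \<integral>\<^sup>+\<omega>. ennreal (exp (- w * r n) * P (r n) (g k) (L 0 \<omega>)) \<partial>N)"
        by (intro nn_integral_liminf) (use mP[OF r0] in measurable)
      also have "\<dots> = liminf (\<lambda>n. ennreal (exp (- w * r n)) * (\<integral>\<^sup>+\<omega>. ennreal (g k (L (r n) \<omega>)) \<partial>N))"
        by (simp only: c[OF r0])
      also have "\<dots> \<le> liminf (\<lambda>n. ennreal (exp (- w * r n)) * (\<integral>\<^sup>+\<omega>. ennreal (\<rho> (L (r n) \<omega>)) \<partial>N))"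
        by (intro Liminf_mono always_eventually allI mult_left_mono nn_integral_mono ennreal_leI g_le) simp
      also have "\<dots> = liminf (\<lambda>n. \<integral>\<^sup>+\<omega>. ennreal (exp (- w * r n) * \<rho> (L (r n) \<omega>)) \<partial>N)"
        using scale[OF r0 sets.top] by (simp only: set_nn_integral_space)
      finally show ?thesis .
    qed
    have "(\<integral>\<^sup>+\<omega>. ennreal (exp (- w * t) * \<rho> (L t \<omega>)) \<partial>N) = (SUP k. ennreal (exp (- w * t)) * (\<integral>\<^sup>+\<omega>. ennreal (g k (L t \<omega>)) \<partial>N))"
      using scale[OF t sets.top] sup[OF t sets.top] by (simp only: set_nn_integral_space SUP_mult_left_ennreal)
    also have "\<dots> \<le> liminf (\<lambda>n. \<integral>\<^sup>+\<omega>. ennreal (exp (- w * r n) * \<rho> (L (r n) \<omega>)) \<partial>N)"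
      by (intro SUP_least ge)
    finally show "(\<integral>\<^sup>+\<omega>. ennreal (exp (- w * t) * \<rho> (L t \<omega>)) \<partial>N) \<le> liminf (\<lambda>n. \<integral>\<^sup>+\<omega>. ennreal (exp (- w * r n) * \<rho> (L (r n) \<omega>)) \<partial>N)" .
  qed
qed

end

section \<open>Versions with cadlag paths\<close>

text \<open>Where the regularised paths \<open>f n \<circ> \<gamma>\<close> agree with some \<open>f n z\<close>, the point \<open>z\<close> is unique, so
  the selection below is the value of the cadlag modification.\<close>

definition selection :: "(nat \<Rightarrow> 'a \<Rightarrow> real) \<Rightarrow> (real \<Rightarrow> 'a) \<Rightarrow> real \<Rightarrow> 'a" where
  "selection f \<gamma> t = (SOME z. \<forall>n. f n z = right_lim (\<lambda>s. f n (\<gamma> s)) t)"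

lemma selection_eqI:
  assumes sep: "\<And>x y. x \<noteq> y \<Longrightarrow> \<exists>n. f n x \<noteq> f n y"
    and z: "\<And>n. f n z = right_lim (\<lambda>s. f n (\<gamma> s)) t"
  shows "selection f \<gamma> t = z"
  unfolding selection_def
proof (rule some_equality)
  fix y assume "\<forall>n. f n y = right_lim (\<lambda>s. f n (\<gamma> s)) t"
  then have "\<nexists>n. f n y \<noteq> f n z" using z by simp
  then show "y = z" using sep by blast
qed (use z in simp)

lemma selection_eq_path:
  assumes sep: "\<And>x y. x \<noteq> y \<Longrightarrow> \<exists>n. f n x \<noteq> f n y"
    and "0 \<le> t" and "\<And>n. ((\<lambda>s. f n (\<gamma> s)) \<longlongrightarrow> f n (\<gamma> t)) (dright t)"
  shows "selection f \<gamma> t = \<gamma> t"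
  by (rule selection_eqI, erule sep, rule right_limI[OF assms(2,3), symmetric])

lemma tendsto_sublevel:
  fixes g :: "'b \<Rightarrow> real"
  shows "(g \<longlongrightarrow> l) F \<Longrightarrow> \<forall>\<^sub>F x in F. g x \<le> l + 1"
  by (rule eventually_mono[OF order_tendstoD(2)[of g l F "l + 1"]]) simp_all

text \<open>On a compact sublevel set the continuous functions \<open>f n\<close> determine points,
  so convergence of every \<open>f n\<close> along the selected path forces convergence of the path.
  Regularity of the weight confines it to one sublevel set on each side of a time.\<close>

lemma cadlag_selection:
  fixes \<rho> :: "'a::topological_space \<Rightarrow> real"
  assumes K: "\<And>R. compact {x. \<rho> x \<le> R}"
    and cont: "\<And>n R. continuous_on {x. \<rho> x \<le> R} (f n)"
    and sep: "\<And>x y. x \<noteq> y \<Longrightarrow> \<exists>n. f n x \<noteq> f n y"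
    and rho: "regular_path (\<lambda>t. \<rho> (\<gamma> t))" and reg: "\<And>n. regular_path (\<lambda>t. f n (\<gamma> t))"
  shows "cadlag (selection f \<gamma>)"
proof -
  \<comment> \<open>The bound \<open>R\<close> is left free, because one \<open>R\<close> obtained
    at a time \<open>t\<close> has to serve all nearby times as well.\<close>
  have sel: "\<rho> (selection f \<gamma> t) \<le> R \<and> (\<forall>n. f n (selection f \<gamma> t) = right_lim (\<lambda>s. f n (\<gamma> s)) t)"
    if t: "0 \<le> t" and R: "\<forall>\<^sub>F q in dright t. \<rho> (\<gamma> q) \<le> R" for t R
  proof -
    let ?F = "filtermap \<gamma> (dright t)"
    obtain z where z: "z \<in> {x. \<rho> x \<le> R}" "\<And>n. f n z = right_lim (\<lambda>s. f n (\<gamma> s)) t"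
    proof (rule compact_cluster_point[OF K])
      show "?F \<noteq> bot" using dright_neq_bot[OF t] by (simp add: filtermap_bot_iff)
      show "\<forall>\<^sub>F y in ?F. y \<in> {x. \<rho> x \<le> R}" using R by (simp add: eventually_filtermap)
      show "continuous_on {x. \<rho> x \<le> R} (f n)" for n by (rule cont)
      show "(f n \<longlongrightarrow> right_lim (\<lambda>s. f n (\<gamma> s)) t) ?F" for n
        using right_lim_tendsto[OF reg t] by (simp add: filterlim_filtermap)
    qed (rule that; assumption)
    have "selection f \<gamma> t = z" using sep z(2) by (rule selection_eqI)
    with z show ?thesis by simp
  qed
  have det: "x = y" if "\<And>n. f n x = f n y" for x y using sep[of x y] that by auto
  show ?thesis
    unfolding cadlag_def
  proof (intro conjI allI impI)
    fix t :: real assume t: "0 \<le> t"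
    define R where "R = right_lim (\<lambda>s. \<rho> (\<gamma> s)) t + 1"
    have R: "\<forall>\<^sub>F q in dright t. \<rho> (\<gamma> q) \<le> R"
      unfolding R_def by (rule tendsto_sublevel[OF right_lim_tendsto[OF rho t]])
    then obtain d where d: "t < d" "\<And>q. q \<in> dyadic \<Longrightarrow> t < q \<Longrightarrow> q < d \<Longrightarrow> \<rho> (\<gamma> q) \<le> R"
      unfolding eventually_dright by blast
    have ev: "\<forall>\<^sub>F s in at_right t. \<rho> (selection f \<gamma> s) \<le> R \<and>
        (\<forall>n. f n (selection f \<gamma> s) = right_lim (\<lambda>s. f n (\<gamma> s)) s)"
      unfolding eventually_at_right_field
    proof (intro exI[of _ d] conjI allI impI d(1))
      fix s assume s: "t < s" "s < d"
      have "\<forall>\<^sub>F q in dright s. \<rho> (\<gamma> q) \<le> R"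
        unfolding eventually_dright using d(2) s by (intro exI[of _ d]) auto
      then show "\<rho> (selection f \<gamma> s) \<le> R" "f n (selection f \<gamma> s) = right_lim (\<lambda>s. f n (\<gamma> s)) s" for n
        using sel[of s R] s t by auto
    qed
    let ?F = "filtermap (selection f \<gamma>) (at_right t)"
    have "((\<lambda>x. x) \<longlongrightarrow> selection f \<gamma> t) ?F"
    proof (rule compact_determined_tendsto[OF K[of R], where h = f and c = "\<lambda>n. right_lim (\<lambda>s. f n (\<gamma> s)) t"])
      show "\<forall>\<^sub>F y in ?F. y \<in> {x. \<rho> x \<le> R}"
        unfolding eventually_filtermap using ev by eventually_elim simp
      fix n
      have "(right_lim (\<lambda>s. f n (\<gamma> s)) \<longlongrightarrow> right_lim (\<lambda>s. f n (\<gamma> s)) t) (at_right t)"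
        using cadlag_right_lim[OF reg] t by (simp add: cadlag_def)
      moreover have "\<forall>\<^sub>F s in at_right t. right_lim (\<lambda>s. f n (\<gamma> s)) s = f n (selection f \<gamma> s)"
        using ev by eventually_elim simp
      ultimately have "((\<lambda>s. f n (selection f \<gamma> s)) \<longlongrightarrow> right_lim (\<lambda>s. f n (\<gamma> s)) t) (at_right t)"
        by (rule Lim_transform_eventually)
      then show "(f n \<longlongrightarrow> right_lim (\<lambda>s. f n (\<gamma> s)) t) ?F" by (simp add: filterlim_filtermap)
    qed (use cont det sel[OF t R] in \<open>auto intro: continuous_on_id\<close>)
    then show "(selection f \<gamma> \<longlongrightarrow> selection f \<gamma> t) (at_right t)" by (simp add: filterlim_filtermap)
  next
    fix t :: real assume t: "0 < t"
    obtain l where l: "((\<lambda>s. \<rho> (\<gamma> s)) \<longlongrightarrow> l) (dleft t)" using rho t unfolding regular_path_def by blast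
    define R where "R = l + 1"
    have "\<forall>\<^sub>F q in dleft t. \<rho> (\<gamma> q) \<le> R"
      unfolding R_def by (rule tendsto_sublevel[OF l])
    then obtain d where d: "d < t" "\<And>q. q \<in> dyadic \<Longrightarrow> d < q \<Longrightarrow> q < t \<Longrightarrow> \<rho> (\<gamma> q) \<le> R"
      unfolding eventually_dleft by blast
    have ev: "\<forall>\<^sub>F s in at_left t. \<rho> (selection f \<gamma> s) \<le> R \<and>
        (\<forall>n. f n (selection f \<gamma> s) = right_lim (\<lambda>s. f n (\<gamma> s)) s)"
      unfolding eventually_at_left_field
    proof (intro exI[of _ "max 0 d"] conjI allI impI)
      show "max 0 d < t" using d(1) t by simp
      fix s assume s: "max 0 d < s" "s < t"
      have "\<forall>\<^sub>F q in dright s. \<rho> (\<gamma> q) \<le> R"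
        unfolding eventually_dright using d(2) s by (intro exI[of _ t]) auto
      then show "\<rho> (selection f \<gamma> s) \<le> R" "f n (selection f \<gamma> s) = right_lim (\<lambda>s. f n (\<gamma> s)) s" for n
        using sel[of s R] s by auto
    qed
    have "\<exists>c. (right_lim (\<lambda>s. f n (\<gamma> s)) \<longlongrightarrow> c) (at_left t)" for n
      using cadlag_right_lim[OF reg] t by (simp add: cadlag_def)
    then obtain c where c: "\<And>n. (right_lim (\<lambda>s. f n (\<gamma> s)) \<longlongrightarrow> c n) (at_left t)" by metis
    let ?F = "filtermap (selection f \<gamma>) (at_left t)"
    have FK: "\<forall>\<^sub>F y in ?F. y \<in> {x. \<rho> x \<le> R}"
      unfolding eventually_filtermap using ev by eventually_elim simp
    have fc: "(f n \<longlongrightarrow> c n) ?F" for n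
    proof -
      have "\<forall>\<^sub>F s in at_left t. right_lim (\<lambda>s. f n (\<gamma> s)) s = f n (selection f \<gamma> s)"
        using ev by eventually_elim simp
      with c have "((\<lambda>s. f n (selection f \<gamma> s)) \<longlongrightarrow> c n) (at_left t)"
        by (rule Lim_transform_eventually)
      then show ?thesis by (simp add: filterlim_filtermap)
    qed
    \<comment> \<open>A left limit need not be a value of the path, so the candidate comes from
      compactness.\<close>
    obtain z where z: "z \<in> {x. \<rho> x \<le> R}" "\<And>n. f n z = c n"
    proof (rule compact_cluster_point[OF K _ FK cont fc])
      show "?F \<noteq> bot" by (simp add: filtermap_bot_iff)
    qed (rule that; assumption)
    have "((\<lambda>x. x) \<longlongrightarrow> z) ?F"
      by (rule compact_determined_tendsto[OF K[of R] FK, where h = f and c = c])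
        (use cont fc det z in \<open>auto intro: continuous_on_id\<close>)
    then show "\<exists>l. (selection f \<gamma> \<longlongrightarrow> l) (at_left t)" by (auto simp: filterlim_filtermap)
  qed
qed

section \<open>Regular versions of functions of the process and of the process itself\<close>

context feller_process
begin

interpretation complete_measure N by (rule complete)

text \<open>By completeness, a cadlag modification inherits measurability at each fixed time from
  the original process.\<close>

lemma measurable_cong_AE_complete:
  assumes X: "X \<in> N \<rightarrow>\<^sub>M B" and Y: "Y \<in> space N \<rightarrow> space B" and eq: "AE \<omega> in N. Y \<omega> = X \<omega>"
  shows "Y \<in> N \<rightarrow>\<^sub>M B"
proof (rule measurableI)
  fix S assume "S \<in> sets B"
  then have S: "X -` S \<inter> space N \<in> sets N" by (rule measurable_sets[OF X])
  show "Y -` S \<inter> space N \<in> sets N"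
  proof (rule in_sets_AE[OF _ S])
    show "AE \<omega> in N. \<omega> \<in> X -` S \<inter> space N \<longleftrightarrow> \<omega> \<in> Y -` S \<inter> space N"
      using eq by eventually_elim simp
  qed simp
qed (use Y in auto)

text \<open>In the first clause one null set serves all times; in the second it depends on
  \<open>t\<close>. The first makes the paths of right limits cadlag, the second makes them a
  modification.\<close>

definition has_regular_version :: "('a \<Rightarrow> real) \<Rightarrow> bool" where
  "has_regular_version \<phi> \<longleftrightarrow>
     (AE \<omega> in N. regular_path (\<lambda>t. \<phi> (L t \<omega>))) \<and>
     (\<forall>t\<ge>0. AE \<omega> in N. ((\<lambda>q. \<phi> (L q \<omega>)) \<longlongrightarrow> \<phi> (L t \<omega>)) (dright t))"

text \<open>The discount is continuous in time and never 0, so it can be undone path by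
  path.\<close>

lemma has_regular_version_of_supermartingale:
  assumes super: "nonneg_supermartingale N F (\<lambda>t \<omega>. exp (- a * t) * \<phi> (L t \<omega>))"
  shows "has_regular_version \<phi>"
proof -
  interpret S: nonneg_supermartingale N F "\<lambda>t \<omega>. exp (- a * t) * \<phi> (L t \<omega>)" by (rule super)
  have eq: "exp (a * t) * (exp (- a * t) * \<phi> (L t \<omega>)) = \<phi> (L t \<omega>)" for t \<omega>
    by (simp add: mult.assoc[symmetric] exp_add[symmetric])
  show ?thesis
    unfolding has_regular_version_def
  proof (intro conjI allI impI)
    show "AE \<omega> in N. regular_path (\<lambda>t. \<phi> (L t \<omega>))"
      using S.AE_regular_path
    proof eventually_elim
      case (elim \<omega>)
      have "continuous_on UNIV (\<lambda>t. exp (a * t))" by (intro continuous_intros)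
      from regular_path_mult_continuous[OF this elim] show ?case by (simp only: eq)
    qed
    fix t :: real assume "0 \<le> t"
    from S.AE_right_limit[OF this] show "AE \<omega> in N. ((\<lambda>q. \<phi> (L q \<omega>)) \<longlongrightarrow> \<phi> (L t \<omega>)) (dright t)"
    proof eventually_elim
      case (elim \<omega>)
      have "((\<lambda>q. exp (a * q)) \<longlongrightarrow> exp (a * t)) (dright t)" by (intro tendsto_intros)
      from tendsto_mult[OF this elim] show ?case by (simp only: eq)
    qed
  qed
qed

lemma has_regular_version_const: "has_regular_version (\<lambda>_. c)"
  unfolding has_regular_version_def regular_path_def by auto

lemma has_regular_version_diff:
  assumes "has_regular_version \<phi>" "has_regular_version \<psi>"
  shows "has_regular_version (\<lambda>x. \<phi> x - \<psi> x)"
  unfolding has_regular_version_def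
proof (intro conjI allI impI)
  have "AE \<omega> in N. regular_path (\<lambda>t. \<phi> (L t \<omega>))" "AE \<omega> in N. regular_path (\<lambda>t. \<psi> (L t \<omega>))"
    using assms by (simp_all add: has_regular_version_def)
  then show "AE \<omega> in N. regular_path (\<lambda>t. \<phi> (L t \<omega>) - \<psi> (L t \<omega>))"
    by eventually_elim (rule regular_path_diff)
  fix t :: real assume "0 \<le> t"
  then have "AE \<omega> in N. ((\<lambda>q. \<phi> (L q \<omega>)) \<longlongrightarrow> \<phi> (L t \<omega>)) (dright t)"
    "AE \<omega> in N. ((\<lambda>q. \<psi> (L q \<omega>)) \<longlongrightarrow> \<psi> (L t \<omega>)) (dright t)"
    using assms by (simp_all add: has_regular_version_def)
  then show "AE \<omega> in N. ((\<lambda>q. \<phi> (L q \<omega>) - \<psi> (L q \<omega>)) \<longlongrightarrow> \<phi> (L t \<omega>) - \<psi> (L t \<omega>)) (dright t)"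
    by eventually_elim (rule tendsto_diff)
qed

lemma has_regular_version_cmult:
  assumes "has_regular_version \<phi>"
  shows "has_regular_version (\<lambda>x. c * \<phi> x)"
  unfolding has_regular_version_def
proof (intro conjI allI impI)
  have "AE \<omega> in N. regular_path (\<lambda>t. \<phi> (L t \<omega>))"
    using assms by (simp add: has_regular_version_def)
  then show "AE \<omega> in N. regular_path (\<lambda>t. c * \<phi> (L t \<omega>))"
    by eventually_elim (rule regular_path_mult_continuous[OF continuous_on_const])
  fix t :: real assume "0 \<le> t"
  then have "AE \<omega> in N. ((\<lambda>q. \<phi> (L q \<omega>)) \<longlongrightarrow> \<phi> (L t \<omega>)) (dright t)"
    using assms by (simp add: has_regular_version_def)
  then show "AE \<omega> in N. ((\<lambda>q. c * \<phi> (L q \<omega>)) \<longlongrightarrow> c * \<phi> (L t \<omega>)) (dright t)"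
    by eventually_elim (rule tendsto_mult_left)
qed

lemma has_regular_version_resolvent:
  assumes f: "f \<in> Brho \<rho>" and \<beta>: "w < \<beta>"
  shows "has_regular_version (resolvent P \<beta> f)"
proof -
  have "has_regular_version (resolvent P \<beta> (\<lambda>x. max (f x) 0))"
    "has_regular_version (resolvent P \<beta> (\<lambda>x. max (- f x) 0))"
    by (rule has_regular_version_of_supermartingale[where a = \<beta>];
        intro nonneg_supermartingale_resolvent Brho_pos_part Brho_neg_part f \<beta>; simp)+
  from has_regular_version_diff[OF this] show ?thesis
    unfolding resolvent_diff[OF f \<beta>, symmetric] by simp
qed

text \<open>A countable index type allows one null set per time for the whole family; it lies in
  \<open>F 0\<close> because all null sets do.\<close>

lemma ex_cadlag_versions:
  fixes \<phi> :: "'k::countable \<Rightarrow> 'a \<Rightarrow> real"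
  assumes reg: "\<And>k. has_regular_version (\<phi> k)" and meas: "\<And>k. \<phi> k \<in> borel_measurable borel"
  shows "\<exists>G. (\<forall>k. (\<forall>\<omega>. cadlag (\<lambda>t. G k t \<omega>)) \<and> (\<forall>t\<ge>0. G k t \<in> borel_measurable N)) \<and>
    (\<forall>t\<ge>0. \<exists>Z. Z \<in> null_sets N \<and> Z \<in> sets (F 0) \<and> (\<forall>\<omega>\<in>space N - Z. \<forall>k. \<phi> k (L t \<omega>) = G k t \<omega>))"
proof -
  \<comment> \<open>Irregular paths are replaced by the zero path, so that every path is cadlag
    without exception.\<close>
  define G where "G k t \<omega> =
    (if regular_path (\<lambda>t. \<phi> k (L t \<omega>)) then right_lim (\<lambda>t. \<phi> k (L t \<omega>)) t else 0)" for k t \<omega>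
  have eq: "AE \<omega> in N. \<forall>k. G k t \<omega> = \<phi> k (L t \<omega>)" if t: "0 \<le> t" for t
  proof (subst AE_all_countable, intro allI)
    fix k
    have "AE \<omega> in N. regular_path (\<lambda>t. \<phi> k (L t \<omega>))"
      "AE \<omega> in N. ((\<lambda>q. \<phi> k (L q \<omega>)) \<longlongrightarrow> \<phi> k (L t \<omega>)) (dright t)"
      using reg[of k] t by (simp_all add: has_regular_version_def)
    then show "AE \<omega> in N. G k t \<omega> = \<phi> k (L t \<omega>)"
      by eventually_elim (simp add: G_def right_limI[OF t])
  qed
  show ?thesis
  proof (intro exI[of _ G] conjI allI impI)
    fix k
    show "cadlag (\<lambda>t. G k t \<omega>)" for \<omega>
    proof (cases "regular_path (\<lambda>t. \<phi> k (L t \<omega>))")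
      case True
      then show ?thesis using cadlag_right_lim[OF True] by (simp add: G_def)
    next
      case False
      then show ?thesis by (auto simp: G_def cadlag_def)
    qed
    fix t :: real assume t: "0 \<le> t"
    have "AE \<omega> in N. G k t \<omega> = \<phi> k (L t \<omega>)" using eq[OF t] by eventually_elim simp
    then show "G k t \<in> borel_measurable N"
      by (rule measurable_cong_AE_complete[OF measurable_compose[OF measurable_L[OF t] meas], rotated]) simp
  next
    fix t :: real assume t: "0 \<le> t"
    let ?Z = "{\<omega> \<in> space N. \<not> (\<forall>k. G k t \<omega> = \<phi> k (L t \<omega>))}"
    have "?Z \<in> null_sets N" using eq[OF t] by (simp add: AE_iff_null_sets)
    then show "\<exists>Z. Z \<in> null_sets N \<and> Z \<in> sets (F 0) \<and> (\<forall>\<omega>\<in>space N - Z. \<forall>k. \<phi> k (L t \<omega>) = G k t \<omega>)"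
      by (intro exI[of _ ?Z] conjI null_sets_F0) auto
  qed
qed

text \<open>Convergence of \<open>\<rho>\<close> along the path keeps it in a compact sublevel set, on which the resolvents
  \<open>R(\<beta>) f\<close> are continuous; hence all cluster points share the values \<open>R(\<beta>) f\<close> and therefore the value
  of \<open>f\<close>. Pointwise convergence \<open>\<beta> R(\<beta>) f \<rightarrow> f\<close> is thus enough and strong continuity is not used.\<close>

lemma tendsto_if_resolvent_tendsto:
  assumes f: "f \<in> Brho \<rho>" and m: "w < real m" and Fi: "Fi \<noteq> bot"
    and rho: "((\<lambda>q. \<rho> (\<gamma> q)) \<longlongrightarrow> l) Fi"
    and res: "\<And>n. ((\<lambda>q. resolvent P (real (m + n)) f (\<gamma> q)) \<longlongrightarrow> c n) Fi"
  shows "\<exists>z. (\<forall>n. resolvent P (real (m + n)) f z = c n) \<and> ((\<lambda>q. f (\<gamma> q)) \<longlongrightarrow> f z) Fi"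
    and "\<rho> y \<le> l + 1 \<Longrightarrow> (\<And>n. resolvent P (real (m + n)) f y = c n) \<Longrightarrow> ((\<lambda>q. f (\<gamma> q)) \<longlongrightarrow> f y) Fi"
proof -
  let ?K = "{x. \<rho> x \<le> l + 1}" and ?F = "filtermap \<gamma> Fi"
  have FK: "\<forall>\<^sub>F y in ?F. y \<in> ?K" using tendsto_sublevel[OF rho] by (simp add: eventually_filtermap)
  have cont: "continuous_on ?K (resolvent P (real (m + n)) f)" for n
    by (rule resolvent_continuous_on_sublevel[OF f]) (use m in simp)
  have lim: "(resolvent P (real (m + n)) f \<longlongrightarrow> c n) ?F" for n
    using res[of n] by (simp add: filterlim_filtermap)
  have det: "f x = f y" if "\<And>n. resolvent P (real (m + n)) f x = resolvent P (real (m + n)) f y" for x y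
  proof -
    have "resolvent P (real (n + m)) f x = resolvent P (real (n + m)) f y" for n
      using that[of n] by (simp only: add.commute)
    then have "(\<lambda>n. real (n + m) * resolvent P (real (n + m)) f x) \<longlonglongrightarrow> f y"
      using LIMSEQ_ignore_initial_segment[OF resolvent_tendsto[OF f, of y], of m] by simp
    then have "(\<lambda>n. real n * resolvent P (real n) f x) \<longlonglongrightarrow> f y" by (rule LIMSEQ_offset)
    then show ?thesis using resolvent_tendsto[OF f, of x] LIMSEQ_unique by blast
  qed
  have conv: "((\<lambda>q. f (\<gamma> q)) \<longlongrightarrow> f y) Fi" if "y \<in> ?K" "\<And>n. resolvent P (real (m + n)) f y = c n" for y
  proof -
    have "(f \<longlongrightarrow> f y) ?F"
      by (rule compact_determined_tendsto[OF compact_sublevel FK, where h = "\<lambda>n. resolvent P (real (m + n)) f" and c = c])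
        (fact cont lim Brho_continuous_on_sublevel[OF f] that | erule det)+
    then show ?thesis by (simp add: filterlim_filtermap)
  qed
  obtain z where z: "z \<in> ?K" "\<And>n. resolvent P (real (m + n)) f z = c n"
  proof (rule compact_cluster_point[OF compact_sublevel _ FK cont lim])
    show "?F \<noteq> bot" using Fi by (simp add: filtermap_bot_iff)
  qed (rule that; assumption)
  show "\<exists>z. (\<forall>n. resolvent P (real (m + n)) f z = c n) \<and> ((\<lambda>q. f (\<gamma> q)) \<longlongrightarrow> f z) Fi"
    using z conv by blast
  show "\<rho> y \<le> l + 1 \<Longrightarrow> (\<And>n. resolvent P (real (m + n)) f y = c n) \<Longrightarrow> ((\<lambda>q. f (\<gamma> q)) \<longlongrightarrow> f y) Fi"
    by (rule conv) auto
qed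

text \<open>The resolvents at integers from \<open>m\<close> on have regular versions, and countably
  many null sets can be discarded. The two parts of \<open>tendsto_if_resolvent_tendsto\<close> then
  give existence of the one-sided limits and identify the right limit.\<close>

lemma has_regular_version_Brho:
  assumes rho: "has_regular_version \<rho>" and f: "f \<in> Brho \<rho>"
  shows "has_regular_version f"
proof -
  obtain m :: nat where m: "w < real m" using reals_Archimedean2 by metis
  have res: "has_regular_version (resolvent P (real (m + n)) f)" for n
    by (rule has_regular_version_resolvent[OF f]) (use m in simp)
  show ?thesis
    unfolding has_regular_version_def
  proof (intro conjI allI impI)
    have "AE \<omega> in N. \<forall>n. regular_path (\<lambda>t. resolvent P (real (m + n)) f (L t \<omega>))"
      using res by (subst AE_all_countable) (simp add: has_regular_version_def)
    moreover have "AE \<omega> in N. regular_path (\<lambda>t. \<rho> (L t \<omega>))" using rho by (simp add: has_regular_version_def)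
    ultimately show "AE \<omega> in N. regular_path (\<lambda>t. f (L t \<omega>))"
    proof eventually_elim
      case (elim \<omega>)
      have "\<exists>l. ((\<lambda>t. f (L t \<omega>)) \<longlongrightarrow> l) Fi"
        if Fi: "Fi \<noteq> bot" "\<exists>l. ((\<lambda>t. \<rho> (L t \<omega>)) \<longlongrightarrow> l) Fi"
          "\<forall>n. \<exists>c. ((\<lambda>t. resolvent P (real (m + n)) f (L t \<omega>)) \<longlongrightarrow> c) Fi" for Fi
      proof -
        obtain l where l: "((\<lambda>t. \<rho> (L t \<omega>)) \<longlongrightarrow> l) Fi" using Fi(2) by blast
        from choice[OF Fi(3)] obtain c where
          c: "\<And>n. ((\<lambda>t. resolvent P (real (m + n)) f (L t \<omega>)) \<longlongrightarrow> c n) Fi" by blast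
        show ?thesis using tendsto_if_resolvent_tendsto(1)[OF f m Fi(1) l c] by blast
      qed
      then show ?case
        using elim dright_neq_bot dleft_neq_bot unfolding regular_path_def by simp
    qed
  next
    fix t :: real assume t: "0 \<le> t"
    have "AE \<omega> in N. \<forall>n. ((\<lambda>q. resolvent P (real (m + n)) f (L q \<omega>)) \<longlongrightarrow> resolvent P (real (m + n)) f (L t \<omega>)) (dright t)"
      using res t by (subst AE_all_countable) (simp add: has_regular_version_def)
    moreover have "AE \<omega> in N. ((\<lambda>q. \<rho> (L q \<omega>)) \<longlongrightarrow> \<rho> (L t \<omega>)) (dright t)"
      using rho t by (simp add: has_regular_version_def)
    ultimately show "AE \<omega> in N. ((\<lambda>q. f (L q \<omega>)) \<longlongrightarrow> f (L t \<omega>)) (dright t)"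
    proof eventually_elim
      case (elim \<omega>)
      show ?case
        \<comment> \<open>Here \<open>y\<close> is \<open>L t \<omega>\<close> and \<open>l\<close>
          is its weight, so \<open>y\<close> satisfies the sublevel condition trivially.\<close>
        by (rule tendsto_if_resolvent_tendsto(2)[OF f m dright_neq_bot[OF t] elim(2) elim(1)[rule_format]]) simp_all
    qed
  qed
qed

lemma ex_cadlag_process:
  assumes rho: "has_regular_version \<rho>" and f: "\<And>n :: nat. f n \<in> Brho \<rho>"
    and sep: "\<And>x y. x \<noteq> y \<Longrightarrow> \<exists>n. f n x \<noteq> f n y"
  shows "\<exists>X. (\<forall>\<omega>. cadlag (\<lambda>t. X t \<omega>)) \<and>
    (\<forall>t\<ge>0. X t \<in> N \<rightarrow>\<^sub>M borel \<and> (AE \<omega> in N. X t \<omega> = L t \<omega>))"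
proof -
  have reg: "has_regular_version (f n)" for n by (rule has_regular_version_Brho[OF rho f])
  define good where "good \<omega> \<longleftrightarrow> regular_path (\<lambda>t. \<rho> (L t \<omega>)) \<and> (\<forall>n. regular_path (\<lambda>t. f n (L t \<omega>)))" for \<omega>
  \<comment> \<open>Off the almost sure event \<open>good\<close> a constant path is cadlag;
    \<open>undefined\<close> is merely some point of \<open>E\<close>.\<close>
  define X where "X t \<omega> = (if good \<omega> then selection f (\<lambda>s. L s \<omega>) t else undefined)" for t \<omega>
  have good: "AE \<omega> in N. good \<omega>"
  proof -
    have "AE \<omega> in N. \<forall>n. regular_path (\<lambda>t. f n (L t \<omega>))"
      using reg by (subst AE_all_countable) (simp add: has_regular_version_def)
    moreover have "AE \<omega> in N. regular_path (\<lambda>t. \<rho> (L t \<omega>))" using rho by (simp add: has_regular_version_def)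
    ultimately show ?thesis by eventually_elim (simp add: good_def)
  qed
  show ?thesis
  proof (intro exI[of _ X] conjI allI impI)
    fix \<omega> show "cadlag (\<lambda>t. X t \<omega>)"
    proof (cases "good \<omega>")
      case True
      then have "cadlag (selection f (\<lambda>s. L s \<omega>))"
        by (intro cadlag_selection[of \<rho>] compact_sublevel Brho_continuous_on_sublevel f sep)
          (auto simp: good_def)
      then show ?thesis using True by (simp add: X_def)
    next
      case False
      then show ?thesis by (auto simp: X_def cadlag_def)
    qed
  next
    fix t :: real assume t: "0 \<le> t"
    have "AE \<omega> in N. \<forall>n. ((\<lambda>q. f n (L q \<omega>)) \<longlongrightarrow> f n (L t \<omega>)) (dright t)"
      using reg t by (subst AE_all_countable) (simp add: has_regular_version_def)
    with good show eq: "AE \<omega> in N. X t \<omega> = L t \<omega>"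
      by eventually_elim (simp add: X_def selection_eq_path[OF sep t])
    show "X t \<in> N \<rightarrow>\<^sub>M borel"
      by (rule measurable_cong_AE_complete[OF measurable_L[OF t] _ eq]) simp
  qed
qed

end

theorem mainTheorem6:
  fixes \<rho> :: "'a::topological_space \<Rightarrow> real"
    and P :: "real \<Rightarrow> ('a \<Rightarrow> real) \<Rightarrow> ('a \<Rightarrow> real)"
    and M w :: real
    and \<nu> :: "'a measure"
    and Pnu :: "(real \<Rightarrow> 'a) measure"
    and F :: "real \<Rightarrow> (real \<Rightarrow> 'a) measure"
  assumes E_creg: "completely_regular_space (euclidean :: 'a topology)"
    and E_haus: "Hausdorff_space (euclidean :: 'a topology)"
    and rho_adm: "admissible_weight \<rho>"
    and feller: "gen_feller_semigroup \<rho> P"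
    and conserv: "\<forall>t\<ge>0. P t (\<lambda>_. 1) = (\<lambda>_. 1)"
    and M_ge: "M \<ge> 1"
    and growth: "\<forall>t\<ge>0. \<forall>f\<in>Brho \<rho>. rho_norm \<rho> (P t f) \<le> M * exp (w * t) * rho_norm \<rho> f"
    and nu_radon: "radon_measure \<nu>"
    and nu_prob: "prob_space \<nu>"
    and nu_rho: "(\<integral>\<^sup>+ x. ennreal (\<rho> x) \<partial>\<nu>) < \<infinity>"
    and Pnu_prob: "prob_space Pnu"
    and Pnu_sets: "sets Pnu = sets (PiM {0..} (\<lambda>_. borel :: 'a measure))"
    and filt: "complete_rc_filtration (completion Pnu) F"
    and adapted: "\<forall>t\<ge>0. (\<lambda>\<omega>. \<omega> t) \<in> measurable (F t) borel"
    and init_law: "distr Pnu borel (\<lambda>\<omega>. \<omega> 0) = \<nu>"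
    and markov: "\<forall>s t f. 0 \<le> s \<and> s \<le> t \<and> f \<in> Brho \<rho> \<longrightarrow>
        integrable (completion Pnu) (\<lambda>\<omega>. f (\<omega> t)) \<and>
        (AE \<omega> in completion Pnu.
           real_cond_exp (completion Pnu) (F s) (\<lambda>\<omega>. f (\<omega> t)) \<omega> = P (t - s) f (\<omega> s))"
  shows
    \<comment> \<open>(i)\<close>
    "(\<forall>f :: nat \<Rightarrow> 'a \<Rightarrow> real. range f \<subseteq> Brho \<rho> \<longrightarrow>
       (\<exists>Z :: int \<Rightarrow> nat \<Rightarrow> real \<Rightarrow> (real \<Rightarrow> 'a) \<Rightarrow> real.
          (\<forall>\<beta> n. real_of_int \<beta> > w \<longrightarrow>
              (\<forall>\<omega>\<in>space Pnu. cadlag (\<lambda>t. Z \<beta> n t \<omega>)) \<and>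
              (\<forall>t\<ge>0. Z \<beta> n t \<in> borel_measurable (completion Pnu))) \<and>
          (\<forall>t\<ge>0. \<exists>N. N \<in> null_sets (completion Pnu) \<and> N \<in> sets (F 0) \<and>
              (\<forall>\<omega>\<in>space Pnu - N. \<forall>\<beta> n. real_of_int \<beta> > w \<longrightarrow>
                  real_of_int \<beta> * resolvent P (real_of_int \<beta>) (f n) (\<omega> t) = Z \<beta> n t \<omega>))))
     \<and>
    \<comment> \<open>(ii)\<close>
    ((\<forall>B\<in>sets (borel :: real measure). \<rho> -` B \<in> baire_sets) \<and>
     (\<forall>t\<ge>0. \<forall>f\<in>Brho \<rho>. rho_norm \<rho> (P t f) \<le> exp (w * t) * rho_norm \<rho> f) \<longrightarrow>
       supermartingale (completion Pnu) F (\<lambda>t \<omega>. exp (- w * t) * \<rho> (\<omega> t)) \<and>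
       ((AE x in \<nu>. continuous_on {0..} (\<lambda>t. P_rho \<rho> P t x)) \<longrightarrow>
          (\<exists>Y :: real \<Rightarrow> (real \<Rightarrow> 'a) \<Rightarrow> real.
             (\<forall>\<omega>\<in>space Pnu. cadlag (\<lambda>t. Y t \<omega>)) \<and>
             (\<forall>t\<ge>0. Y t \<in> borel_measurable (completion Pnu) \<and>
                (AE \<omega> in completion Pnu. Y t \<omega> = exp (- w * t) * \<rho> (\<omega> t)))) \<and>
          (\<forall>f :: nat \<Rightarrow> 'a \<Rightarrow> real. range f \<subseteq> Brho \<rho> \<longrightarrow>
             (\<exists>G :: nat \<Rightarrow> real \<Rightarrow> (real \<Rightarrow> 'a) \<Rightarrow> real.
                (\<forall>n. (\<forall>\<omega>\<in>space Pnu. cadlag (\<lambda>t. G n t \<omega>)) \<and>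
                     (\<forall>t\<ge>0. G n t \<in> borel_measurable (completion Pnu))) \<and>
                (\<forall>t\<ge>0. \<exists>N. N \<in> null_sets (completion Pnu) \<and> N \<in> sets (F 0) \<and>
                   (\<forall>\<omega>\<in>space Pnu - N. \<forall>n. f n (\<omega> t) = G n t \<omega>))))))
     \<and>
    \<comment> \<open>(iii)\<close>
    ((\<forall>B\<in>sets (borel :: real measure). \<rho> -` B \<in> baire_sets) \<and>
     (\<forall>t\<ge>0. \<forall>f\<in>Brho \<rho>. rho_norm \<rho> (P t f) \<le> exp (w * t) * rho_norm \<rho> f) \<and>
     (AE x in \<nu>. continuous_on {0..} (\<lambda>t. P_rho \<rho> P t x)) \<and>
     (\<exists>f :: nat \<Rightarrow> 'a \<Rightarrow> real. range f \<subseteq> Brho \<rho> \<and>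
        (\<forall>n. sequentially_continuous (f n)) \<and>
        (\<forall>x y. x \<noteq> y \<longrightarrow> (\<exists>n. f n x \<noteq> f n y))) \<longrightarrow>
       (\<exists>X :: real \<Rightarrow> (real \<Rightarrow> 'a) \<Rightarrow> 'a.
          (\<forall>\<omega>\<in>space Pnu. cadlag (\<lambda>t. X t \<omega>)) \<and>
          (\<forall>t\<ge>0. X t \<in> measurable (completion Pnu) borel \<and>
             (AE \<omega> in completion Pnu. X t \<omega> = \<omega> t))))"
proof -
  let ?N = "completion Pnu"
  interpret W: weighted_semigroup \<rho> P M w
    using E_haus rho_adm feller growth by (rule weighted_semigroup.intro)
  interpret Pnu: prob_space Pnu by (rule Pnu_prob)
  have coord: "(\<lambda>\<omega>. \<omega> 0) \<in> Pnu \<rightarrow>\<^sub>M borel"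
    unfolding measurable_cong_sets[OF Pnu_sets refl] by (rule measurable_component_singleton) simp
  have init: "(\<integral>\<^sup>+\<omega>. ennreal (\<rho> (\<omega> 0)) \<partial>?N) = (\<integral>\<^sup>+x. ennreal (\<rho> x) \<partial>\<nu>)"
    unfolding init_law[symmetric] nn_integral_completion
    by (rule nn_integral_distr[symmetric, OF coord]) measurable
  \<comment> \<open>The coordinate process on the completed path space takes the place of
    \<open>L\<close>.\<close>
  interpret feller_process \<rho> P M w ?N F "\<lambda>t \<omega>. \<omega> t"
  proof (intro feller_process.intro feller_process_axioms.intro)
    show "weighted_semigroup \<rho> P M w" by (rule W.weighted_semigroup_axioms)
    show "prob_space ?N" by (rule prob_spaceI) (simp add: Pnu.emeasure_space_1)
    show "complete_measure ?N" by (rule completion.complete_measure_axioms)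
    show "complete_rc_filtration ?N F" by (rule filt)
    show "(\<integral>\<^sup>+\<omega>. ennreal (\<rho> (\<omega> 0)) \<partial>?N) < \<infinity>" unfolding init by (rule nu_rho)
    show "(\<lambda>\<omega>. \<omega> t) \<in> F t \<rightarrow>\<^sub>M borel" if "0 \<le> t" for t
      using adapted that by blast
    show "integrable ?N (\<lambda>\<omega>. f (\<omega> t))" if "0 \<le> t" "f \<in> Brho \<rho>" for t f
      using markov[rule_format, of t t f] that by simp
    show "AE \<omega> in ?N. real_cond_exp ?N (F s) (\<lambda>\<omega>. f (\<omega> t)) \<omega> = P (t - s) f (\<omega> s)"
      if "0 \<le> s" "s \<le> t" "f \<in> Brho \<rho>" for s t f
      using markov[rule_format, of s t f] that by simp
  qed

  have part1: "\<exists>Z :: int \<Rightarrow> nat \<Rightarrow> real \<Rightarrow> (real \<Rightarrow> 'a) \<Rightarrow> real.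
      (\<forall>\<beta> n. real_of_int \<beta> > w \<longrightarrow>
        (\<forall>\<omega>\<in>space Pnu. cadlag (\<lambda>t. Z \<beta> n t \<omega>)) \<and> (\<forall>t\<ge>0. Z \<beta> n t \<in> borel_measurable ?N)) \<and>
      (\<forall>t\<ge>0. \<exists>N. N \<in> null_sets ?N \<and> N \<in> sets (F 0) \<and>
        (\<forall>\<omega>\<in>space Pnu - N. \<forall>\<beta> n. real_of_int \<beta> > w \<longrightarrow>
          real_of_int \<beta> * resolvent P (real_of_int \<beta>) (f n) (\<omega> t) = Z \<beta> n t \<omega>))"
    if f: "range f \<subseteq> Brho \<rho>" for f :: "nat \<Rightarrow> 'a \<Rightarrow> real"
  proof -
    \<comment> \<open>Both indices are merged into one countable type. The value 0 for parameters at
      most \<open>w\<close>, where the resolvent integral may diverge, keeps the family regular for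
      every index.\<close>
    define \<phi> :: "int \<times> nat \<Rightarrow> 'a \<Rightarrow> real" where
      "\<phi> k x = (if w < real_of_int (fst k) then real_of_int (fst k) * resolvent P (real_of_int (fst k)) (f (snd k)) x else 0)" for k x
    have fn: "f n \<in> Brho \<rho>" for n using f by auto
    have "has_regular_version (\<phi> k)" for k
      by (cases "w < real_of_int (fst k)")
        (auto simp: \<phi>_def[abs_def] intro!: has_regular_version_const has_regular_version_cmult has_regular_version_resolvent fn)
    moreover have "\<phi> k \<in> borel_measurable borel" for k
      using measurable_resolvent[OF fn] unfolding \<phi>_def[abs_def] by measurable
    ultimately obtain G where G: "\<And>k \<omega>. cadlag (\<lambda>t. G k t \<omega>)"
      "\<And>k t. 0 \<le> t \<Longrightarrow> G k t \<in> borel_measurable ?N"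
      "\<And>t. 0 \<le> t \<Longrightarrow> \<exists>Z. Z \<in> null_sets ?N \<and> Z \<in> sets (F 0) \<and> (\<forall>\<omega>\<in>space ?N - Z. \<forall>k. \<phi> k (\<omega> t) = G k t \<omega>)"
      using ex_cadlag_versions[of \<phi>] by blast
    show ?thesis
    proof (intro exI[of _ "\<lambda>\<beta> n. G (\<beta>, n)"] conjI allI impI ballI)
      fix t :: real assume "0 \<le> t"
      from G(3)[OF this] obtain Z where Z: "Z \<in> null_sets ?N" "Z \<in> sets (F 0)"
        "\<And>\<omega> k. \<omega> \<in> space ?N - Z \<Longrightarrow> \<phi> k (\<omega> t) = G k t \<omega>" by blast
      have "real_of_int \<beta> * resolvent P (real_of_int \<beta>) (f n) (\<omega> t) = G (\<beta>, n) t \<omega>"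
        if "\<omega> \<in> space Pnu - Z" "w < real_of_int \<beta>" for \<omega> \<beta> n
        using Z(3)[of \<omega> "(\<beta>, n)"] that by (simp add: \<phi>_def)
      with Z(1,2) show "\<exists>N. N \<in> null_sets ?N \<and> N \<in> sets (F 0) \<and>
        (\<forall>\<omega>\<in>space Pnu - N. \<forall>\<beta> n. real_of_int \<beta> > w \<longrightarrow>
          real_of_int \<beta> * resolvent P (real_of_int \<beta>) (f n) (\<omega> t) = G (\<beta>, n) t \<omega>)" by blast
    qed (rule G; assumption?)+
  qed

  let ?contr = "(\<forall>B\<in>sets (borel :: real measure). \<rho> -` B \<in> baire_sets) \<and>
     (\<forall>t\<ge>0. \<forall>f\<in>Brho \<rho>. rho_norm \<rho> (P t f) \<le> exp (w * t) * rho_norm \<rho> f)"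
  have super: "nonneg_supermartingale ?N F (\<lambda>t \<omega>. exp (- w * t) * \<rho> (\<omega> t))" if ?contr
    using that by (intro nonneg_supermartingale_rho) auto
  have rho: "has_regular_version \<rho>" if ?contr
    using super[OF that] by (rule has_regular_version_of_supermartingale)

  have part2a: "\<exists>Y :: real \<Rightarrow> (real \<Rightarrow> 'a) \<Rightarrow> real.
      (\<forall>\<omega>\<in>space Pnu. cadlag (\<lambda>t. Y t \<omega>)) \<and>
      (\<forall>t\<ge>0. Y t \<in> borel_measurable ?N \<and> (AE \<omega> in ?N. Y t \<omega> = exp (- w * t) * \<rho> (\<omega> t)))" if ?contr
  proof -
    \<comment> \<open>The one-element index type specializes the family version to a single
      function.\<close>
    have "\<exists>G. (\<forall>k::unit. (\<forall>\<omega>. cadlag (\<lambda>t. G k t \<omega>)) \<and> (\<forall>t\<ge>0. G k t \<in> borel_measurable ?N)) \<and>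
      (\<forall>t\<ge>0. \<exists>Z. Z \<in> null_sets ?N \<and> Z \<in> sets (F 0) \<and> (\<forall>\<omega>\<in>space ?N - Z. \<forall>k. \<rho> (\<omega> t) = G k t \<omega>))"
      by (rule ex_cadlag_versions[OF rho[OF that] W.measurable_rho])
    then obtain G where G: "\<And>\<omega>. cadlag (\<lambda>t. G () t \<omega>)"
      "\<And>t. 0 \<le> t \<Longrightarrow> G () t \<in> borel_measurable ?N"
      "\<And>t. 0 \<le> t \<Longrightarrow> \<exists>Z. Z \<in> null_sets ?N \<and> Z \<in> sets (F 0) \<and> (\<forall>\<omega>\<in>space ?N - Z. \<forall>k. \<rho> (\<omega> t) = G k t \<omega>)"
      by blast
    show ?thesis
    proof (intro exI[of _ "\<lambda>t \<omega>. exp (- w * t) * G () t \<omega>"] conjI allI impI ballI)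
      show "cadlag (\<lambda>t. exp (- w * t) * G () t \<omega>)" for \<omega>
        by (rule cadlag_mult_continuous[OF _ G(1)]) (intro continuous_intros)
      fix t :: real assume t: "0 \<le> t"
      show "(\<lambda>\<omega>. exp (- w * t) * G () t \<omega>) \<in> borel_measurable ?N"
        by (intro borel_measurable_times G(2)[OF t]) simp
      from G(3)[OF t] obtain Z where Z: "Z \<in> null_sets ?N" "\<And>\<omega>. \<omega> \<in> space ?N - Z \<Longrightarrow> \<rho> (\<omega> t) = G () t \<omega>"
        by blast
      show "AE \<omega> in ?N. exp (- w * t) * G () t \<omega> = exp (- w * t) * \<rho> (\<omega> t)"
        using AE_not_in[OF Z(1)] AE_space by eventually_elim (use Z(2) in simp)
    qed
  qed

  have part2b: "\<exists>G :: nat \<Rightarrow> real \<Rightarrow> (real \<Rightarrow> 'a) \<Rightarrow> real.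
      (\<forall>n. (\<forall>\<omega>\<in>space Pnu. cadlag (\<lambda>t. G n t \<omega>)) \<and> (\<forall>t\<ge>0. G n t \<in> borel_measurable ?N)) \<and>
      (\<forall>t\<ge>0. \<exists>N. N \<in> null_sets ?N \<and> N \<in> sets (F 0) \<and> (\<forall>\<omega>\<in>space Pnu - N. \<forall>n. f n (\<omega> t) = G n t \<omega>))"
    if ?contr and f: "range f \<subseteq> Brho \<rho>" for f :: "nat \<Rightarrow> 'a \<Rightarrow> real"
  proof -
    have fn: "f n \<in> Brho \<rho>" for n using f by auto
    have "\<exists>G. (\<forall>k. (\<forall>\<omega>. cadlag (\<lambda>t. G k t \<omega>)) \<and> (\<forall>t\<ge>0. G k t \<in> borel_measurable ?N)) \<and>
      (\<forall>t\<ge>0. \<exists>Z. Z \<in> null_sets ?N \<and> Z \<in> sets (F 0) \<and> (\<forall>\<omega>\<in>space ?N - Z. \<forall>k. f k (\<omega> t) = G k t \<omega>))"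
      by (rule ex_cadlag_versions[OF has_regular_version_Brho[OF rho[OF \<open>?contr\<close>] fn] W.Brho_measurable[OF fn]])
    then show ?thesis unfolding space_completion by blast
  qed

  have part3: "\<exists>X :: real \<Rightarrow> (real \<Rightarrow> 'a) \<Rightarrow> 'a.
      (\<forall>\<omega>\<in>space Pnu. cadlag (\<lambda>t. X t \<omega>)) \<and>
      (\<forall>t\<ge>0. X t \<in> measurable ?N borel \<and> (AE \<omega> in ?N. X t \<omega> = \<omega> t))"
    if ?contr and f: "range f \<subseteq> Brho \<rho>" and sep: "\<forall>x y. x \<noteq> y \<longrightarrow> (\<exists>n. f n x \<noteq> f n y)"
    for f :: "nat \<Rightarrow> 'a \<Rightarrow> real"
  proof -
    have fn: "f n \<in> Brho \<rho>" for n using f by auto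
    have "\<exists>X. (\<forall>\<omega>. cadlag (\<lambda>t. X t \<omega>)) \<and>
      (\<forall>t\<ge>0. X t \<in> ?N \<rightarrow>\<^sub>M borel \<and> (AE \<omega> in ?N. X t \<omega> = \<omega> t))"
      by (rule ex_cadlag_process[of f, OF rho[OF \<open>?contr\<close>] fn sep[rule_format]])
    then show ?thesis by blast
  qed

  show ?thesis
  proof (intro conjI allI impI, goal_cases)
    case (1 f)
    then show ?case by (rule part1)
  next
    case 2
    then show ?case by (rule nonneg_supermartingale.supermartingale_X[OF super])
  next
    case 3
    from 3(1) show ?case by (rule part2a)
  next
    case (4 f)
    from 4(1,3) show ?case by (rule part2b)
  next
    case 5
    then obtain f :: "nat \<Rightarrow> 'a \<Rightarrow> real" where "range f \<subseteq> Brho \<rho>" "\<forall>x y. x \<noteq> y \<longrightarrow> (\<exists>n. f n x \<noteq> f n y)"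
      by (elim conjE exE) (rule that)
    moreover from 5 have ?contr by (elim conjE) (intro conjI)
    ultimately show ?case by (intro part3)
  qed
qed

end
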